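(* Let $\mathbb{K}$ be a field and let $P$ be a finite Boolean poset with at least two atoms. Then the zero-divisor graph $\Gamma(P)$ is Cohen--Macaulay (over $\mathbb{K}$).
   Context: For a poset $P$ and $A\subseteq P$, the upper cone is $A^{u}=\{b\in P : b\ge a \text{ for all } a\in A\}$ and the lower cone is $A^{\ell}=\{b\in P : b\le a\text{ for all }a\in A\}$; $A^{u\ell}=(A^{u})^{\ell}$. A poset is bounded if it has a least element $0$ and a greatest element $1$. An atom of $P$ is an element $a>0$ such that there is no $b\in P$ with $0<b<a$. In a bounded poset, $a'$ is a complement of $a$ if $\{a,a'\}^{\ell}=\{0\}$ and $\{a,a'\}^{u}=\{1\}$; a bounded poset is complemented if every element has a complement. A poset is distributive if for all $a,b,c\in P$, $(\{a\}\cup\{b,c\}^{u})^{\ell}=(\{a,b\}^{\ell}\cup\{a,c\}^{\ell})^{u\ell}$. A Boolean poset is a bounded poset that is both distributive and complemented. For a poset $P$ with $0$, the set of zero-divisors is $Z(P)=\{a\in P : \text{there exists } b\in P\setminus\{0\}\text{ with }\{a,b\}^{\ell}=\{0\}\}$. The zero-divisor graph $\Gamma(P)$ is the simple graph with vertex set $Z(P)\setminus\{0\}$ in which two distinct vertices $a,b$ are adjacent if and only if $\{a,b\}^{\ell}=\{0\}$. For a finite simple graph $\Gamma$ on vertices $1,\dots,m$ and a field $\mathbb{K}$, the independence complex $\Delta_\Gamma$ is the simplicial complex whose faces are the independent sets of $\Gamma$. Its Stanley--Reisner ring is $\mathbb{K}[\Delta_\Gamma]=\mathbb{K}[x_1,\dots,x_m]/I(\Gamma)$,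 where $I(\Gamma)=(x_ix_j : \{i,j\}\text{ is an edge of }\Gamma)$. The graph $\Gamma$ is Cohen--Macaulay (over $\mathbb{K}$) if $\mathbb{K}[\Delta_\Gamma]$ is a Cohen--Macaulay ring. *)

theory Defs
  imports "HOL-Algebra.Ring_Divisibility" "HOL-Library.Poly_Mapping" "HOL-Library.Extended_Nat"
begin

section \<open>Boolean posets and the zero-divisor graph\<close>

text \<open>The cones of a set \<open>A\<close> in a poset \<open>P\<close> are \<^term>\<open>Upper P A\<close> and \<^term>\<open>Lower P A\<close>
  of HOL-Algebra. The bounds \<^term>\<open>\<bottom>\<^bsub>P\<^esub>\<close> and \<^term>\<open>\<top>\<^bsub>P\<^esub>\<close> are chosen by \<open>SOME\<close> there, so they are
  meaningful only for posets in which they exist.\<close>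

locale bounded_poset = partial_order P for P (structure) +
  assumes ex_bottom: "\<exists>x. least P x (carrier P)"
    and ex_top: "\<exists>x. greatest P x (carrier P)"

definition poset_atom :: "('a, 'm) gorder_scheme \<Rightarrow> 'a \<Rightarrow> bool" where
  "poset_atom P a \<longleftrightarrow> a \<in> carrier P \<and> \<bottom>\<^bsub>P\<^esub> \<sqsubset>\<^bsub>P\<^esub> a \<and>
     \<not> (\<exists>b \<in> carrier P. \<bottom>\<^bsub>P\<^esub> \<sqsubset>\<^bsub>P\<^esub> b \<and> b \<sqsubset>\<^bsub>P\<^esub> a)"

definition is_complement :: "('a, 'm) gorder_scheme \<Rightarrow> 'a \<Rightarrow> 'a \<Rightarrow> bool" where
  "is_complement P a a' \<longleftrightarrow> Lower P {a, a'} = {\<bottom>\<^bsub>P\<^esub>} \<and> Upper P {a, a'} = {\<top>\<^bsub>P\<^esub>}"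

locale boolean_poset = bounded_poset +
  assumes distributive:
    "\<lbrakk>a \<in> carrier P; b \<in> carrier P; c \<in> carrier P\<rbrakk> \<Longrightarrow>
      Lower P ({a} \<union> Upper P {b, c}) = Lower P (Upper P (Lower P {a, b} \<union> Lower P {a, c}))"
    and complemented:
    "a \<in> carrier P \<Longrightarrow> \<exists>a' \<in> carrier P. is_complement P a a'"

definition zero_divisors :: "('a, 'm) gorder_scheme \<Rightarrow> 'a set" where
  "zero_divisors P =
     {a \<in> carrier P. \<exists>b \<in> carrier P - {\<bottom>\<^bsub>P\<^esub>}. Lower P {a, b} = {\<bottom>\<^bsub>P\<^esub>}}"

definition zero_divisor_graph_verts :: "('a, 'm) gorder_scheme \<Rightarrow> 'a set" where
  "zero_divisor_graph_verts P = zero_divisors P - {\<bottom>\<^bsub>P\<^esub>}"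

definition zero_divisor_graph_edges :: "('a, 'm) gorder_scheme \<Rightarrow> 'a set set" where
  "zero_divisor_graph_edges P =
     {{a, b} | a b. a \<in> zero_divisor_graph_verts P \<and> b \<in> zero_divisor_graph_verts P \<and>
        a \<noteq> b \<and> Lower P {a, b} = {\<bottom>\<^bsub>P\<^esub>}}"


section \<open>Cohen--Macaulay rings\<close>

text \<open>Supremum of the lengths \<open>n\<close> of strict chains of prime ideals
  \<open>C 0 \<subset> \<dots> \<subset> C n\<close>. In \<^typ>\<open>enat\<close> the supremum over no chains is \<open>0\<close>, so the zero ring gets
  dimension \<open>0\<close>; only local, hence nonzero, rings matter below.\<close>

definition krull_dim :: "('a, 'm) ring_scheme \<Rightarrow> enat" where
  "krull_dim R = Sup {enat n | n. \<exists>C :: nat \<Rightarrow> 'a set.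
     (\<forall>i\<le>n. primeideal (C i) R) \<and> (\<forall>i<n. C i \<subset> C (Suc i))}"

text \<open>The first condition says that \<open>x\<^sub>i\<close> is a nonzerodivisor on the ring
  \<open>R / (x\<^sub>0, \<dots>, x\<^bsub>i-1\<^esub>)\<close>, written with representatives.\<close>

definition regular_sequence :: "('a, 'm) ring_scheme \<Rightarrow> 'a list \<Rightarrow> bool" where
  "regular_sequence R xs \<longleftrightarrow> set xs \<subseteq> carrier R \<and>
     (\<forall>i<length xs. \<forall>a \<in> carrier R.
        xs ! i \<otimes>\<^bsub>R\<^esub> a \<in> Idl\<^bsub>R\<^esub> (set (take i xs)) \<longrightarrow> a \<in> Idl\<^bsub>R\<^esub> (set (take i xs))) \<and>
     Idl\<^bsub>R\<^esub> (set xs) \<noteq> carrier R"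

definition local_ring :: "('a, 'm) ring_scheme \<Rightarrow> 'a set \<Rightarrow> bool" where
  "local_ring R M \<longleftrightarrow> cring R \<and> {I. maximalideal I R} = {M}"

definition depth :: "('a, 'm) ring_scheme \<Rightarrow> 'a set \<Rightarrow> enat" where
  "depth R M = Sup {enat (length xs) | xs. regular_sequence R xs \<and> set xs \<subseteq> M}"

definition cohen_macaulay_local_ring :: "('a, 'm) ring_scheme \<Rightarrow> bool" where
  "cohen_macaulay_local_ring R \<longleftrightarrow>
     noetherian_ring R \<and> (\<exists>M. local_ring R M \<and> depth R M = krull_dim R)"

text \<open>Localization at a multiplicative set \<open>S\<close>: the fraction \<open>a / s\<close> is the class of \<open>(a, s)\<close>.
  The extra factor \<open>u\<close> is needed because \<open>R\<close> may have zero divisors.\<close>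

definition frac_rel :: "('a, 'm) ring_scheme \<Rightarrow> 'a set \<Rightarrow> (('a \<times> 'a) \<times> ('a \<times> 'a)) set" where
  "frac_rel R S = {((a, s), (b, t)). a \<in> carrier R \<and> s \<in> S \<and> b \<in> carrier R \<and> t \<in> S \<and>
     (\<exists>u \<in> S. u \<otimes>\<^bsub>R\<^esub> (t \<otimes>\<^bsub>R\<^esub> a) = u \<otimes>\<^bsub>R\<^esub> (s \<otimes>\<^bsub>R\<^esub> b))}"

definition localization :: "('a, 'm) ring_scheme \<Rightarrow> 'a set \<Rightarrow> ('a \<times> 'a) set ring" where
  "localization R S =
     \<lparr>carrier = (carrier R \<times> S) // frac_rel R S,
      mult = (\<lambda>X Y. \<Union>(a, s)\<in>X. \<Union>(b, t)\<in>Y. frac_rel R S `` {(a \<otimes>\<^bsub>R\<^esub> b, s \<otimes>\<^bsub>R\<^esub> t)}),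
      one = frac_rel R S `` {(\<one>\<^bsub>R\<^esub>, \<one>\<^bsub>R\<^esub>)},
      zero = frac_rel R S `` {(\<zero>\<^bsub>R\<^esub>, \<one>\<^bsub>R\<^esub>)},
      add = (\<lambda>X Y. \<Union>(a, s)\<in>X. \<Union>(b, t)\<in>Y.
        frac_rel R S `` {(t \<otimes>\<^bsub>R\<^esub> a \<oplus>\<^bsub>R\<^esub> s \<otimes>\<^bsub>R\<^esub> b, s \<otimes>\<^bsub>R\<^esub> t)})\<rparr>"

definition cohen_macaulay_ring :: "('a, 'm) ring_scheme \<Rightarrow> bool" where
  "cohen_macaulay_ring R \<longleftrightarrow> cring R \<and> noetherian_ring R \<and>
     (\<forall>M. maximalideal M R \<longrightarrow> cohen_macaulay_local_ring (localization R (carrier R - M)))"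


section \<open>The Stanley--Reisner ring of the independence complex of a graph\<close>

text \<open>The polynomial ring with coefficients in the type \<open>'k\<close> and one variable for each element of \<open>V\<close>.
  A monomial is a finitely supported exponent function \<^typ>\<open>'v \<Rightarrow>\<^sub>0 nat\<close>, a polynomial is a
  finitely supported coefficient function on monomials; multiplication is convolution.\<close>

type_synonym ('v, 'k) mpoly = "('v \<Rightarrow>\<^sub>0 nat) \<Rightarrow>\<^sub>0 'k"

definition mpoly_ring :: "'k::field itself \<Rightarrow> 'v set \<Rightarrow> ('v, 'k) mpoly ring" where
  "mpoly_ring K V =
     \<lparr>carrier = {p. \<forall>m \<in> Poly_Mapping.keys p. Poly_Mapping.keys m \<subseteq> V},
      mult = (*), one = 1, zero = 0, add = (+)\<rparr>"

definition poly_var :: "'v \<Rightarrow> ('v, 'k::field) mpoly" where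
  "poly_var v = Poly_Mapping.single (Poly_Mapping.single v 1) 1"

definition edge_ideal :: "'k::field itself \<Rightarrow> 'v set \<Rightarrow> 'v set set \<Rightarrow> ('v, 'k) mpoly set" where
  "edge_ideal K V E =
     Idl\<^bsub>mpoly_ring K V\<^esub> {poly_var i * poly_var j | i j. i \<in> V \<and> j \<in> V \<and> {i, j} \<in> E}"

definition stanley_reisner_ring ::
    "'k::field itself \<Rightarrow> 'v set \<Rightarrow> 'v set set \<Rightarrow> ('v, 'k) mpoly set ring" where
  "stanley_reisner_ring K V E = mpoly_ring K V Quot edge_ideal K V E"

definition cohen_macaulay_graph :: "'k::field itself \<Rightarrow> 'v set \<Rightarrow> 'v set set \<Rightarrow> bool" where
  "cohen_macaulay_graph K V E \<longleftrightarrow> cohen_macaulay_ring (stanley_reisner_ring K V E)"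

end

theory Submission
  imports Defs "HOL-Computational_Algebra.Polynomial"
begin

text \<open>Fix an atom \<open>p\<close>. Let \<open>N\<close> be the set of vertices of the graph that do not lie above \<open>p\<close>. Complementation
  \<open>a \<mapsto> a'\<close> is a bijection from \<open>N\<close> onto the set of vertices above \<open>p\<close>. Two vertices above \<open>p\<close> have
  the common lower bound \<open>p\<close> and are never adjacent; \<open>a \<in> N\<close> is adjacent to \<open>b'\<close> if and only if \<open>a \<le> b\<close>,
  by distributivity. So the graph is given by the finite poset \<open>N\<close>, with two vertices \<open>a\<close> and \<open>a'\<close> for every
  element, edges \<open>{a, b'}\<close> for \<open>a \<le> b\<close>, and edges \<open>{a, b}\<close> for disjoint \<open>a\<close> and \<open>b\<close>.
  Disjointness is symmetric, irreflexive and inherited by smaller elements. The locale \<open>paired_order\<close> keeps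
  only this information.

  Write \<open>n = |N|\<close>, let \<open>S\<close> be the polynomial ring with variables \<open>x\<^sub>a\<close> and \<open>y\<^sub>a\<close> for the vertices \<open>a\<close> and \<open>a'\<close>, let \<open>I\<close> be the
  edge ideal and \<open>M \<supseteq> I\<close> a maximal ideal of \<open>S\<close>. Let \<open>R\<close> be the localization of \<open>S/I\<close> at \<open>M\<close>. It suffices
  that \<open>dim R \<le> n\<close> and that \<open>R\<close> has a regular sequence of length \<open>n\<close>, because the depth of a local ring
  never exceeds its dimension (\<open>depth_le_krull_dim\<close>).

  The dimension is at most \<open>n\<close> since every prime ideal over \<open>I\<close> contains \<open>x\<^sub>a y\<^sub>a\<close> and hence one
  of the two variables. Modulo the prime there are at most \<open>n\<close> algebraically independent variables, and
  this number drops along a strict chain of primes (\<open>prime_chain_length\<close>).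

  For the regular sequence, one of \<open>x\<^sub>a\<close>, \<open>y\<^sub>a\<close> lies in \<open>M\<close>, so \<open>x\<^sub>a + y\<^sub>a\<close> is
  congruent to a variable modulo \<open>M\<close>. By Zariski's lemma (\<open>variable_algebraic_mod_maximal\<close>)
  there is a nonzero univariate polynomial \<open>F\<^sub>a\<close> with \<open>F\<^sub>a(x\<^sub>a + y\<^sub>a) \<in> M\<close>. These \<open>n\<close> elements form
  a regular sequence on \<open>S/I\<close>, for arbitrary nonzero \<open>F\<^sub>a\<close> (\<open>weakly_regular_parameters\<close>). To see this, pick
  \<open>i \<in> N\<close> minimal. Both \<open>I + (x\<^sub>i)\<close> and the colon ideal \<open>(I : x\<^sub>i)\<close> are ideals of the same kind in
  which some pairs are decided, that is, one variable of the pair is a generator and the other one is free.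
  Regularity modulo these two ideals gives regularity modulo \<open>I\<close> (\<open>weakly_regular_colon\<close>), so one
  can induct on the number of undecided pairs. Once all pairs are decided, the ideal is generated by one
  variable of each pair, \<open>x\<^sub>a + y\<^sub>a\<close> is congruent to the other variable, and the claim concerns nonzero
  univariate polynomials in distinct variables (\<open>eval_at_var_nonzerodivisor\<close>).

  Working with \<open>F\<^sub>a(x\<^sub>a + y\<^sub>a)\<close> instead of \<open>x\<^sub>a + y\<^sub>a\<close> treats all maximal ideals alike, over every field.\<close>

section \<open>Prime ideals and regular sequences\<close>

text \<open>An ideal that is maximal among those containing \<open>I\<close> and avoiding \<open>T\<close> is prime: if it contained \<open>ab\<close> but
  neither \<open>a\<close> nor \<open>b\<close>, then enlarging it by \<open>a\<close> and by \<open>b\<close> would reach two elements of \<open>T\<close>, and their product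
  would lie both in \<open>T\<close> and in the ideal.\<close>
lemma (in cring) prime_avoiding_multiplicative_set:
  assumes I: "ideal I R" and T1: "\<one> \<in> T" and TR: "T \<subseteq> carrier R"
    and Tm: "\<And>s t. s \<in> T \<Longrightarrow> t \<in> T \<Longrightarrow> s \<otimes> t \<in> T" and disjoint: "I \<inter> T = {}"
  obtains Q where "primeideal Q R" "I \<subseteq> Q" "Q \<inter> T = {}"
proof -
  let ?A = "{J. ideal J R \<and> I \<subseteq> J \<and> J \<inter> T = {}}"
  have "\<exists>Q\<in>?A. \<forall>X\<in>?A. Q \<subseteq> X \<longrightarrow> X = Q"
  proof (rule subset_Zorn_nonempty)
    show "?A \<noteq> {}" using I disjoint by auto
    fix C assume "C \<noteq> {}" and C: "subset.chain ?A C"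
    have CA: "C \<subseteq> ?A" using C by (simp add: subset_chain_def)
    have "subset.chain {I. ideal I R} C"
      using C CA by (auto simp: subset_chain_def)
    then have "ideal (\<Union>C) R" using chain_Union_is_ideal[of C] \<open>C \<noteq> {}\<close> by simp
    then show "\<Union>C \<in> ?A" using CA \<open>C \<noteq> {}\<close> by blast
  qed
  then obtain Q where QA: "Q \<in> ?A" and Qmax: "\<forall>X\<in>?A. Q \<subseteq> X \<longrightarrow> X = Q" ..
  have Q: "ideal Q R" "I \<subseteq> Q" "Q \<inter> T = {}" using QA by auto
  have max: "J = Q" if "ideal J R" "I \<subseteq> J" "J \<inter> T = {}" "Q \<subseteq> J" for J
    using Qmax that by auto
  interpret Q: ideal Q R by fact
  have meets: "\<exists>q\<in>Q. \<exists>r\<in>carrier R. q \<oplus> r \<otimes> a \<in> T" if a: "a \<in> carrier R" "a \<notin> Q" for a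
  proof -
    have id: "ideal (Q <+> PIdl a) R" using add_ideals[OF Q(1) cgenideal_ideal[OF a(1)]] .
    have elem: "q \<oplus> r \<otimes> a \<in> Q <+> PIdl a" if "q \<in> Q" "r \<in> carrier R" for q r
      unfolding set_add_def' cgenideal_def using that by auto
    have sub: "Q \<subseteq> Q <+> PIdl a"
      using elem[of _ \<zero>] a(1) Q.Icarr by auto
    have "a \<in> Q <+> PIdl a"
      using elem[of \<zero> \<one>] a(1) Q.zero_closed by auto
    then have "(Q <+> PIdl a) \<inter> T \<noteq> {}" using max[OF id _ _ sub] a(2) Q(2) sub by auto
    then show ?thesis unfolding set_add_def' cgenideal_def by auto
  qed
  have "primeideal Q R"
  proof (rule primeidealI)
    show "carrier R \<noteq> Q" using T1 Q(3) by auto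
    fix a b assume ab: "a \<in> carrier R" "b \<in> carrier R" "a \<otimes> b \<in> Q"
    show "a \<in> Q \<or> b \<in> Q"
    proof (rule ccontr)
      assume "\<not> (a \<in> Q \<or> b \<in> Q)"
      then obtain q r q' r' where q: "q \<in> Q" "r \<in> carrier R" "q \<oplus> r \<otimes> a \<in> T"
        and q': "q' \<in> Q" "r' \<in> carrier R" "q' \<oplus> r' \<otimes> b \<in> T" using meets ab by metis
      have c: "q \<in> carrier R" "q' \<in> carrier R" using q q' Q.Icarr by auto
      have "(q \<oplus> r \<otimes> a) \<otimes> (q' \<oplus> r' \<otimes> b)
          = (q' \<oplus> r' \<otimes> b) \<otimes> q \<oplus> ((r \<otimes> a) \<otimes> q' \<oplus> (r \<otimes> r') \<otimes> (a \<otimes> b))"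
        using ab q(2) q'(2) c by algebra
      also have "\<dots> \<in> Q"
        using ab q(1,2) q'(1,2) c Q.I_l_closed[OF q(1), of "q' \<oplus> r' \<otimes> b"] Q.I_l_closed[OF q'(1), of "r \<otimes> a"]
          Q.I_l_closed[OF ab(3), of "r \<otimes> r'"] by auto
      finally show False using Tm[OF q(3) q'(3)] Q(3) by auto
    qed
  qed (use Q is_cring in auto)
  then show thesis using that Q by auto
qed

lemma (in cring) Idl_Un_singleton:
  assumes J: "ideal J R" and x: "x \<in> carrier R"
  shows "Idl (J \<union> {x}) = {j \<oplus> s \<otimes> x | j s. j \<in> J \<and> s \<in> carrier R}"
proof -
  interpret J: ideal J R by fact
  have "Idl (J \<union> PIdl x) = J <+> PIdl x"
    using union_genideal[OF J cgenideal_ideal[OF x]] .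
  also have "\<dots> = {j \<oplus> s \<otimes> x | j s. j \<in> J \<and> s \<in> carrier R}"
    unfolding set_add_def' cgenideal_def by auto
  also have "Idl (J \<union> PIdl x) = Idl (J \<union> {x})"
  proof (rule antisym)
    have sub: "J \<union> {x} \<subseteq> carrier R" using J.a_subset x by auto
    have sub': "J \<union> PIdl x \<subseteq> carrier R" using J.a_subset x by (auto simp: cgenideal_def)
    show "Idl (J \<union> {x}) \<subseteq> Idl (J \<union> PIdl x)"
      using genideal_self[OF sub'] cgenideal_self[OF x]
      by (intro genideal_minimal genideal_ideal sub') auto
    have i: "ideal (Idl (J \<union> {x})) R" by (rule genideal_ideal[OF sub])
    show "Idl (J \<union> PIdl x) \<subseteq> Idl (J \<union> {x})"
      using genideal_self[OF sub] cgenideal_minimal[OF i, of x]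
      by (intro genideal_minimal i) auto
  qed
  finally show ?thesis .
qed

lemma (in ring) Idl_Idl_Un:
  assumes "A \<subseteq> carrier R" "B \<subseteq> carrier R"
  shows "Idl (Idl A \<union> B) = Idl (A \<union> B)"
proof (rule antisym)
  have i: "ideal (Idl (A \<union> B)) R" "A \<union> B \<subseteq> Idl (A \<union> B)"
    using assms genideal_ideal[of "A \<union> B"] genideal_self[of "A \<union> B"] by auto
  have i2: "ideal (Idl A) R" "A \<subseteq> Idl A" using assms genideal_ideal[of A] genideal_self[of A] by auto
  have "Idl A \<subseteq> Idl (A \<union> B)" using i by (intro genideal_minimal) auto
  then show "Idl (Idl A \<union> B) \<subseteq> Idl (A \<union> B)" using i by (intro genideal_minimal) auto
  have c: "Idl A \<union> B \<subseteq> carrier R" using assms i2 by (simp add: additive_subgroup.a_subset ideal.axioms(1))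
  show "Idl (A \<union> B) \<subseteq> Idl (Idl A \<union> B)"
    using i2 genideal_self[OF c] by (intro genideal_minimal genideal_ideal c) auto
qed

lemma (in ring) Idl_ideal: "ideal J R \<Longrightarrow> Idl J = J"
  by (meson additive_subgroup.a_subset genideal_minimal genideal_self ideal.axioms(1) subset_antisym order_refl)

text \<open>A regular sequence on \<open>R/J\<close>, without the condition that the sequence and \<open>J\<close> generate a proper ideal. The
  recursive form fits the induction in \<open>weakly_regular_colon\<close>; \<open>weakly_regular_nth\<close> connects it
  with \<^const>\<open>regular_sequence\<close>.\<close>
primrec weakly_regular :: "('a, 'm) ring_scheme \<Rightarrow> 'a set \<Rightarrow> 'a list \<Rightarrow> bool" where
  "weakly_regular R J [] \<longleftrightarrow> True"
| "weakly_regular R J (g # gs) \<longleftrightarrow> (\<forall>a\<in>carrier R. g \<otimes>\<^bsub>R\<^esub> a \<in> J \<longrightarrow> a \<in> J) \<and>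
     weakly_regular R (Idl\<^bsub>R\<^esub> (J \<union> {g})) gs"

lemma (in cring) weakly_regular_nth:
  assumes "ideal J R" "set gs \<subseteq> carrier R"
  shows "weakly_regular R J gs \<longleftrightarrow> (\<forall>i<length gs. \<forall>a \<in> carrier R.
     gs ! i \<otimes> a \<in> Idl (J \<union> set (take i gs)) \<longrightarrow> a \<in> Idl (J \<union> set (take i gs)))"
  using assms
proof (induction gs arbitrary: J)
  case Nil
  then show ?case by simp
next
  case (Cons g gs)
  have J: "J \<subseteq> carrier R" "g \<in> carrier R" using Cons.prems by (auto simp: additive_subgroup.a_subset ideal.axioms(1))
  have id: "ideal (Idl (J \<union> {g})) R" using J by (intro genideal_ideal) auto
  have tk: "Idl (Idl (J \<union> {g}) \<union> set (take i gs)) = Idl (J \<union> set (take (Suc i) (g # gs)))" for i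
  proof -
    have "set (take i gs) \<subseteq> carrier R" using Cons.prems(2) set_take_subset[of i gs] by auto
    then show ?thesis using J by (subst Idl_Idl_Un) (auto simp: Un_assoc)
  qed
  have "weakly_regular R (Idl (J \<union> {g})) gs \<longleftrightarrow> (\<forall>i<length gs. \<forall>a \<in> carrier R.
     (g # gs) ! Suc i \<otimes> a \<in> Idl (J \<union> set (take (Suc i) (g # gs))) \<longrightarrow> a \<in> Idl (J \<union> set (take (Suc i) (g # gs))))"
    using Cons.IH[OF id] Cons.prems(2) tk by simp
  moreover have "(\<forall>a\<in>carrier R. g \<otimes> a \<in> J \<longrightarrow> a \<in> J) \<longleftrightarrow> (\<forall>a \<in> carrier R.
     (g # gs) ! 0 \<otimes> a \<in> Idl (J \<union> set (take 0 (g # gs))) \<longrightarrow> a \<in> Idl (J \<union> set (take 0 (g # gs))))"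
    using Idl_ideal[OF Cons.prems(1)] by simp
  ultimately show ?case by (simp only: weakly_regular.simps length_Cons All_less_Suc2)
qed

text \<open>This is the regularity criterion for the exact sequence \<open>0 \<rightarrow> R/(I : x) \<rightarrow> R/I \<rightarrow> R/(I + (x)) \<rightarrow> 0\<close>. The
  sequence stays exact after dividing out the first element \<open>g\<close>, since \<open>g\<close> is a nonzerodivisor on the right-hand
  term; hence the two equations \<open>sum'\<close> and \<open>sum''\<close> below, which make the induction work.\<close>
lemma (in cring) weakly_regular_colon:
  assumes "ideal I R" "x \<in> carrier R" "set gs \<subseteq> carrier R"
    and "weakly_regular R {b \<in> carrier R. x \<otimes> b \<in> I} gs"
    and "weakly_regular R (Idl (I \<union> {x})) gs"
  shows "weakly_regular R I gs"
  using assms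
proof (induction gs arbitrary: I)
  case Nil
  then show ?case by simp
next
  case (Cons g gs)
  let ?I' = "{b \<in> carrier R. x \<otimes> b \<in> I}" and ?I'' = "Idl (I \<union> {x})"
  note x = \<open>x \<in> carrier R\<close>
  interpret I: ideal I R by fact
  have g: "g \<in> carrier R" and gs: "set gs \<subseteq> carrier R" using Cons.prems by auto
  have I': "ideal ?I' R"
  proof (rule idealI)
    show "subgroup ?I' (add_monoid R)"
    proof (rule add.subgroupI)
      show "?I' \<noteq> {}" using x by (auto intro!: exI[of _ \<zero>])
      show "\<ominus> a \<in> ?I'" if "a \<in> ?I'" for a using that x by (simp add: r_minus)
      show "a \<oplus> b \<in> ?I'" if "a \<in> ?I'" "b \<in> ?I'" for a b using that x by (simp add: r_distr)
    qed auto
    show "c \<otimes> a \<in> ?I'" if "a \<in> ?I'" "c \<in> carrier R" for a c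
      using that x by (simp add: m_lcomm[of x c a] I.I_l_closed)
    show "a \<otimes> c \<in> ?I'" if "a \<in> ?I'" "c \<in> carrier R" for a c
      using that x by (simp add: m_assoc[symmetric] I.I_r_closed)
  qed (rule ring_axioms)
  have Isub: "I \<union> {x} \<subseteq> carrier R" using x I.a_subset by auto
  have I'': "ideal ?I'' R" by (rule genideal_ideal[OF Isub])
  interpret I'': ideal ?I'' R by fact
  have mem: "p \<in> ?I'' \<longleftrightarrow> (\<exists>j s. p = j \<oplus> s \<otimes> x \<and> j \<in> I \<and> s \<in> carrier R)" for p
    by (subst Idl_Un_singleton[OF Cons.prems(1) x]) auto
  have nzd': "b \<in> ?I'" if "g \<otimes> b \<in> ?I'" "b \<in> carrier R" for b
    using Cons.prems(4) that by auto
  have nzd'': "b \<in> ?I''" if "g \<otimes> b \<in> ?I''" "b \<in> carrier R" for b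
    using Cons.prems(5) that by auto
  have IsubI'': "I \<subseteq> ?I''" using genideal_self[OF Isub] by auto
  have nzd: "a \<in> I" if a: "a \<in> carrier R" and ga: "g \<otimes> a \<in> I" for a
  proof -
    obtain j s where js: "a = j \<oplus> s \<otimes> x" "j \<in> I" "s \<in> carrier R"
      using nzd''[OF _ a] ga IsubI'' mem[of a] by auto
    have jc: "j \<in> carrier R" using js by auto
    have "x \<otimes> (g \<otimes> s) = g \<otimes> a \<ominus> g \<otimes> j" using js(1,3) jc g x by algebra
    also have "\<dots> \<in> I" using ga js(2) g by (metis I.I_l_closed I.a_closed I.a_inv_closed minus_eq)
    finally have "s \<in> ?I'" using nzd'[of s] js(3) g by auto
    then show ?thesis using js x by (auto simp: m_comm)
  qed
  let ?J = "Idl (I \<union> {g})"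
  have Jsub: "I \<union> {g} \<subseteq> carrier R" using g I.a_subset by auto
  have J: "ideal ?J R" by (rule genideal_ideal[OF Jsub])
  interpret J: ideal ?J R by fact
  have memJ: "p \<in> ?J \<longleftrightarrow> (\<exists>j s. p = j \<oplus> s \<otimes> g \<and> j \<in> I \<and> s \<in> carrier R)" for p
    by (subst Idl_Un_singleton[OF Cons.prems(1) g]) auto
  have sum'': "Idl (?J \<union> {x}) = Idl (?I'' \<union> {g})"
    using I.a_subset g x Idl_Idl_Un[of "I \<union> {g}" "{x}"] Idl_Idl_Un[of "I \<union> {x}" "{g}"]
    by (simp add: insert_commute)
  have sum': "{b \<in> carrier R. x \<otimes> b \<in> ?J} = Idl (?I' \<union> {g})"
  proof (intro Set.set_eqI iffI)
    fix b assume "b \<in> {b \<in> carrier R. x \<otimes> b \<in> ?J}"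
    then obtain j c where b: "b \<in> carrier R" and jc: "x \<otimes> b = j \<oplus> c \<otimes> g" "j \<in> I" "c \<in> carrier R"
      using memJ by auto
    have j: "j \<in> carrier R" using jc by auto
    have "g \<otimes> c = b \<otimes> x \<ominus> j" using jc(1,3) j b g x by algebra
    moreover have "b \<otimes> x \<ominus> j \<in> ?I''"
      unfolding mem using b jc(2) j x by (intro exI[of _ "\<ominus> j"] exI[of _ b]) (auto simp: minus_eq a_comm)
    ultimately obtain j1 d where d: "c = j1 \<oplus> d \<otimes> x" "j1 \<in> I" "d \<in> carrier R"
      using nzd''[of c] jc(3) mem[of c] by auto
    have j1: "j1 \<in> carrier R" using d by auto
    have "x \<otimes> (b \<ominus> d \<otimes> g) = j \<oplus> j1 \<otimes> g" using jc(1) d(1,3) j j1 b g x by algebra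
    also have "\<dots> \<in> I" using jc(2) d(2) g by (simp add: I.I_r_closed)
    finally have 1: "b \<ominus> d \<otimes> g \<in> ?I'" using b d(3) g by auto
    have "b = (b \<ominus> d \<otimes> g) \<oplus> d \<otimes> g" using b d(3) g by algebra
    then show "b \<in> Idl (?I' \<union> {g})"
      using 1 d(3) Idl_Un_singleton[OF I' g] by blast
  next
    fix b assume "b \<in> Idl (?I' \<union> {g})"
    then obtain j c where b: "b = j \<oplus> c \<otimes> g" "j \<in> carrier R" "x \<otimes> j \<in> I" "c \<in> carrier R"
      using Idl_Un_singleton[OF I' g] by auto
    have "x \<otimes> b = x \<otimes> j \<oplus> (x \<otimes> c) \<otimes> g" using b x g by algebra
    then show "b \<in> {b \<in> carrier R. x \<otimes> b \<in> ?J}" using b x g memJ by auto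
  qed
  have "weakly_regular R ?J gs"
  proof (rule Cons.IH[OF J x gs])
    show "weakly_regular R {b \<in> carrier R. x \<otimes> b \<in> ?J} gs"
      unfolding sum' using Cons.prems(4) by simp
    show "weakly_regular R (Idl (?J \<union> {x})) gs"
      unfolding sum'' using Cons.prems(5) by simp
  qed
  then show ?case using nzd by simp
qed

text \<open>The chain is built downwards from \<open>P\<close>. Let \<open>I\<close> be the ideal of all elements of the sequence except the last one, \<open>g\<close>.
  As \<open>g\<close> is a nonzerodivisor modulo \<open>I \<subseteq> P\<close>, no product \<open>s g\<^sup>n\<close> with \<open>s \<notin> P\<close> lies in \<open>I\<close>. A prime that contains
  \<open>I\<close> and avoids these products is contained in \<open>P\<close> and does not contain \<open>g\<close>.\<close>
lemma (in cring) prime_chain_of_regular_sequence: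
  assumes "primeideal P R" "set gs \<subseteq> P"
    and "\<forall>i<length gs. \<forall>a\<in>carrier R. gs ! i \<otimes> a \<in> Idl (set (take i gs)) \<longrightarrow> a \<in> Idl (set (take i gs))"
  shows "\<exists>C. (\<forall>i\<le>length gs. primeideal (C i) R) \<and> (\<forall>i<length gs. C i \<subset> C (Suc i)) \<and> C (length gs) = P"
  using assms
proof (induction gs arbitrary: P rule: rev_induct)
  case Nil
  then show ?case by (intro exI[of _ "\<lambda>_. P"]) auto
next
  case (snoc g gs)
  interpret P: primeideal P R by fact
  let ?I = "Idl (set gs)"
  define T where "T = {s \<otimes> g [^] n | s (n::nat). s \<in> carrier R - P}"
  have P: "set gs \<subseteq> P" "g \<in> P" using snoc.prems by auto
  then have c: "set gs \<subseteq> carrier R" "g \<in> carrier R" using P.a_subset by auto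
  interpret I: ideal ?I R by (rule genideal_ideal[OF c(1)])
  have nzd: "a \<in> ?I" if "a \<in> carrier R" "g \<otimes> a \<in> ?I" for a
    using snoc.prems(3) that by (auto dest!: spec[of _ "length gs"])
  have nzdn: "a \<in> ?I" if "a \<in> carrier R" "a \<otimes> g [^] (n::nat) \<in> ?I" for a n
    using that(2)
  proof (induction n)
    case 0
    then show ?case using that(1) by simp
  next
    case (Suc n)
    have c': "a \<otimes> g [^] n \<in> carrier R" using that(1) c(2) by simp
    have "g \<otimes> (a \<otimes> g [^] n) = a \<otimes> g [^] Suc n"
      using that(1) c(2) by (simp add: m_lcomm[of g a] m_comm[of g "g [^] n"])
    then have "g \<otimes> (a \<otimes> g [^] n) \<in> ?I" using Suc.prems by metis
    then show ?case by (rule Suc.IH[OF nzd[OF c']])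
  qed
  have IP: "?I \<subseteq> P" by (rule genideal_minimal[OF P.is_ideal P(1)])
  have one: "\<one> \<in> carrier R - P" using P.I_notcarr P.one_imp_carrier by auto
  obtain Q where Q: "primeideal Q R" "?I \<subseteq> Q" "Q \<inter> T = {}"
  proof (rule prime_avoiding_multiplicative_set[OF I.is_ideal])
    show "\<one> \<in> T" unfolding T_def using one by (auto intro!: exI[of _ \<one>] exI[of _ 0])
    show "T \<subseteq> carrier R" unfolding T_def using c by auto
    show "x \<otimes> y \<in> T" if xy: "x \<in> T" "y \<in> T" for x y
    proof -
      obtain s n s' n' where s: "x = s \<otimes> g [^] (n::nat)" "s \<in> carrier R - P"
        and s': "y = s' \<otimes> g [^] (n'::nat)" "s' \<in> carrier R - P"
        using xy unfolding T_def by auto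
      have "x \<otimes> y = (s \<otimes> s') \<otimes> (g [^] n \<otimes> g [^] n')" unfolding s s'
        using s(2) s'(2) nat_pow_closed[OF c(2), of n] nat_pow_closed[OF c(2), of n'] by (simp add: m_ac)
      then have "x \<otimes> y = (s \<otimes> s') \<otimes> g [^] (n + n')" using c(2) by (simp add: nat_pow_mult)
      moreover have "s \<otimes> s' \<in> carrier R - P" using s(2) s'(2) P.I_prime by auto
      ultimately show ?thesis unfolding T_def by blast
    qed
    show "?I \<inter> T = {}" unfolding T_def using nzdn IP by blast
  qed (use that in auto)
  interpret Q: primeideal Q R by fact
  have inT: "s \<in> T" if "s \<in> carrier R - P" for s
    unfolding T_def using that by (auto intro!: exI[of _ s] exI[of _ 0])
  then have QP: "Q \<subseteq> P" using Q(3) Q.a_subset by blast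
  have "g \<in> T" unfolding T_def using one c(2) by (auto intro!: exI[of _ \<one>] exI[of _ 1])
  then have QP': "Q \<subset> P" using QP P(2) Q(3) by blast
  have "\<exists>C. (\<forall>i\<le>length gs. primeideal (C i) R) \<and> (\<forall>i<length gs. C i \<subset> C (Suc i)) \<and> C (length gs) = Q"
  proof (rule snoc.IH[OF Q(1)])
    show "set gs \<subseteq> Q" using Q(2) genideal_self[OF c(1)] by auto
    show "\<forall>i<length gs. \<forall>a\<in>carrier R. gs ! i \<otimes> a \<in> Idl (set (take i gs)) \<longrightarrow> a \<in> Idl (set (take i gs))"
      using snoc.prems(3) by (auto simp: nth_append all_conj_distrib less_Suc_eq)
  qed
  then obtain C where C: "\<forall>i\<le>length gs. primeideal (C i) R" "\<forall>i<length gs. C i \<subset> C (Suc i)" "C (length gs) = Q"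
    by blast
  show ?case
    using C QP' snoc.prems(1)
    by (intro exI[of _ "\<lambda>i. if i \<le> length gs then C i else P"]) (auto simp: less_Suc_eq le_Suc_eq)
qed

lemma (in cring) depth_le_krull_dim:
  assumes "primeideal M R"
  shows "depth R M \<le> krull_dim R"
  unfolding depth_def
proof (rule Sup_least)
  fix d assume "d \<in> {enat (length xs) |xs. regular_sequence R xs \<and> set xs \<subseteq> M}"
  then obtain xs where xs: "d = enat (length xs)" "regular_sequence R xs" "set xs \<subseteq> M" by auto
  then show "d \<le> krull_dim R"
    unfolding krull_dim_def xs(1) using prime_chain_of_regular_sequence[OF assms xs(3)] xs(2)
    by (intro Sup_upper) (auto simp: regular_sequence_def)
qed

section \<open>Rings of fractions\<close>

text \<open>The homomorphism \<open>h\<close> presents \<open>S\<close> as the ring of fractions of \<open>R/I\<close> with denominators \<open>W\<close>. Describing \<open>S\<close> by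
  \<open>h\<close> covers the quotient \<open>R/I\<close> itself (with \<open>W = {\<one>}\<close>) and its localizations, and transports
  everything in one step from \<open>R\<close> to \<open>S\<close>.\<close>
locale ring_of_fractions = ring_hom_cring R S h + I: ideal I R
  for R (structure) and S (structure) and h and I +
  fixes W
  assumes denoms: "W \<subseteq> carrier R" "\<one> \<in> W" "\<And>v w. v \<in> W \<Longrightarrow> w \<in> W \<Longrightarrow> v \<otimes> w \<in> W"
    and unit: "w \<in> W \<Longrightarrow> h w \<in> Units S"
    and fraction: "q \<in> carrier S \<Longrightarrow> \<exists>a\<in>carrier R. \<exists>w\<in>W. q \<otimes>\<^bsub>S\<^esub> h w = h a"
    and kernel: "a \<in> carrier R \<Longrightarrow> h a = \<zero>\<^bsub>S\<^esub> \<longleftrightarrow> (\<exists>w\<in>W. w \<otimes> a \<in> I)"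
begin

text \<open>The extension of an ideal \<open>J \<supseteq> I\<close> to the ring of fractions: all fractions with numerator in \<open>J\<close>.\<close>
definition extension :: "'a set \<Rightarrow> 'c set" where
  "extension J = {q \<in> carrier S. \<exists>a\<in>J. \<exists>w\<in>W. q \<otimes>\<^bsub>S\<^esub> h w = h a}"

lemma extensionI:
  "q \<in> carrier S \<Longrightarrow> a \<in> J \<Longrightarrow> w \<in> W \<Longrightarrow> q \<otimes>\<^bsub>S\<^esub> h w = h a \<Longrightarrow> q \<in> extension J"
  unfolding extension_def by blast

lemma W_carrier: "w \<in> W \<Longrightarrow> w \<in> carrier R"
  using denoms by auto

lemma ideal_extension:
  assumes J: "ideal J R"
  shows "ideal (extension J) S"
proof -
  interpret J: ideal J R by fact
  show ?thesis
  proof (rule idealI)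
    show "subgroup (extension J) (add_monoid S)"
    proof (rule S.add.subgroupI)
      show "extension J \<subseteq> carrier S" by (auto simp: extension_def)
      have "\<zero>\<^bsub>S\<^esub> \<in> extension J" unfolding extension_def using J.zero_closed denoms(2)
        by (auto intro!: bexI[OF _ J.zero_closed] bexI[OF _ denoms(2)])
      then show "extension J \<noteq> {}" by auto
    next
      fix q assume "q \<in> extension J"
      then obtain a w where a: "q \<in> carrier S" "a \<in> J" "w \<in> W" "q \<otimes>\<^bsub>S\<^esub> h w = h a" by (auto simp: extension_def)
      then have "(\<ominus>\<^bsub>S\<^esub> q) \<otimes>\<^bsub>S\<^esub> h w = h (\<ominus> a)" by (simp add: S.l_minus W_carrier)
      then show "\<ominus>\<^bsub>S\<^esub> q \<in> extension J" using a(1-3) J.a_inv_closed by (intro extensionI[of _ "\<ominus> a" _ w]) auto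
      fix q' assume "q' \<in> extension J"
      then obtain a' w' where a': "q' \<in> carrier S" "a' \<in> J" "w' \<in> W" "q' \<otimes>\<^bsub>S\<^esub> h w' = h a'" by (auto simp: extension_def)
      note c = a(1) a'(1) a(2,3) a'(2,3) W_carrier J.Icarr
      have "(q \<oplus>\<^bsub>S\<^esub> q') \<otimes>\<^bsub>S\<^esub> h (w \<otimes> w') =
          (q \<otimes>\<^bsub>S\<^esub> h w) \<otimes>\<^bsub>S\<^esub> h w' \<oplus>\<^bsub>S\<^esub> (q' \<otimes>\<^bsub>S\<^esub> h w') \<otimes>\<^bsub>S\<^esub> h w"
        using c by (simp add: S.l_distr S.m_assoc S.m_comm[of "h w'" "h w"])
      also have "\<dots> = h (a \<otimes> w' \<oplus> a' \<otimes> w)" unfolding a(4) a'(4) using c by simp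
      finally show "q \<oplus>\<^bsub>S\<^esub> q' \<in> extension J" using c denoms(3) J.I_r_closed
        by (intro extensionI[of _ "a \<otimes> w' \<oplus> a' \<otimes> w" _ "w \<otimes> w'"]) auto
    qed
    have mult: "x \<otimes>\<^bsub>S\<^esub> q \<in> extension J" if q: "q \<in> extension J" and x: "x \<in> carrier S" for q x
    proof -
      obtain a w where a: "q \<in> carrier S" "a \<in> J" "w \<in> W" "q \<otimes>\<^bsub>S\<^esub> h w = h a"
        using q by (auto simp: extension_def)
      obtain a' w' where a': "a' \<in> carrier R" "w' \<in> W" "x \<otimes>\<^bsub>S\<^esub> h w' = h a'" using fraction[OF x] by blast
      note c = x a(1) a(2,3) a'(1,2) W_carrier J.Icarr
      have "(x \<otimes>\<^bsub>S\<^esub> q) \<otimes>\<^bsub>S\<^esub> h (w' \<otimes> w) = (x \<otimes>\<^bsub>S\<^esub> h w') \<otimes>\<^bsub>S\<^esub> (q \<otimes>\<^bsub>S\<^esub> h w)"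
        using c by (simp add: S.m_assoc S.m_lcomm[of q])
      also have "\<dots> = h (a' \<otimes> a)" unfolding a(4) a'(3) using c by simp
      finally show ?thesis using c denoms(3) J.I_l_closed
        by (intro extensionI[of _ "a' \<otimes> a" _ "w' \<otimes> w"]) auto
    qed
    then show "x \<otimes>\<^bsub>S\<^esub> q \<in> extension J" "q \<otimes>\<^bsub>S\<^esub> x \<in> extension J" if "q \<in> extension J" "x \<in> carrier S" for q x
      using that by (auto simp: S.m_comm[of q x] extension_def)
  qed (rule S.ring_axioms)
qed

text \<open>The element \<open>w\<close> collects the denominator of the fraction and the factor that witnesses an equation in \<open>S\<close>.\<close>
lemma hom_mem_extension:
  assumes J: "ideal J R" "I \<subseteq> J" and a: "a \<in> carrier R"
  shows "h a \<in> extension J \<longleftrightarrow> (\<exists>w\<in>W. w \<otimes> a \<in> J)"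
proof
  interpret J: ideal J R by fact
  assume "h a \<in> extension J"
  then obtain b w where b: "b \<in> J" "w \<in> W" "h a \<otimes>\<^bsub>S\<^esub> h w = h b" by (auto simp: extension_def)
  note c = a b(1,2) W_carrier J.Icarr
  have "h (a \<otimes> w \<ominus> b) = \<zero>\<^bsub>S\<^esub>" using b(3) c by (simp add: minus_eq S.r_neg)
  then obtain w' where w': "w' \<in> W" "w' \<otimes> (a \<otimes> w \<ominus> b) \<in> I" using kernel[of "a \<otimes> w \<ominus> b"] c by auto
  have cc: "w \<in> carrier R" "w' \<in> carrier R" "b \<in> carrier R" using c w' by auto
  have "(w' \<otimes> w) \<otimes> a = w' \<otimes> (a \<otimes> w \<ominus> b) \<oplus> w' \<otimes> b" using cc a by algebra
  also have "\<dots> \<in> J" using w'(2) J(2) J.I_l_closed[OF b(1) cc(2)] by (intro J.a_closed) auto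
  finally show "\<exists>w\<in>W. w \<otimes> a \<in> J" using denoms(3)[OF w'(1) b(2)] by auto
next
  assume "\<exists>w\<in>W. w \<otimes> a \<in> J"
  then obtain w where w: "w \<in> W" "w \<otimes> a \<in> J" by auto
  then show "h a \<in> extension J" using a W_carrier[OF w(1)]
    by (intro extensionI[of _ "w \<otimes> a" _ w]) (auto simp: S.m_comm)
qed

lemma fraction_in_ideal:
  assumes A: "ideal A S" and q: "q \<in> carrier S" and w: "w \<in> W" and "q \<otimes>\<^bsub>S\<^esub> h w \<in> A"
  shows "q \<in> A"
proof -
  interpret A: ideal A S by fact
  have "(q \<otimes>\<^bsub>S\<^esub> h w) \<otimes>\<^bsub>S\<^esub> inv\<^bsub>S\<^esub> (h w) = q"
    using q unit[OF w] by (simp add: S.m_assoc S.Units_closed)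
  then show ?thesis using A.I_r_closed[OF assms(4), of "inv\<^bsub>S\<^esub> (h w)"] unit[OF w] by simp
qed

lemma kernel_subset: "I \<subseteq> {a \<in> carrier R. h a = \<zero>\<^bsub>S\<^esub>}"
  using kernel denoms(2) I.a_subset by (auto intro!: bexI[of _ \<one>])

lemma Idl_image:
  assumes T: "T \<subseteq> carrier R"
  shows "Idl\<^bsub>S\<^esub> (h ` T) = extension (Idl (I \<union> T))"
proof (rule antisym)
  have sub: "I \<union> T \<subseteq> carrier R" using T I.a_subset by auto
  have id: "ideal (Idl (I \<union> T)) R" by (rule R.genideal_ideal[OF sub])
  have "h ` T \<subseteq> extension (Idl (I \<union> T))"
  proof clarify
    fix t assume t: "t \<in> T"
    then have "t \<in> Idl (I \<union> T)" using R.genideal_self[OF sub] by auto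
    then show "h t \<in> extension (Idl (I \<union> T))" using t T denoms(2) by (intro extensionI[of _ t _ \<one>]) auto
  qed
  then show "Idl\<^bsub>S\<^esub> (h ` T) \<subseteq> extension (Idl (I \<union> T))"
    by (intro S.genideal_minimal ideal_extension id)
  have hT: "h ` T \<subseteq> carrier S" using T by auto
  have id': "ideal (Idl\<^bsub>S\<^esub> (h ` T)) S" by (rule S.genideal_ideal[OF hT])
  interpret K: ideal "Idl\<^bsub>S\<^esub> (h ` T)" S by fact
  have "Idl (I \<union> T) \<subseteq> {r \<in> carrier R. h r \<in> Idl\<^bsub>S\<^esub> (h ` T)}"
    using kernel_subset T S.genideal_self[OF hT] K.zero_closed
    by (intro R.genideal_minimal ring.ideal_vimage id') auto
  then show "extension (Idl (I \<union> T)) \<subseteq> Idl\<^bsub>S\<^esub> (h ` T)"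
  proof (intro subsetI)
    fix q assume sub': "Idl (I \<union> T) \<subseteq> {r \<in> carrier R. h r \<in> Idl\<^bsub>S\<^esub> (h ` T)}" and "q \<in> extension (Idl (I \<union> T))"
    then obtain a w where "q \<in> carrier S" "a \<in> Idl (I \<union> T)" "w \<in> W" "q \<otimes>\<^bsub>S\<^esub> h w = h a"
      unfolding extension_def by blast
    then show "q \<in> Idl\<^bsub>S\<^esub> (h ` T)" using fraction_in_ideal[OF id', of q w] sub' by auto
  qed
qed

lemma extension_vimage:
  assumes A: "ideal A S"
  shows "extension {r \<in> carrier R. h r \<in> A} = A"
proof -
  interpret A: ideal A S by fact
  show ?thesis
  proof (intro subset_antisym subsetI)
    fix q assume "q \<in> extension {r \<in> carrier R. h r \<in> A}"
    then show "q \<in> A" using fraction_in_ideal[OF A, of q] by (auto simp: extension_def)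
  next
    fix q assume q: "q \<in> A"
    then obtain a w where a: "a \<in> carrier R" "w \<in> W" "q \<otimes>\<^bsub>S\<^esub> h w = h a"
      using fraction[of q] A.Icarr by auto
    moreover have "q \<otimes>\<^bsub>S\<^esub> h w \<in> A" using A.I_r_closed[OF q] W_carrier[OF a(2)] by simp
    ultimately show "q \<in> extension {r \<in> carrier R. h r \<in> A}" using A.Icarr[OF q] unfolding extension_def by auto
  qed
qed

lemma vimage_ideal:
  assumes A: "ideal A S"
  shows "ideal {r \<in> carrier R. h r \<in> A} R" "I \<subseteq> {r \<in> carrier R. h r \<in> A}"
proof -
  interpret A: ideal A S by fact
  show "ideal {r \<in> carrier R. h r \<in> A} R" "I \<subseteq> {r \<in> carrier R. h r \<in> A}"
    using ring.ideal_vimage[OF A] kernel_subset by auto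
qed

text \<open>Every ideal of \<open>S\<close> is the extension of its preimage, so generators of the preimage map to generators.\<close>
lemma noetherian_ring_of_fractions:
  assumes "noetherian_ring R"
  shows "noetherian_ring S"
proof (rule S.noetherian_ringI)
  interpret noetherian_ring R by fact
  fix A assume A: "ideal A S"
  let ?J = "{r \<in> carrier R. h r \<in> A}"
  obtain T where T: "T \<subseteq> carrier R" "finite T" "?J = Idl T"
    using finetely_gen[OF vimage_ideal(1)[OF A]] by auto
  have "Idl (I \<union> T) = ?J"
  proof -
    have "Idl (I \<union> T) \<subseteq> ?J" using vimage_ideal[OF A] T(3) R.genideal_self[OF T(1)]
      by (intro R.genideal_minimal) auto
    moreover have "Idl T \<subseteq> Idl (I \<union> T)" using T(1) I.a_subset R.genideal_self[of "I \<union> T"]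
      by (intro R.genideal_minimal R.genideal_ideal) auto
    ultimately show ?thesis using T(3) by auto
  qed
  then have "A = Idl\<^bsub>S\<^esub> (h ` T)" using Idl_image[OF T(1)] extension_vimage[OF A] by simp
  then show "\<exists>A'\<subseteq>carrier S. finite A' \<and> A = Idl\<^bsub>S\<^esub> A'" using T(1,2) by (intro exI[of _ "h ` T"]) auto
qed

text \<open>Taking preimages maps strict chains of primes of \<open>S\<close> to strict chains of primes over \<open>I\<close>, since
  \<open>extension_vimage\<close> recovers an ideal of \<open>S\<close> from its preimage.\<close>
lemma krull_dim_le:
  assumes bound: "\<And>C k. \<forall>i\<le>k. primeideal (C i) R \<Longrightarrow> I \<subseteq> C 0 \<Longrightarrow> \<forall>i<k. C i \<subset> C (Suc i) \<Longrightarrow> k \<le> n"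
  shows "krull_dim S \<le> enat n"
  unfolding krull_dim_def
proof (rule Sup_least)
  fix d assume "d \<in> {enat k |k. \<exists>C. (\<forall>i\<le>k. primeideal (C i) S) \<and> (\<forall>i<k. C i \<subset> C (Suc i))}"
  then obtain k C where d: "d = enat k" and C: "\<forall>i\<le>k. primeideal (C i) S" "\<forall>i<k. C i \<subset> C (Suc i)" by auto
  have idl: "ideal (C i) S" if "i \<le> k" for i using C(1) that by (simp add: primeideal_def)
  define D where "D i = {r \<in> carrier R. h r \<in> C i}" for i
  have extension: "extension (D i) = C i" if "i \<le> k" for i unfolding D_def using extension_vimage idl that by blast
  have "k \<le> n"
  proof (rule bound)
    show "\<forall>i\<le>k. primeideal (D i) R" unfolding D_def using C(1) ring.primeideal_vimage[OF R.is_cring] by auto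
    show "I \<subseteq> D 0" unfolding D_def using vimage_ideal idl by blast
    show "\<forall>i<k. D i \<subset> D (Suc i)"
    proof (intro allI impI psubsetI)
      fix i assume i: "i < k"
      then show "D i \<subseteq> D (Suc i)" unfolding D_def using C(2) by blast
      show "D i \<noteq> D (Suc i)" using extension[of i] extension[of "Suc i"] C(2) i by auto
    qed
  qed
  then show "d \<le> enat n" using d by simp
qed

lemma regular_sequence_ring_of_fractions:
  assumes gs: "set gs \<subseteq> carrier R" and reg: "weakly_regular R I gs"
    and proper: "Idl\<^bsub>S\<^esub> (set (map h gs)) \<noteq> carrier S"
  shows "regular_sequence S (map h gs)"
  unfolding regular_sequence_def
proof (intro conjI allI impI ballI)
  show "set (map h gs) \<subseteq> carrier S" using gs by auto
  fix i q assume i: "i < length (map h gs)" and q: "q \<in> carrier S"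
    and mem: "map h gs ! i \<otimes>\<^bsub>S\<^esub> q \<in> Idl\<^bsub>S\<^esub> (set (take i (map h gs)))"
  define J where "J = Idl (I \<union> set (take i gs))"
  have tk: "set (take i gs) \<subseteq> carrier R" using gs set_take_subset[of i gs] by auto
  have sub: "I \<union> set (take i gs) \<subseteq> carrier R" using tk I.a_subset by auto
  have J: "ideal J R" "I \<subseteq> J" unfolding J_def using R.genideal_ideal[OF sub] R.genideal_self[OF sub] by auto
  interpret J: ideal J R by fact
  interpret eJ: ideal "extension J" S by (rule ideal_extension[OF J(1)])
  have IdlJ: "Idl\<^bsub>S\<^esub> (set (take i (map h gs))) = extension J"
    using Idl_image[OF tk] by (simp add: J_def take_map)
  let ?g = "gs ! i"
  have g: "?g \<in> carrier R" using i gs by auto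
  obtain a w where a: "a \<in> carrier R" "w \<in> W" "q \<otimes>\<^bsub>S\<^esub> h w = h a" using fraction[OF q] by blast
  have wc: "w \<in> carrier R" using a W_carrier by auto
  have "h (?g \<otimes> a) = (h ?g \<otimes>\<^bsub>S\<^esub> q) \<otimes>\<^bsub>S\<^esub> h w" using g a q wc by (simp add: S.m_assoc a(3)[symmetric])
  also have "\<dots> \<in> extension J" using eJ.I_r_closed[of "h ?g \<otimes>\<^bsub>S\<^esub> q" "h w"] mem i wc unfolding IdlJ by simp
  finally obtain v where v: "v \<in> W" "v \<otimes> (?g \<otimes> a) \<in> J" using hom_mem_extension[OF J, of "?g \<otimes> a"] g a by auto
  have vc: "v \<in> carrier R" using v W_carrier by auto
  have "?g \<otimes> (v \<otimes> a) \<in> J" using v(2) vc g a(1) by (simp add: R.m_lcomm[of "gs ! i" v a])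
  then have "v \<otimes> a \<in> J" using reg i vc a(1) unfolding R.weakly_regular_nth[OF I.is_ideal gs] J_def by auto
  then have "h a \<in> extension J" using hom_mem_extension[OF J a(1)] v by auto
  then show "q \<in> Idl\<^bsub>S\<^esub> (set (take i (map h gs)))" unfolding IdlJ
    using fraction_in_ideal[OF eJ.is_ideal q a(2)] a(3) by simp
qed (rule proper)

text \<open>If the denominators are all elements outside \<open>M\<close>, every fraction outside the extension of \<open>M\<close> is a unit.\<close>
lemma local_ring_of_fractions:
  assumes M: "maximalideal M R" "I \<subseteq> M" and W: "W = carrier R - M"
  shows "local_ring S (extension M)"
proof -
  interpret M: maximalideal M R by fact
  interpret Mp: primeideal M R by (rule R.maximalideal_prime[OF M(1)])
  interpret eM: ideal "extension M" S by (rule ideal_extension[OF M.is_ideal])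
  have proper: "\<one>\<^bsub>S\<^esub> \<notin> extension M"
  proof
    assume "\<one>\<^bsub>S\<^esub> \<in> extension M"
    then obtain w where w: "w \<in> W" "w \<otimes> \<one> \<in> M" using hom_mem_extension[OF M.is_ideal M(2), of \<one>] by auto
    then show False using W by auto
  qed
  have un: "q \<in> Units S" if q: "q \<in> carrier S" "q \<notin> extension M" for q
  proof -
    obtain a w where a: "a \<in> carrier R" "w \<in> W" "q \<otimes>\<^bsub>S\<^esub> h w = h a" using fraction[OF q(1)] by blast
    have "q \<in> extension M" if "a \<in> M" unfolding extension_def using a(2,3) q(1) that by blast
    then have "a \<notin> M" using q(2) by blast
    then have u: "h a \<in> Units S" using unit a(1) W by auto
    have hw: "h w \<in> carrier S" using W_carrier[OF a(2)] by simp
    let ?r = "h w \<otimes>\<^bsub>S\<^esub> inv\<^bsub>S\<^esub> (h a)"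
    have r: "?r \<in> carrier S" using hw u by simp
    have "q \<otimes>\<^bsub>S\<^esub> ?r = (q \<otimes>\<^bsub>S\<^esub> h w) \<otimes>\<^bsub>S\<^esub> inv\<^bsub>S\<^esub> (h a)"
      using q(1) hw S.Units_inv_closed[OF u] by (simp add: S.m_assoc)
    then have 1: "q \<otimes>\<^bsub>S\<^esub> ?r = \<one>\<^bsub>S\<^esub>" unfolding a(3) using S.Units_r_inv[OF u] by simp
    then have "?r \<otimes>\<^bsub>S\<^esub> q = \<one>\<^bsub>S\<^esub>" using S.m_comm[OF q(1) r] by simp
    with 1 show ?thesis using q(1) r unfolding Units_def by blast
  qed
  have sub: "A \<subseteq> extension M" if A: "ideal A S" "A \<noteq> carrier S" for A
  proof
    interpret A: ideal A S by fact
    fix q assume q: "q \<in> A"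
    show "q \<in> extension M"
    proof (rule ccontr)
      assume "q \<notin> extension M"
      then have u: "q \<in> Units S" using un q A.Icarr by auto
      then have "\<one>\<^bsub>S\<^esub> \<in> A" using A.I_r_closed[OF q, of "inv\<^bsub>S\<^esub> q"] by simp
      then show False using A A.one_imp_carrier by simp
    qed
  qed
  have "maximalideal (extension M) S"
  proof (rule maximalidealI[OF eM.is_ideal])
    show "carrier S \<noteq> extension M" using proper by auto
    show "J = extension M \<or> J = carrier S" if "ideal J S" "extension M \<subseteq> J" "J \<subseteq> carrier S" for J
      using sub[OF that(1)] that(2) by auto
  qed
  moreover have "A = extension M" if "maximalideal A S" for A
  proof -
    interpret A: maximalideal A S by fact
    have "A \<subseteq> extension M" by (rule sub[OF A.is_ideal A.I_notcarr[symmetric]])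
    then have "extension M = A \<or> extension M = carrier S" using A.I_maximal[OF eM.is_ideal _ eM.a_subset] by blast
    then show ?thesis using proper S.one_closed by metis
  qed
  ultimately have "{I. maximalideal I S} = {extension M}" by blast
  then show ?thesis unfolding local_ring_def using S.is_cring by simp
qed

text \<open>The inequalities \<open>length gs \<le> depth \<le> dim \<le> length gs\<close> come from the regular sequence, from
  \<open>depth_le_krull_dim\<close>, and from the bound on prime chains.\<close>
theorem cohen_macaulay_ring_of_fractions:
  assumes noeth: "noetherian_ring R" and M: "maximalideal M R" "I \<subseteq> M" and W: "W = carrier R - M"
    and gs: "set gs \<subseteq> M" "weakly_regular R I gs"
    and bound: "\<And>C k. \<forall>i\<le>k. primeideal (C i) R \<Longrightarrow> I \<subseteq> C 0 \<Longrightarrow> \<forall>i<k. C i \<subset> C (Suc i) \<Longrightarrow> k \<le> length gs"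
  shows "cohen_macaulay_local_ring S"
proof -
  interpret M: maximalideal M R by fact
  have loc: "local_ring S (extension M)" by (rule local_ring_of_fractions[OF M W])
  then have max: "maximalideal (extension M) S" unfolding local_ring_def by auto
  interpret eM: maximalideal "extension M" S by (rule max)
  have gsc: "set gs \<subseteq> carrier R" using gs(1) M.a_subset by auto
  have in_extension: "set (map h gs) \<subseteq> extension M"
  proof clarsimp
    fix g assume g: "g \<in> set gs"
    then have "\<one> \<otimes> g \<in> M" using gs(1) gsc by auto
    then show "h g \<in> extension M" using hom_mem_extension[OF M.is_ideal M(2), of g] gsc g denoms(2) by blast
  qed
  have "Idl\<^bsub>S\<^esub> (set (map h gs)) \<subseteq> extension M" by (rule S.genideal_minimal[OF eM.is_ideal in_extension])
  then have "regular_sequence S (map h gs)"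
    using eM.I_notcarr eM.a_subset by (intro regular_sequence_ring_of_fractions gsc gs(2)) auto
  then have "enat (length gs) \<le> depth S (extension M)"
    unfolding depth_def using in_extension by (intro Sup_upper) (auto intro!: exI[of _ "map h gs"])
  moreover have "depth S (extension M) \<le> krull_dim S"
    by (rule S.depth_le_krull_dim[OF S.maximalideal_prime[OF max]])
  moreover have "krull_dim S \<le> enat (length gs)" using bound by (rule krull_dim_le)
  ultimately have "depth S (extension M) = krull_dim S" by (meson order_antisym order_trans)
  then show ?thesis unfolding cohen_macaulay_local_ring_def
    using loc noetherian_ring_of_fractions[OF noeth] by auto
qed

end

section \<open>Localization of a quotient ring\<close>

locale multiplicative_subset = cring R for R (structure) +
  fixes T
  assumes T_carrier: "T \<subseteq> carrier R" and T_one: "\<one> \<in> T"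
    and T_mult: "s \<in> T \<Longrightarrow> t \<in> T \<Longrightarrow> s \<otimes> t \<in> T"
begin

abbreviation "L \<equiv> localization R T"

definition frac :: "'a \<Rightarrow> 'a \<Rightarrow> ('a \<times> 'a) set" where
  "frac a s = frac_rel R T `` {(a, s)}"

lemma T_closed: "s \<in> T \<Longrightarrow> s \<in> carrier R" using T_carrier by auto

lemma frac_rel_iff: "((a, s), (b, t)) \<in> frac_rel R T \<longleftrightarrow>
    a \<in> carrier R \<and> s \<in> T \<and> b \<in> carrier R \<and> t \<in> T \<and> (\<exists>u\<in>T. u \<otimes> (t \<otimes> a) = u \<otimes> (s \<otimes> b))"
  by (auto simp: frac_rel_def)

lemma equiv_frac_rel: "equiv (carrier R \<times> T) (frac_rel R T)"
proof (rule equivI)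
  show "frac_rel R T \<subseteq> (carrier R \<times> T) \<times> carrier R \<times> T" by (auto simp: frac_rel_def)
  show "refl_on (carrier R \<times> T) (frac_rel R T)"
    using T_one by (auto simp: refl_on_def frac_rel_iff)
  show "sym (frac_rel R T)"
    by (rule symI) (auto simp: frac_rel_def, metis)
  show "trans (frac_rel R T)"
  proof (rule transI, clarify)
    fix a s b t c v
    assume "((a, s), b, t) \<in> frac_rel R T" "((b, t), c, v) \<in> frac_rel R T"
    then obtain u u' where 1: "a \<in> carrier R" "s \<in> T" "b \<in> carrier R" "t \<in> T" "c \<in> carrier R" "v \<in> T"
      "u \<in> T" "u' \<in> T" and e: "u \<otimes> (t \<otimes> a) = u \<otimes> (s \<otimes> b)" "u' \<otimes> (v \<otimes> b) = u' \<otimes> (t \<otimes> c)"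
      by (auto simp: frac_rel_iff)
    have cl: "s \<in> carrier R" "t \<in> carrier R" "v \<in> carrier R" "u \<in> carrier R" "u' \<in> carrier R"
      using 1 T_closed by auto
    have "(u \<otimes> u' \<otimes> t) \<otimes> (v \<otimes> a) = (u' \<otimes> v) \<otimes> (u \<otimes> (t \<otimes> a))" using 1(1) cl by (simp add: m_ac)
    also have "\<dots> = (u \<otimes> s) \<otimes> (u' \<otimes> (v \<otimes> b))" unfolding e(1) using 1(3) cl by (simp add: m_ac)
    also have "\<dots> = (u \<otimes> u' \<otimes> t) \<otimes> (s \<otimes> c)" unfolding e(2) using 1(5) cl by (simp add: m_ac)
    finally show "((a, s), c, v) \<in> frac_rel R T"
      unfolding frac_rel_iff using 1 by (auto intro!: bexI[of _ "u \<otimes> u' \<otimes> t"] T_mult)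
  qed
qed

lemma frac_eq_iff:
  assumes "a \<in> carrier R" "s \<in> T" "b \<in> carrier R" "t \<in> T"
  shows "frac a s = frac b t \<longleftrightarrow> (\<exists>u\<in>T. u \<otimes> (t \<otimes> a) = u \<otimes> (s \<otimes> b))"
  unfolding frac_def using eq_equiv_class_iff[OF equiv_frac_rel, of "(a, s)" "(b, t)"] assms
  by (auto simp: frac_rel_iff)

lemma carrier_localization: "carrier L = {frac a s | a s. a \<in> carrier R \<and> s \<in> T}"
  by (auto simp: localization_def quotient_def frac_def)

lemma frac_in_carrier [simp]: "a \<in> carrier R \<Longrightarrow> s \<in> T \<Longrightarrow> frac a s \<in> carrier L"
  by (auto simp: carrier_localization)

lemma carrier_localizationE:
  assumes "x \<in> carrier L" obtains a s where "x = frac a s" "a \<in> carrier R" "s \<in> T"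
  using assms by (auto simp: carrier_localization)

lemma one_localization: "\<one>\<^bsub>L\<^esub> = frac \<one> \<one>" and zero_localization: "\<zero>\<^bsub>L\<^esub> = frac \<zero> \<one>"
  by (simp_all add: localization_def frac_def)

text \<open>Sum and product of fractions both have the form \<open>f a s b t / (s t)\<close> with a symmetric numerator, so it is
  enough to check that the class does not change when the first fraction is replaced by an equivalent one.\<close>
lemma congruent2_frac:
  assumes "\<And>a s b t. a \<in> carrier R \<Longrightarrow> s \<in> T \<Longrightarrow> b \<in> carrier R \<Longrightarrow> t \<in> T \<Longrightarrow>
      f a s b t \<in> carrier R"
    and "\<And>a s b t a' s' u. a \<in> carrier R \<Longrightarrow> s \<in> T \<Longrightarrow> b \<in> carrier R \<Longrightarrow> t \<in> T \<Longrightarrow> a' \<in> carrier R \<Longrightarrow> s' \<in> T \<Longrightarrow>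
      u \<in> T \<Longrightarrow> u \<otimes> (s' \<otimes> a) = u \<otimes> (s \<otimes> a') \<Longrightarrow>
      u \<otimes> ((s' \<otimes> t) \<otimes> f a s b t) = u \<otimes> ((s \<otimes> t) \<otimes> f a' s' b t)"
    and "\<And>a s b t. a \<in> carrier R \<Longrightarrow> s \<in> T \<Longrightarrow> b \<in> carrier R \<Longrightarrow> t \<in> T \<Longrightarrow>
      f a s b t = f b t a s"
  shows "congruent2 (frac_rel R T) (frac_rel R T) (\<lambda>(a, s). \<lambda>(b, t). frac_rel R T `` {(f a s b t, s \<otimes> t)})"
proof (rule congruent2_commuteI[OF equiv_frac_rel])
  fix y z :: "'a \<times> 'a"
  assume yz: "y \<in> carrier R \<times> T" "z \<in> carrier R \<times> T"
  obtain a s b t where e: "y = (a, s)" "z = (b, t)" by (cases y, cases z) auto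
  have "t \<otimes> s = s \<otimes> t" using yz e T_closed by (intro m_comm) auto
  then show "(\<lambda>(a, s). \<lambda>(b, t). frac_rel R T `` {(f a s b t, s \<otimes> t)}) y z =
      (\<lambda>(a, s). \<lambda>(b, t). frac_rel R T `` {(f a s b t, s \<otimes> t)}) z y"
    using assms(3)[of a s b t] yz e by simp
next
  fix y z w :: "'a \<times> 'a"
  assume w: "w \<in> carrier R \<times> T" and yz: "(y, z) \<in> frac_rel R T"
  obtain a s a' s' b t where e: "y = (a, s)" "z = (a', s')" "w = (b, t)" by (cases y, cases z, cases w) auto
  obtain u where u: "a \<in> carrier R" "s \<in> T" "a' \<in> carrier R" "s' \<in> T" "u \<in> T" "b \<in> carrier R" "t \<in> T"
    and eq: "u \<otimes> (s' \<otimes> a) = u \<otimes> (s \<otimes> a')" using yz w e by (auto simp: frac_rel_iff)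
  have "frac (f a s b t) (s \<otimes> t) = frac (f a' s' b t) (s' \<otimes> t)"
    using u assms(1) assms(2)[OF u(1,2,6,7,3,4,5) eq] by (subst frac_eq_iff) (auto intro!: T_mult)
  moreover have "(\<lambda>(a, s). \<lambda>(b, t). frac_rel R T `` {(f a s b t, s \<otimes> t)}) w y = frac (f a s b t) (s \<otimes> t)"
    "(\<lambda>(a, s). \<lambda>(b, t). frac_rel R T `` {(f a s b t, s \<otimes> t)}) w z = frac (f a' s' b t) (s' \<otimes> t)"
    unfolding e frac_def using assms(3) u T_closed by (simp_all add: m_comm[of t])
  ultimately show "(\<lambda>(a, s). \<lambda>(b, t). frac_rel R T `` {(f a s b t, s \<otimes> t)}) w y =
      (\<lambda>(a, s). \<lambda>(b, t). frac_rel R T `` {(f a s b t, s \<otimes> t)}) w z" by simp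
qed

lemma mult_localization:
  assumes "a \<in> carrier R" "s \<in> T" "b \<in> carrier R" "t \<in> T"
  shows "frac a s \<otimes>\<^bsub>L\<^esub> frac b t = frac (a \<otimes> b) (s \<otimes> t)"
proof -
  have "congruent2 (frac_rel R T) (frac_rel R T) (\<lambda>(a, s). \<lambda>(b, t). frac_rel R T `` {(a \<otimes> b, s \<otimes> t)})"
  proof (rule congruent2_frac[where f = "\<lambda>a s b t. a \<otimes> b"])
    fix a s b t a' s' u
    assume *: "a \<in> carrier R" "s \<in> T" "b \<in> carrier R" "t \<in> T" "a' \<in> carrier R" "s' \<in> T"
      "u \<in> T" and e: "u \<otimes> (s' \<otimes> a) = u \<otimes> (s \<otimes> a')"
    have c: "s \<in> carrier R" "s' \<in> carrier R" "t \<in> carrier R" "u \<in> carrier R" using * T_closed by auto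
    have "u \<otimes> ((s' \<otimes> t) \<otimes> (a \<otimes> b)) = (u \<otimes> (s' \<otimes> a)) \<otimes> (t \<otimes> b)" using * c by (simp add: m_ac)
    also have "\<dots> = u \<otimes> ((s \<otimes> t) \<otimes> (a' \<otimes> b))" unfolding e using * c by (simp add: m_ac)
    finally show "u \<otimes> ((s' \<otimes> t) \<otimes> (a \<otimes> b)) = u \<otimes> ((s \<otimes> t) \<otimes> (a' \<otimes> b))" .
  qed (auto simp: m_comm)
  from UN_equiv_class2[OF equiv_frac_rel equiv_frac_rel this, of "(a, s)" "(b, t)"]
  show ?thesis using assms unfolding localization_def frac_def by (simp add: case_prod_beta')
qed

lemma add_localization:
  assumes "a \<in> carrier R" "s \<in> T" "b \<in> carrier R" "t \<in> T"
  shows "frac a s \<oplus>\<^bsub>L\<^esub> frac b t = frac (t \<otimes> a \<oplus> s \<otimes> b) (s \<otimes> t)"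
proof -
  have "congruent2 (frac_rel R T) (frac_rel R T)
      (\<lambda>(a, s). \<lambda>(b, t). frac_rel R T `` {(t \<otimes> a \<oplus> s \<otimes> b, s \<otimes> t)})"
  proof (rule congruent2_frac[where f = "\<lambda>a s b t. t \<otimes> a \<oplus> s \<otimes> b"])
    fix a s b t a' s' u
    assume *: "a \<in> carrier R" "s \<in> T" "b \<in> carrier R" "t \<in> T" "a' \<in> carrier R" "s' \<in> T"
      "u \<in> T" and e: "u \<otimes> (s' \<otimes> a) = u \<otimes> (s \<otimes> a')"
    have c: "s \<in> carrier R" "s' \<in> carrier R" "t \<in> carrier R" "u \<in> carrier R" using * T_closed by auto
    have "u \<otimes> ((s' \<otimes> t) \<otimes> (t \<otimes> a \<oplus> s \<otimes> b)) =
        (u \<otimes> (s' \<otimes> a)) \<otimes> (t \<otimes> t) \<oplus> u \<otimes> ((s' \<otimes> t) \<otimes> (s \<otimes> b))" using * c by algebra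
    also have "\<dots> = u \<otimes> ((s \<otimes> t) \<otimes> (t \<otimes> a' \<oplus> s' \<otimes> b))" unfolding e using * c by algebra
    finally show "u \<otimes> ((s' \<otimes> t) \<otimes> (t \<otimes> a \<oplus> s \<otimes> b)) = u \<otimes> ((s \<otimes> t) \<otimes> (t \<otimes> a' \<oplus> s' \<otimes> b))" .
  qed (auto simp: T_closed a_comm)
  from UN_equiv_class2[OF equiv_frac_rel equiv_frac_rel this, of "(a, s)" "(b, t)"]
  show ?thesis using assms unfolding localization_def frac_def by (simp add: case_prod_beta')
qed

lemma frac_eqI:
  assumes "a \<in> carrier R" "s \<in> T" "b \<in> carrier R" "t \<in> T" "t \<otimes> a = s \<otimes> b"
  shows "frac a s = frac b t"
  using assms T_one by (subst frac_eq_iff) auto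

lemma frac_zero: "s \<in> T \<Longrightarrow> frac \<zero> s = \<zero>\<^bsub>L\<^esub>"
  unfolding zero_localization using T_closed T_one by (intro frac_eqI) auto

lemma cring_localization: "cring L"
proof (rule cringI)
  note [simp] = mult_localization add_localization one_localization zero_localization T_mult T_one T_closed
  show "abelian_group L"
  proof (rule abelian_groupI)
    fix x assume "x \<in> carrier L"
    then obtain a s where x: "x = frac a s" "a \<in> carrier R" "s \<in> T" by (rule carrier_localizationE)
    show "\<zero>\<^bsub>L\<^esub> \<oplus>\<^bsub>L\<^esub> x = x" using x by simp
    have "frac (\<ominus> a) s \<oplus>\<^bsub>L\<^esub> x = frac (s \<otimes> (\<ominus> a) \<oplus> s \<otimes> a) (s \<otimes> s)" using x by simp
    also have "s \<otimes> (\<ominus> a) \<oplus> s \<otimes> a = \<zero>" using x T_closed[OF x(3)] by algebra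
    finally show "\<exists>y\<in>carrier L. y \<oplus>\<^bsub>L\<^esub> x = \<zero>\<^bsub>L\<^esub>" using x frac_zero[of "s \<otimes> s"]
      by (intro bexI[of _ "frac (\<ominus> a) s"]) simp_all
    fix y assume "y \<in> carrier L"
    then obtain b t where y: "y = frac b t" "b \<in> carrier R" "t \<in> T" by (rule carrier_localizationE)
    show "x \<oplus>\<^bsub>L\<^esub> y \<in> carrier L" using x y by simp
    show "x \<oplus>\<^bsub>L\<^esub> y = y \<oplus>\<^bsub>L\<^esub> x" using x y by (simp add: m_comm[of s t] a_comm)
    fix z assume "z \<in> carrier L"
    then obtain c u where z: "z = frac c u" "c \<in> carrier R" "u \<in> T" by (rule carrier_localizationE)
    have cl: "s \<in> carrier R" "t \<in> carrier R" "u \<in> carrier R" using x y z by auto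
    have "u \<otimes> (t \<otimes> a \<oplus> s \<otimes> b) \<oplus> (s \<otimes> t) \<otimes> c = (t \<otimes> u) \<otimes> a \<oplus> s \<otimes> (u \<otimes> b \<oplus> t \<otimes> c)"
      using x(2) y(2) z(2) cl by algebra
    then show "x \<oplus>\<^bsub>L\<^esub> y \<oplus>\<^bsub>L\<^esub> z = x \<oplus>\<^bsub>L\<^esub> (y \<oplus>\<^bsub>L\<^esub> z)" using x y z cl by (simp add: m_assoc)
  qed simp
  show "comm_monoid L"
  proof (rule comm_monoidI)
    fix x assume "x \<in> carrier L"
    then obtain a s where x: "x = frac a s" "a \<in> carrier R" "s \<in> T" by (rule carrier_localizationE)
    show "\<one>\<^bsub>L\<^esub> \<otimes>\<^bsub>L\<^esub> x = x" using x by simp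
    fix y assume "y \<in> carrier L"
    then obtain b t where y: "y = frac b t" "b \<in> carrier R" "t \<in> T" by (rule carrier_localizationE)
    show "x \<otimes>\<^bsub>L\<^esub> y \<in> carrier L" using x y by simp
    show "x \<otimes>\<^bsub>L\<^esub> y = y \<otimes>\<^bsub>L\<^esub> x" using x y by (simp add: m_comm[of s t] m_comm[of a b])
    fix z assume "z \<in> carrier L"
    then obtain c u where z: "z = frac c u" "c \<in> carrier R" "u \<in> T" by (rule carrier_localizationE)
    show "x \<otimes>\<^bsub>L\<^esub> y \<otimes>\<^bsub>L\<^esub> z = x \<otimes>\<^bsub>L\<^esub> (y \<otimes>\<^bsub>L\<^esub> z)" using x y z by (simp add: m_assoc)
  qed simp
  fix x y z assume "x \<in> carrier L" "y \<in> carrier L" "z \<in> carrier L"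
  then obtain a s b t c u where x: "x = frac a s" "a \<in> carrier R" "s \<in> T"
    and y: "y = frac b t" "b \<in> carrier R" "t \<in> T" and z: "z = frac c u" "c \<in> carrier R" "u \<in> T"
    by (metis carrier_localizationE)
  have cl: "s \<in> carrier R" "t \<in> carrier R" "u \<in> carrier R" using x y z by auto
  have "frac ((t \<otimes> a \<oplus> s \<otimes> b) \<otimes> c) (s \<otimes> t \<otimes> u) = frac (t \<otimes> u \<otimes> (a \<otimes> c) \<oplus> s \<otimes> u \<otimes> (b \<otimes> c)) (s \<otimes> u \<otimes> (t \<otimes> u))"
  proof (rule frac_eqI)
    show "s \<otimes> u \<otimes> (t \<otimes> u) \<otimes> ((t \<otimes> a \<oplus> s \<otimes> b) \<otimes> c) =
        s \<otimes> t \<otimes> u \<otimes> (t \<otimes> u \<otimes> (a \<otimes> c) \<oplus> s \<otimes> u \<otimes> (b \<otimes> c))"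
      using x(2) y(2) z(2) cl by algebra
  qed (use x y z cl in simp_all)
  then show "(x \<oplus>\<^bsub>L\<^esub> y) \<otimes>\<^bsub>L\<^esub> z = x \<otimes>\<^bsub>L\<^esub> z \<oplus>\<^bsub>L\<^esub> y \<otimes>\<^bsub>L\<^esub> z" using x y z by simp
qed

end

text \<open>A maximal ideal of \<open>R/I\<close> corresponds to a maximal ideal \<open>N \<supseteq> I\<close> of \<open>R\<close>, and the localization of \<open>R/I\<close> there
  is a ring of fractions of \<open>R/I\<close> with denominators outside \<open>N\<close>.\<close>
lemma (in cring) localization_of_quotient:
  assumes I: "ideal I R" and M: "maximalideal M (R Quot I)"
  defines "N \<equiv> {a \<in> carrier R. I +> a \<in> M}"
  defines "L \<equiv> localization (R Quot I) (carrier (R Quot I) - M)"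
  shows "maximalideal N R" "I \<subseteq> N"
    "ring_of_fractions R L (\<lambda>a. frac_rel (R Quot I) (carrier (R Quot I) - M) `` {(I +> a, \<one>\<^bsub>R Quot I\<^esub>)}) I (carrier R - N)"
proof -
  let ?Q = "R Quot I"
  interpret I: ideal I R by fact
  interpret Q: cring ?Q by (rule I.quotient_is_cring[OF is_cring])
  interpret proj: ring_hom_cring R ?Q "(+>) I" by (rule I.rcos_ring_hom_cring[OF is_cring])
  interpret M: maximalideal M ?Q by fact
  interpret Mp: primeideal M ?Q by (rule Q.maximalideal_prime[OF M])
  have Qcarr: "carrier ?Q = (+>) I ` carrier R"
    unfolding FactRing_def A_RCOSETS_def' by simp blast
  have Qzero: "I +> a = \<zero>\<^bsub>?Q\<^esub> \<longleftrightarrow> a \<in> I" if "a \<in> carrier R" for a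
  proof -
    have "\<zero>\<^bsub>?Q\<^esub> = I" unfolding FactRing_def by simp
    then show ?thesis using I.rcos_const_imp_mem[OF that] a_rcos_zero[OF I, of a] by argo
  qed
  have Nid: "ideal N R" unfolding N_def by (rule proj.ring.ideal_vimage[OF M.is_ideal])
  show IN: "I \<subseteq> N"
  proof
    fix i assume i: "i \<in> I"
    then show "i \<in> N" unfolding N_def using Qzero[of i] M.zero_closed I.Icarr by auto
  qed
  interpret N: ideal N R by (rule Nid)
  have one: "\<one> \<notin> N" unfolding N_def using proj.hom_one M.one_imp_carrier M.I_notcarr by auto
  show max: "maximalideal N R"
  proof (rule maximalidealI[OF Nid])
    show "carrier R \<noteq> N" using one by auto
    fix J assume J: "ideal J R" "N \<subseteq> J" "J \<subseteq> carrier R"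
    interpret J: ideal J R by fact
    have "J = N" if "\<one> \<notin> J"
    proof -
      have "M \<subseteq> (+>) I ` J"
      proof
        fix x assume x: "x \<in> M"
        have "x \<in> (+>) I ` carrier R" using M.Icarr[OF x] unfolding Qcarr .
        then obtain a where a: "a \<in> carrier R" "x = I +> a" by (rule imageE)
        have "a \<in> J" using x a J(2) unfolding N_def by blast
        then show "x \<in> (+>) I ` J" using a(2) by blast
      qed
      moreover have "ideal ((+>) I ` J) ?Q" using ring_ideal_imp_quot_ideal[OF I J(1)] .
      moreover have "(+>) I ` J \<subseteq> carrier ?Q" unfolding Qcarr using J(3) by (rule image_mono)
      ultimately have "(+>) I ` J = M \<or> (+>) I ` J = carrier ?Q"
        using M.I_maximal by blast
      then show "J = N"
      proof
        assume "(+>) I ` J = M"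
        then have "J \<subseteq> N" unfolding N_def using J(3) by blast
        then show ?thesis using J(2) by blast
      next
        assume "(+>) I ` J = carrier ?Q"
        then obtain j where j: "j \<in> J" "I +> j = I +> \<one>" unfolding Qcarr by (metis imageE image_eqI one_closed)
        then have "I +> (\<one> \<ominus> j) = \<zero>\<^bsub>?Q\<^esub>"
          using proj.hom_sub[of \<one> j] J.Icarr by (simp add: Q.r_neg Q.minus_eq)
        then have "\<one> \<ominus> j \<in> J" using Qzero[of "\<one> \<ominus> j"] j IN J(2) J.Icarr by auto
        then have "(\<one> \<ominus> j) \<oplus> j \<in> J" using j J.a_closed by blast
        moreover have "(\<one> \<ominus> j) \<oplus> j = \<one>" using J.Icarr[OF j(1)] by algebra
        ultimately show ?thesis using that by simp
      qed
    qed
    then show "J = N \<or> J = carrier R" using J.one_imp_carrier by auto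
  qed
  define T where "T = carrier ?Q - M"
  interpret T: multiplicative_subset ?Q T
  proof
    show "\<one>\<^bsub>?Q\<^esub> \<in> T" unfolding T_def using M.one_imp_carrier M.I_notcarr by auto
    show "s \<otimes>\<^bsub>?Q\<^esub> t \<in> T" if "s \<in> T" "t \<in> T" for s t
      using that Mp.I_prime unfolding T_def by auto
  qed (auto simp: T_def)
  let ?L = "localization ?Q T"
  interpret L: cring ?L by (rule T.cring_localization)
  note [simp] = T.T_one
  have W: "I +> w \<in> T \<longleftrightarrow> w \<in> carrier R - N" if "w \<in> carrier R" for w
    using that proj.hom_closed[OF that] unfolding T_def N_def by blast
  have "ring_of_fractions R (?L) (\<lambda>a. T.frac (I +> a) \<one>\<^bsub>?Q\<^esub>) I (carrier R - N)"
  proof (intro ring_of_fractions.intro ring_of_fractions_axioms.intro I ring_hom_cring.intro ring_hom_cring_axioms.intro)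
    show "(\<lambda>a. T.frac (I +> a) \<one>\<^bsub>?Q\<^esub>) \<in> ring_hom R (?L)"
      by (rule ring_hom_memI)
        (simp_all add: T.mult_localization T.add_localization T.one_localization)
    show "cring R" by (rule is_cring)
    show "cring (?L)" by (rule L.is_cring)
    show "carrier R - N \<subseteq> carrier R" by auto
    show "\<one> \<in> carrier R - N" using one by simp
    show "v \<otimes> w \<in> carrier R - N" if "v \<in> carrier R - N" "w \<in> carrier R - N" for v w
      using that W[of v] W[of w] W[of "v \<otimes> w"] T.T_mult[of "I +> v" "I +> w"] by simp
  next
    fix w assume w: "w \<in> carrier R - N"
    then have w': "w \<in> carrier R" "I +> w \<in> T" using W by auto
    have "T.frac (I +> w) \<one>\<^bsub>?Q\<^esub> \<otimes>\<^bsub>?L\<^esub> T.frac \<one>\<^bsub>?Q\<^esub> (I +> w) = \<one>\<^bsub>?L\<^esub>"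
      using w' by (simp add: T.mult_localization T.one_localization T.T_closed) (intro T.frac_eqI, simp_all)
    moreover have "T.frac (I +> w) \<one>\<^bsub>?Q\<^esub> \<in> carrier (?L)"
      "T.frac \<one>\<^bsub>?Q\<^esub> (I +> w) \<in> carrier (?L)" using w' by simp_all
    ultimately show "T.frac (I +> w) \<one>\<^bsub>?Q\<^esub> \<in> Units (?L)"
      unfolding Units_def using L.m_comm by fastforce
  next
    fix q assume "q \<in> carrier (?L)"
    then obtain x s where x: "q = T.frac x s" "x \<in> carrier ?Q" "s \<in> T" by (rule T.carrier_localizationE)
    have "x \<in> (+>) I ` carrier R" "s \<in> (+>) I ` carrier R"
      using x(2) T.T_closed[OF x(3)] unfolding Qcarr by simp_all
    then obtain a w where a: "x = I +> a" "a \<in> carrier R" "s = I +> w" "w \<in> carrier R"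
      by (metis imageE)
    have "T.frac x s \<otimes>\<^bsub>?L\<^esub> T.frac s \<one>\<^bsub>?Q\<^esub> = T.frac x \<one>\<^bsub>?Q\<^esub>"
      using x T.T_closed by (simp add: T.mult_localization) (intro T.frac_eqI, simp_all add: Q.m_comm)
    then show "\<exists>a\<in>carrier R. \<exists>w\<in>carrier R - N. q \<otimes>\<^bsub>?L\<^esub> T.frac (I +> w) \<one>\<^bsub>?Q\<^esub> =
        T.frac (I +> a) \<one>\<^bsub>?Q\<^esub>" using a x W[of w] by (intro bexI[of _ a] bexI[of _ w]) simp_all
  next
    fix a assume a: "a \<in> carrier R"
    have "T.frac (I +> a) \<one>\<^bsub>?Q\<^esub> = \<zero>\<^bsub>?L\<^esub> \<longleftrightarrow>
        (\<exists>u\<in>T. u \<otimes>\<^bsub>?Q\<^esub> (I +> a) = \<zero>\<^bsub>?Q\<^esub>)"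
      unfolding T.zero_localization using a T.T_closed by (subst T.frac_eq_iff) auto
    also have "\<dots> \<longleftrightarrow> (\<exists>w\<in>carrier R - N. (I +> w) \<otimes>\<^bsub>?Q\<^esub> (I +> a) = \<zero>\<^bsub>?Q\<^esub>)"
    proof (intro iffI; elim bexE)
      fix u assume u: "u \<in> T" "u \<otimes>\<^bsub>?Q\<^esub> (I +> a) = \<zero>\<^bsub>?Q\<^esub>"
      then have "u \<in> (+>) I ` carrier R" using T.T_closed[OF u(1)] unfolding Qcarr by simp
      then obtain w where w: "w \<in> carrier R" "u = I +> w" by (metis imageE)
      then show "\<exists>w\<in>carrier R - N. (I +> w) \<otimes>\<^bsub>?Q\<^esub> (I +> a) = \<zero>\<^bsub>?Q\<^esub>"
        using u W[OF w(1)] by blast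
    next
      fix w assume "w \<in> carrier R - N" "(I +> w) \<otimes>\<^bsub>?Q\<^esub> (I +> a) = \<zero>\<^bsub>?Q\<^esub>"
      then show "\<exists>u\<in>T. u \<otimes>\<^bsub>?Q\<^esub> (I +> a) = \<zero>\<^bsub>?Q\<^esub>" using W[of w] by blast
    qed
    also have "\<dots> \<longleftrightarrow> (\<exists>w\<in>carrier R - N. w \<otimes> a \<in> I)"
    proof (rule bex_cong[OF refl])
      fix w assume w: "w \<in> carrier R - N"
      then have "(I +> w) \<otimes>\<^bsub>?Q\<^esub> (I +> a) = I +> (w \<otimes> a)" using a proj.hom_mult[of w a] by simp
      then show "(I +> w) \<otimes>\<^bsub>?Q\<^esub> (I +> a) = \<zero>\<^bsub>?Q\<^esub> \<longleftrightarrow> w \<otimes> a \<in> I"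
        using Qzero[of "w \<otimes> a"] w a by simp
    qed
    finally show "T.frac (I +> a) \<one>\<^bsub>?Q\<^esub> = \<zero>\<^bsub>?L\<^esub> \<longleftrightarrow> (\<exists>w\<in>carrier R - N. w \<otimes> a \<in> I)" .
  qed
  then show "ring_of_fractions R L (\<lambda>a. frac_rel ?Q (carrier ?Q - M) `` {(I +> a, \<one>\<^bsub>?Q\<^esub>)}) I (carrier R - N)"
    unfolding L_def T.frac_def unfolding T_def .
qed

text \<open>The quotient is the ring of fractions with the single denominator \<open>\<one>\<close>.\<close>
lemma (in cring) noetherian_quotient:
  assumes I: "ideal I R" and "noetherian_ring R"
  shows "noetherian_ring (R Quot I)"
proof -
  interpret I: ideal I R by fact
  interpret Q: cring "R Quot I" by (rule I.quotient_is_cring[OF is_cring])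
  interpret proj: ring_hom_cring R "R Quot I" "(+>) I" by (rule I.rcos_ring_hom_cring[OF is_cring])
  have "ring_of_fractions R (R Quot I) ((+>) I) I {\<one>}"
  proof (intro ring_of_fractions.intro ring_of_fractions_axioms.intro I proj.ring_hom_cring_axioms)
    show "\<exists>a\<in>carrier R. \<exists>w\<in>{\<one>}. q \<otimes>\<^bsub>R Quot I\<^esub> (I +> w) = I +> a" if "q \<in> carrier (R Quot I)" for q
    proof -
      have "q \<in> (+>) I ` carrier R" using that unfolding FactRing_def A_RCOSETS_def' by simp blast
      then obtain a where "a \<in> carrier R" "q = I +> a" by (rule imageE)
      then show ?thesis using proj.hom_one Q.r_one[OF that] by (intro bexI[of _ a] bexI[of _ \<one>]) simp_all
    qed
    show "I +> a = \<zero>\<^bsub>R Quot I\<^esub> \<longleftrightarrow> (\<exists>w\<in>{\<one>}. w \<otimes> a \<in> I)" if "a \<in> carrier R" for a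
    proof -
      have z: "\<zero>\<^bsub>R Quot I\<^esub> = I" unfolding FactRing_def by simp
      have e: "(\<exists>w\<in>{\<one>}. w \<otimes> a \<in> I) = (a \<in> I)" using that by simp
      show ?thesis unfolding e z using I.rcos_const_imp_mem[OF that] a_rcos_zero[OF I, of a] by argo
    qed
  qed (use proj.hom_one in auto)
  then show ?thesis by (rule ring_of_fractions.noetherian_ring_of_fractions) fact
qed

text \<open>A criterion entirely in terms of \<open>R\<close>: both conditions speak of ideals of \<open>R\<close> that contain \<open>I\<close>. The
  regular sequence may depend on the maximal ideal, only its length must not.\<close>
theorem (in cring) cohen_macaulay_quotientI:
  assumes I: "ideal I R" and noeth: "noetherian_ring R"
    and bound: "\<And>C k. \<forall>i\<le>k. primeideal (C i) R \<Longrightarrow> I \<subseteq> C 0 \<Longrightarrow> \<forall>i<k. C i \<subset> C (Suc i) \<Longrightarrow> k \<le> n"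
    and reg: "\<And>M. maximalideal M R \<Longrightarrow> I \<subseteq> M \<Longrightarrow>
      \<exists>gs. length gs = n \<and> set gs \<subseteq> M \<and> weakly_regular R I gs"
  shows "cohen_macaulay_ring (R Quot I)"
  unfolding cohen_macaulay_ring_def
proof (intro conjI allI impI)
  show "cring (R Quot I)" by (rule ideal.quotient_is_cring[OF I is_cring])
  show "noetherian_ring (R Quot I)" by (rule noetherian_quotient[OF I noeth])
  fix M assume M: "maximalideal M (R Quot I)"
  note loc = localization_of_quotient[OF I M]
  obtain gs where gs: "length gs = n" "set gs \<subseteq> {a \<in> carrier R. I +> a \<in> M}" "weakly_regular R I gs"
    using reg[OF loc(1,2)] by auto
  show "cohen_macaulay_local_ring (localization (R Quot I) (carrier (R Quot I) - M))"
    by (rule ring_of_fractions.cohen_macaulay_ring_of_fractions[OF loc(3) noeth loc(1,2) refl gs(2,3)])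
      (use bound gs(1) in blast)
qed

section \<open>Polynomials in one of several variables\<close>

abbreviation "keys \<equiv> Poly_Mapping.keys"
abbreviation "lookup \<equiv> Poly_Mapping.lookup"
abbreviation "single \<equiv> Poly_Mapping.single"

text \<open>The carrier of \<^const>\<open>mpoly_ring\<close>, without the token for the coefficient type.\<close>
definition mpolys :: "'v set \<Rightarrow> ('v, 'k::field) mpoly set" where
  "mpolys V = {p. \<forall>m\<in>keys p. keys m \<subseteq> V}"

definition const_poly :: "'k::field \<Rightarrow> ('v, 'k) mpoly" where
  "const_poly c = single 0 c"

lemma mpoly_ring_simps [simp]:
  "carrier (mpoly_ring K V) = mpolys V" "\<zero>\<^bsub>mpoly_ring K V\<^esub> = 0" "\<one>\<^bsub>mpoly_ring K V\<^esub> = 1"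
  "p \<oplus>\<^bsub>mpoly_ring K V\<^esub> q = p + q" "p \<otimes>\<^bsub>mpoly_ring K V\<^esub> q = p * q"
  by (simp_all add: mpoly_ring_def mpolys_def)

lemma mpolys_mono: "U \<subseteq> V \<Longrightarrow> mpolys U \<subseteq> mpolys V"
  by (auto simp: mpolys_def)

lemma mpolys_0 [simp, intro]: "0 \<in> mpolys V" and mpolys_1 [simp, intro]: "1 \<in> mpolys V"
  by (auto simp: mpolys_def)

lemma mpolys_single: "keys m \<subseteq> V \<Longrightarrow> single m c \<in> mpolys V"
  by (auto simp: mpolys_def)

lemma mpolys_const_poly [simp, intro]: "const_poly c \<in> mpolys V"
  by (auto simp: const_poly_def intro: mpolys_single)

lemma mpolys_var [simp, intro]: "v \<in> V \<Longrightarrow> poly_var v \<in> mpolys V"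
  by (auto simp: poly_var_def intro: mpolys_single)

lemma mpolys_add [intro]: "p \<in> mpolys V \<Longrightarrow> q \<in> mpolys V \<Longrightarrow> p + q \<in> mpolys V"
  using keys_add[of p q] by (auto simp: mpolys_def)

lemma mpolys_uminus [intro]: "p \<in> mpolys V \<Longrightarrow> - p \<in> mpolys V"
  by (auto simp: mpolys_def in_keys_iff)

lemma mpolys_diff [intro]: "p \<in> mpolys V \<Longrightarrow> q \<in> mpolys V \<Longrightarrow> p - q \<in> mpolys V"
  using mpolys_add[OF _ mpolys_uminus, of p V q] by simp

lemma mpolys_mult [intro]: "p \<in> mpolys V \<Longrightarrow> q \<in> mpolys V \<Longrightarrow> p * q \<in> mpolys V"
proof (clarsimp simp: mpolys_def)
  fix m v assume pq: "\<forall>m\<in>keys p. keys m \<subseteq> V" "\<forall>m\<in>keys q. keys m \<subseteq> V"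
    and m: "m \<in> keys (p * q)" "v \<in> keys m"
  then obtain a b where "a \<in> keys p" "b \<in> keys q" "m = a + b"
    using keys_mult[of p q] by blast
  then show "v \<in> V" using pq m(2) keys_add[of a b] by blast
qed

lemma mpolys_power [intro]: "p \<in> mpolys V \<Longrightarrow> p ^ n \<in> mpolys V"
  by (induction n) auto

lemma mpolys_sum [intro]: "(\<And>i. i \<in> A \<Longrightarrow> f i \<in> mpolys V) \<Longrightarrow> sum f A \<in> mpolys V"
  by (induction A rule: infinite_finite_induct) auto

lemma mpolys_prod [intro]: "(\<And>i. i \<in> A \<Longrightarrow> f i \<in> mpolys V) \<Longrightarrow> prod f A \<in> mpolys V"
  by (induction A rule: infinite_finite_induct) auto

lemma cring_mpoly_ring: "cring (mpoly_ring K V)"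
proof (rule cringI)
  show "abelian_group (mpoly_ring K V)"
  proof (rule abelian_groupI)
    show "\<exists>q\<in>carrier (mpoly_ring K V). q \<oplus>\<^bsub>mpoly_ring K V\<^esub> p = \<zero>\<^bsub>mpoly_ring K V\<^esub>"
      if "p \<in> carrier (mpoly_ring K V)" for p
      using that by (intro bexI[of _ "- p"]) auto
  qed (auto simp: algebra_simps)
  show "comm_monoid (mpoly_ring K V)"
    by (rule comm_monoidI) (auto simp: algebra_simps)
qed (auto simp: algebra_simps)

lemma mpoly_ring_a_inv: "p \<in> mpolys V \<Longrightarrow> \<ominus>\<^bsub>mpoly_ring K V\<^esub> p = - p"
proof -
  assume p: "p \<in> mpolys V"
  interpret cring "mpoly_ring K V" by (rule cring_mpoly_ring)
  show ?thesis using p by (intro minus_equality[symmetric, THEN sym]) auto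
qed

lemma ideal_mpoly_ring_iff:
  "ideal J (mpoly_ring K V) \<longleftrightarrow> J \<subseteq> mpolys V \<and> 0 \<in> J \<and> (\<forall>p\<in>J. \<forall>q\<in>J. p + q \<in> J) \<and>
     (\<forall>p\<in>J. \<forall>s\<in>mpolys V. s * p \<in> J)"
proof
  interpret cring "mpoly_ring K V" by (rule cring_mpoly_ring)
  assume "ideal J (mpoly_ring K V)"
  then interpret J: ideal J "mpoly_ring K V" .
  show "J \<subseteq> mpolys V \<and> 0 \<in> J \<and> (\<forall>p\<in>J. \<forall>q\<in>J. p + q \<in> J) \<and> (\<forall>p\<in>J. \<forall>s\<in>mpolys V. s * p \<in> J)"
    using J.a_subset J.zero_closed J.a_closed J.I_l_closed by simp
next
  interpret cring "mpoly_ring K V" by (rule cring_mpoly_ring)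
  assume J: "J \<subseteq> mpolys V \<and> 0 \<in> J \<and> (\<forall>p\<in>J. \<forall>q\<in>J. p + q \<in> J) \<and> (\<forall>p\<in>J. \<forall>s\<in>mpolys V. s * p \<in> J)"
  show "ideal J (mpoly_ring K V)"
  proof (rule idealI)
    show "subgroup J (add_monoid (mpoly_ring K V))"
    proof (rule add.subgroupI)
      fix p assume p: "p \<in> J"
      then have "(- 1) * p \<in> J" using J mpolys_uminus[OF mpolys_1] by blast
      then show "\<ominus>\<^bsub>mpoly_ring K V\<^esub> p \<in> J" using mpoly_ring_a_inv[of p V K] p J by auto
    qed (use J in auto)
    show "p \<otimes>\<^bsub>mpoly_ring K V\<^esub> x \<in> J" if "p \<in> J" "x \<in> carrier (mpoly_ring K V)" for p x
      using that J by (simp add: mult.commute[of p])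
  qed (use J ring_axioms in auto)
qed

lemma ideal_mpoly_ring_diff:
  "ideal J (mpoly_ring K V) \<Longrightarrow> p \<in> J \<Longrightarrow> q \<in> J \<Longrightarrow> p - q \<in> J"
  unfolding ideal_mpoly_ring_iff
  by (metis (no_types, lifting) diff_conv_add_uminus mpolys_1 mpolys_uminus mult_minus1)

lemma mpoly_sum_monomials:
  "p = (\<Sum>m\<in>keys p. single m (lookup p m))"
  by (rule poly_mapping_eqI) (auto simp: lookup_sum lookup_single when_def in_keys_iff)

text \<open>Polynomials are built from constants by multiplication with variables and addition; the induction for
  monomials is on the total degree.\<close>
lemma mpolys_induct [consumes 2, case_names const var add]:
  fixes p :: "('v, 'k::field) mpoly"
  assumes "finite V" "p \<in> mpolys V"
    and c: "\<And>c. Q (const_poly c)" and v: "\<And>p v. p \<in> mpolys V \<Longrightarrow> v \<in> V \<Longrightarrow> Q p \<Longrightarrow> Q (poly_var v * p)"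
    and a: "\<And>p q. p \<in> mpolys V \<Longrightarrow> q \<in> mpolys V \<Longrightarrow> Q p \<Longrightarrow> Q q \<Longrightarrow> Q (p + q)"
  shows "Q p"
proof -
  have mono: "Q (single m c)" if "keys m \<subseteq> V" for m c
    using that
  proof (induction "\<Sum>v\<in>V. lookup m v" arbitrary: m)
    case 0
    then have "\<forall>v\<in>V. lookup m v = 0" using assms(1) by simp
    then have "m = 0" using 0(2) by (intro poly_mapping_eqI) (auto simp: in_keys_iff)
    then show ?case using c by (simp add: const_poly_def)
  next
    case (Suc n)
    then obtain v where v: "v \<in> V" "lookup m v > 0" by (metis bot_nat_0.not_eq_extremum nat.distinct(1) sum.neutral)
    define m' where "m' = m - single v 1"
    have lk: "lookup m' w = lookup m w - (if w = v then 1 else 0)" for w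
      by (simp add: m'_def lookup_minus lookup_single when_def)
    have m: "m = single v 1 + m'"
      using v(2) by (intro poly_mapping_eqI) (auto simp: lookup_add lk lookup_single when_def)
    have "(\<Sum>v\<in>V. lookup m v) = 1 + (\<Sum>v\<in>V. lookup m' v)"
      using assms(1) v(1) by (simp add: m lookup_add sum.distrib lookup_single when_def)
    moreover have k: "keys m' \<subseteq> V" using Suc.prems by (auto simp: in_keys_iff lk subset_iff)
    ultimately have "Q (single m' c)" using Suc by auto
    then have "Q (poly_var v * single m' c)"
      using v(1) k by (intro assms(4) mpolys_single) auto
    then show ?case by (simp add: poly_var_def mult_single m)
  qed
  have "Q (\<Sum>m\<in>M. single m (lookup p m))" if "finite M" "M \<subseteq> keys p" for M
    using that
  proof (induction M rule: finite_induct)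
    case empty
    then show ?case using c[of 0] by (simp add: const_poly_def)
  next
    case (insert m M)
    then show ?case using assms(2) mono
      by (auto intro!: a mpolys_single mpolys_sum simp: mpolys_def)
  qed
  then show ?thesis using mpoly_sum_monomials[of p] by (metis finite_keys order_refl)
qed

definition drop_var :: "'v \<Rightarrow> ('v \<Rightarrow>\<^sub>0 nat) \<Rightarrow> ('v \<Rightarrow>\<^sub>0 nat)" where
  "drop_var z m = m - single z (lookup m z)"

text \<open>A polynomial seen as a univariate polynomial in \<open>z\<close> whose coefficients are polynomials in the other variables.
  This makes degrees, leading coefficients and the coefficient formula for products available; its
  inverse is evaluation at the variable \<open>z\<close> (\<open>poly_as_poly\<close>).\<close>
definition as_poly :: "'v \<Rightarrow> ('v, 'k::field) mpoly \<Rightarrow> ('v, 'k) mpoly poly" where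
  "as_poly z p = (\<Sum>m\<in>keys p. Polynomial.monom
     (single (drop_var z m) (lookup p m)) (lookup m z))"

lemma lookup_drop_var: "lookup (drop_var z m) v = (if v = z then 0 else lookup m v)"
  by (simp add: drop_var_def lookup_minus lookup_single when_def)

lemma drop_var_add: "drop_var z (m + n) = drop_var z m + drop_var z n"
  by (rule poly_mapping_eqI) (simp add: lookup_drop_var lookup_add)

lemma drop_var_split: "m = drop_var z m + single z (lookup m z)"
  by (rule poly_mapping_eqI) (simp add: lookup_drop_var lookup_add lookup_single when_def)

lemma as_poly_single: "as_poly z (single m c) =
    Polynomial.monom (single (drop_var z m) c) (lookup m z)"
  by (cases "c = 0") (simp_all add: as_poly_def)

lemma as_poly_0 [simp]: "as_poly z 0 = 0"
  by (simp add: as_poly_def)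

lemma as_poly_add: "as_poly z (p + q) = as_poly z p + as_poly z q"
  unfolding as_poly_def
  by (rule setsum_keys_plus_distrib) (simp_all add: single_add add_monom)

lemma as_poly_uminus: "as_poly z (- p) = - as_poly z p"
  using as_poly_add[of z p "- p"] by (simp add: eq_neg_iff_add_eq_0 add.commute)

lemma as_poly_diff: "as_poly z (p - q) = as_poly z p - as_poly z q"
  using as_poly_add[of z p "- q"] by (simp add: as_poly_uminus)

lemma as_poly_sum: "as_poly z (sum f A) = (\<Sum>i\<in>A. as_poly z (f i))"
  by (induction A rule: infinite_finite_induct) (auto simp: as_poly_add)

text \<open>Both sides are bilinear, and on monomials the equation is additivity of exponents.\<close>
lemma as_poly_mult: "as_poly z (p * q) = as_poly z p * as_poly z q"
proof -
  let ?s = "single"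
  have "as_poly z (p * q) = as_poly z
     ((\<Sum>m\<in>keys p. ?s m (lookup p m)) * (\<Sum>n\<in>keys q. ?s n (lookup q n)))"
    using mpoly_sum_monomials[of p] mpoly_sum_monomials[of q] by simp
  also have "\<dots> = (\<Sum>m\<in>keys p. \<Sum>n\<in>keys q.
      as_poly z (?s m (lookup p m)) * as_poly z (?s n (lookup q n)))"
    by (simp add: sum_product as_poly_sum mult_single as_poly_single drop_var_add lookup_add mult_monom)
  also have "\<dots> = as_poly z p * as_poly z q"
    unfolding as_poly_single by (simp only: sum_product as_poly_def)
  finally show ?thesis .
qed

lemma as_poly_free:
  assumes "p \<in> mpolys V" "z \<notin> V"
  shows "as_poly z p = [:p:]"
proof -
  have "as_poly z p = (\<Sum>m\<in>keys p. [:single m (lookup p m):])"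
    unfolding as_poly_def
  proof (rule sum.cong[OF refl])
    fix m assume "m \<in> keys p"
    then have "z \<notin> keys m" using assms by (auto simp: mpolys_def)
    then have 0: "lookup m z = 0" by (simp add: in_keys_iff)
    then have "drop_var z m = m" using drop_var_split[of m z] by simp
    then show "Polynomial.monom (single (drop_var z m) (lookup p m)) (lookup m z)
      = [:single m (lookup p m):]" using 0 by (simp add: monom_0)
  qed
  also have "\<dots> = [:\<Sum>m\<in>keys p. single m (lookup p m):]"
    by (induction "keys p" rule: infinite_finite_induct) (simp_all add: sum_to_poly)
  finally show ?thesis using mpoly_sum_monomials[of p] by simp
qed

lemma as_poly_1 [simp]: "as_poly z 1 = 1"
  using as_poly_free[of 1 "{}" z] by (simp add: one_pCons)

lemma as_poly_power: "as_poly z (p ^ n) = as_poly z p ^ n"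
  by (induction n) (simp_all add: as_poly_mult)

lemma as_poly_const [simp]: "as_poly z (const_poly c) = [:const_poly c:]"
  using as_poly_free[of "const_poly c" "{}" z] by simp

lemma as_poly_var: "as_poly z (poly_var z) = [:0, 1:]"
proof -
  have "drop_var z (single z 1) = 0"
    by (rule poly_mapping_eqI) (simp add: lookup_drop_var lookup_single when_def)
  then show ?thesis by (simp add: poly_var_def as_poly_single monom_altdef)
qed

lemma poly_var_power: "poly_var v ^ i = single (single v i) 1"
  by (induction i) (simp_all add: poly_var_def mult_single flip: single_add)

lemma poly_as_poly: "poly (as_poly z p) (poly_var z) = p"
proof -
  have "poly (as_poly z p) (poly_var z) = (\<Sum>m\<in>keys p. single m (lookup p m))"
    unfolding as_poly_def poly_sum
    using drop_var_split[of _ z] by (simp add: poly_monom poly_var_power mult_single)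
  then show ?thesis using mpoly_sum_monomials[of p] by simp
qed

lemma as_poly_eq_0_iff [simp]: "as_poly z p = 0 \<longleftrightarrow> p = 0"
  using poly_as_poly[of z p] by auto

lemma coeff_as_poly_mpolys:
  assumes "p \<in> mpolys (insert z V)"
  shows "coeff (as_poly z p) i \<in> mpolys (V - {z})"
  unfolding as_poly_def coeff_sum
proof (rule mpolys_sum)
  fix m assume "m \<in> keys p"
  then have "keys m \<subseteq> insert z V" using assms by (simp add: mpolys_def)
  then have "keys (drop_var z m) \<subseteq> V - {z}"
    by (auto simp: in_keys_iff lookup_drop_var subset_iff split: if_splits)
  then show "coeff (Polynomial.monom (single (drop_var z m) (lookup p m)) (lookup m z)) i
      \<in> mpolys (V - {z})" by (auto intro: mpolys_single)
qed

lemma mpolys_empty: "p \<in> mpolys {} \<longleftrightarrow> (\<exists>c. p = const_poly c)"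
proof
  assume p: "p \<in> mpolys {}"
  have "p = const_poly (lookup p 0)"
  proof (rule poly_mapping_eqI)
    fix m
    have "m \<notin> keys p" if "m \<noteq> 0"
      using p that by (auto simp: mpolys_def)
    then show "lookup p m = lookup (const_poly (lookup p 0)) m"
      by (cases "m = 0") (auto simp: const_poly_def lookup_single in_keys_iff)
  qed
  then show "\<exists>c. p = const_poly c" by blast
qed auto

lemma const_poly_mult: "const_poly a * const_poly b = const_poly (a * b)"
  and const_poly_1 [simp]: "const_poly 1 = 1" and const_poly_0 [simp]: "const_poly 0 = 0"
  by (simp_all add: const_poly_def mult_single)

section \<open>Hilbert's basis theorem\<close>

text \<open>The leading coefficients in degree \<open>d\<close> of the elements of \<open>J\<close>, together with \<open>0\<close>, which arises from elements of
  smaller degree.\<close>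
definition lead_coeffs :: "'v \<Rightarrow> ('v, 'k::field) mpoly set \<Rightarrow> nat \<Rightarrow> ('v, 'k) mpoly set" where
  "lead_coeffs z J d = (\<lambda>p. coeff (as_poly z p) d) ` {p \<in> J. degree (as_poly z p) \<le> d}"

lemma ideal_lead_coeffs:
  fixes J :: "('v, 'k::field) mpoly set"
  assumes J: "ideal J (mpoly_ring K (insert z V))" and z: "z \<notin> V"
  shows "ideal (lead_coeffs z J d) (mpoly_ring K V)"
  unfolding ideal_mpoly_ring_iff
proof (intro conjI ballI)
  have J': "J \<subseteq> mpolys (insert z V)" "0 \<in> J" "\<And>p q. p \<in> J \<Longrightarrow> q \<in> J \<Longrightarrow> p + q \<in> J"
    "\<And>p s. p \<in> J \<Longrightarrow> s \<in> mpolys (insert z V) \<Longrightarrow> s * p \<in> J"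
    using J unfolding ideal_mpoly_ring_iff by blast+
  show "lead_coeffs z J d \<subseteq> mpolys V"
    using coeff_as_poly_mpolys[of _ z V] J'(1) z by (auto simp: lead_coeffs_def)
  show "0 \<in> lead_coeffs z J d"
    unfolding lead_coeffs_def using J'(2) by (intro image_eqI[of _ _ 0]) auto
  fix a assume "a \<in> lead_coeffs z J d"
  then obtain p where p: "p \<in> J" "degree (as_poly z p) \<le> d" "a = coeff (as_poly z p) d"
    by (auto simp: lead_coeffs_def)
  {
    fix b assume "b \<in> lead_coeffs z J d"
    then obtain q where q: "q \<in> J" "degree (as_poly z q) \<le> d" "b = coeff (as_poly z q) d"
      by (auto simp: lead_coeffs_def)
    show "a + b \<in> lead_coeffs z J d"
      unfolding lead_coeffs_def using p q J'(3)[of p q]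
      by (intro image_eqI[of _ _ "p + q"]) (auto simp: as_poly_add intro: degree_add_le)
  }
  fix s :: "('v, 'k) mpoly" assume s: "s \<in> mpolys V"
  then have "as_poly z (s * p) = smult s (as_poly z p)" "s * p \<in> J"
    using as_poly_free[OF s z] p(1) J'(4) mpolys_mono[of V "insert z V"] by (auto simp: as_poly_mult)
  then show "s * a \<in> lead_coeffs z J d"
    unfolding lead_coeffs_def using p degree_smult_le[of s "as_poly z p"]
    by (intro image_eqI[of _ _ "s * p"]) auto
qed

lemma lead_coeffs_Suc:
  assumes J: "ideal J (mpoly_ring K (insert z V))"
  shows "lead_coeffs z J d \<subseteq> lead_coeffs z J (Suc d)"
proof
  fix a assume "a \<in> lead_coeffs z J d"
  then obtain p where p: "p \<in> J" "degree (as_poly z p) \<le> d" "a = coeff (as_poly z p) d"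
    by (auto simp: lead_coeffs_def)
  have "as_poly z (poly_var z * p) = pCons 0 (as_poly z p)" "poly_var z * p \<in> J"
    using J p(1) by (auto simp: as_poly_mult as_poly_var ideal_mpoly_ring_iff)
  then show "a \<in> lead_coeffs z J (Suc d)"
    unfolding lead_coeffs_def using p by (intro image_eqI[of _ _ "poly_var z * p"]) auto
qed

text \<open>Hilbert's basis theorem, by induction on the number of variables. The ideals of leading coefficients in degree
  \<open>d\<close> ascend with \<open>d\<close> and are constant from some \<open>N\<close> on. Choose for each \<open>d \<le> N\<close> finitely many elements of \<open>J\<close>
  whose leading coefficients generate the ideal in degree \<open>d\<close>. The ideal \<open>H\<close> generated by all of them
  has the same leading coefficients as \<open>J\<close> in every degree, so subtracting elements of \<open>H\<close> lowers the
  degree of any element of \<open>J\<close> until it is zero.\<close>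
theorem noetherian_mpoly_ring:
  fixes K :: "'k::field itself"
  assumes "finite V"
  shows "noetherian_ring (mpoly_ring K V)"
  using assms
proof (induction V rule: finite_induct)
  case empty
  interpret S: cring "mpoly_ring K {}" by (rule cring_mpoly_ring)
  show ?case
  proof (rule S.noetherian_ringI)
    fix J assume J: "ideal J (mpoly_ring K {})"
    interpret J: ideal J "mpoly_ring K {}" by fact
    show "\<exists>A\<subseteq>carrier (mpoly_ring K {}). finite A \<and> J = Idl\<^bsub>mpoly_ring K {}\<^esub> A"
    proof (cases "J = {0}")
      case True
      then show ?thesis using S.genideal_zero by (intro exI[of _ "{0}"]) auto
    next
      case False
      then obtain p where p: "p \<in> J" "p \<noteq> 0" using J by (auto simp: ideal_mpoly_ring_iff)
      then have "p \<in> mpolys {}" using J by (auto simp: ideal_mpoly_ring_iff)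
      then obtain c where c: "p = const_poly c" by (auto simp: mpolys_empty)
      have "const_poly (inverse c) * p \<in> J" using J p(1) by (auto simp: ideal_mpoly_ring_iff)
      moreover have "const_poly (inverse c) * p = 1" using p(2) c by (cases "c = 0") (auto simp: const_poly_mult)
      ultimately have "J = mpolys {}" using J.one_imp_carrier by simp
      then show ?thesis using S.genideal_one by (intro exI[of _ "{1}"]) auto
    qed
  qed
next
  case (insert z V)
  let ?S = "mpoly_ring K (insert z V)"
  interpret S: cring ?S by (rule cring_mpoly_ring)
  interpret S0: noetherian_ring "mpoly_ring K V" by fact
  show ?case
  proof (rule S.noetherian_ringI)
    fix J assume J: "ideal J ?S"
    let ?L = "lead_coeffs z J"
    note idl = ideal_lead_coeffs[OF _ insert.hyps(2)]
    have mono: "lead_coeffs z X d \<subseteq> lead_coeffs z X e" if "ideal X ?S" "d \<le> e" for X d e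
      using that(2) by (induction rule: dec_induct) (use lead_coeffs_Suc[OF that(1)] in blast)+
    have "subset.chain {I. ideal I (mpoly_ring K V)} (range ?L)"
      unfolding subset_chain_def using idl[OF J] mono[OF J] nat_le_linear by blast
    then have "\<Union>(range ?L) \<in> range ?L"
      by (intro S0.ideal_chain_is_trivial) auto
    then obtain N where N: "\<Union>(range ?L) = ?L N" by auto
    have "\<forall>d. \<exists>G. finite G \<and> G \<subseteq> {p \<in> J. degree (as_poly z p) \<le> d} \<and>
        ?L d = Idl\<^bsub>mpoly_ring K V\<^esub> ((\<lambda>p. coeff (as_poly z p) d) ` G)"
    proof
      fix d
      obtain A where A: "A \<subseteq> carrier (mpoly_ring K V)" "finite A" "?L d = Idl\<^bsub>mpoly_ring K V\<^esub> A"
        using S0.finetely_gen[OF idl[OF J, of d]] by metis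
      then have sub: "A \<subseteq> ?L d" using S0.genideal_self[of A] by metis
      have "\<exists>G\<subseteq>{p \<in> J. degree (as_poly z p) \<le> d}. finite G \<and>
          A = (\<lambda>p. coeff (as_poly z p) d) ` G"
        by (rule finite_subset_image[OF A(2) sub[unfolded lead_coeffs_def]])
      then show "\<exists>G. finite G \<and> G \<subseteq> {p \<in> J. degree (as_poly z p) \<le> d} \<and>
          ?L d = Idl\<^bsub>mpoly_ring K V\<^esub> ((\<lambda>p. coeff (as_poly z p) d) ` G)"
        unfolding A(3) by (elim exE conjE) (intro exI conjI, assumption+, simp only:)
    qed
    from choice[OF this] obtain G where G': "\<forall>d. finite (G d) \<and>
        G d \<subseteq> {p \<in> J. degree (as_poly z p) \<le> d} \<and>
        ?L d = Idl\<^bsub>mpoly_ring K V\<^esub> ((\<lambda>p. coeff (as_poly z p) d) ` G d)" ..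
    note G = conjunct1[OF spec[OF G']] conjunct1[OF conjunct2[OF spec[OF G']]]
      conjunct2[OF conjunct2[OF spec[OF G']]]
    let ?G = "\<Union>d\<le>N. G d"
    let ?H = "Idl\<^bsub>?S\<^esub> ?G"
    have GJ: "?G \<subseteq> J" using G(2) by blast
    have Gc: "?G \<subseteq> carrier ?S" using GJ J by (auto simp: ideal_mpoly_ring_iff)
    have H: "ideal ?H ?S" by (rule S.genideal_ideal[OF Gc])
    have HJ: "?H \<subseteq> J" by (rule S.genideal_minimal[OF J GJ])
    have LN: "?L d \<subseteq> lead_coeffs z ?H d" if "d \<le> N" for d
    proof -
      have "(\<lambda>p. coeff (as_poly z p) d) ` G d \<subseteq> lead_coeffs z ?H d"
        unfolding lead_coeffs_def using G(2)[of d] S.genideal_self[OF Gc] that by blast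
      then show ?thesis unfolding G(3)[of d] by (intro S0.genideal_minimal idl H)
    qed
    have L: "?L d \<subseteq> lead_coeffs z ?H d" for d
    proof (cases "d \<le> N")
      case False
      have "?L d \<subseteq> ?L N" using N by blast
      also have "\<dots> \<subseteq> lead_coeffs z ?H N" by (rule LN) simp
      also have "\<dots> \<subseteq> lead_coeffs z ?H d" using False by (intro mono[OF H]) simp
      finally show ?thesis .
    qed (rule LN)
    have "p \<in> ?H" if "p \<in> J" "as_poly z p = 0 \<or> degree (as_poly z p) < n" for p n
      using that
    proof (induction n arbitrary: p)
      case 0
      then show ?case using H by (auto simp: ideal_mpoly_ring_iff)
    next
      case (Suc n)
      then have "coeff (as_poly z p) n \<in> ?L n" by (auto simp: lead_coeffs_def)
      then obtain q where q: "q \<in> ?H" "degree (as_poly z q) \<le> n"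
        "coeff (as_poly z q) n = coeff (as_poly z p) n"
        using L[of n] by (auto simp: lead_coeffs_def)
      have "degree (as_poly z (p - q)) \<le> n"
        using q(2) Suc.prems(2) by (auto simp: as_poly_diff intro: degree_diff_le)
      moreover have "coeff (as_poly z (p - q)) n = 0" using q(3) by (simp add: as_poly_diff)
      ultimately have "as_poly z (p - q) = 0 \<or> degree (as_poly z (p - q)) < n"
        by (metis leading_coeff_0_iff order_le_less)
      then have "p - q \<in> ?H"
        using Suc.IH[of "p - q"] ideal_mpoly_ring_diff[OF J Suc.prems(1)] HJ q(1) by blast
      then have "(p - q) + q \<in> ?H" using H q(1) unfolding ideal_mpoly_ring_iff by blast
      then show ?case by simp
    qed
    then have "J = ?H" using HJ by blast
    moreover have "finite ?G" using G(1) by auto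
    ultimately show "\<exists>A\<subseteq>carrier ?S. finite A \<and> J = Idl\<^bsub>?S\<^esub> A" using Gc by blast
  qed
qed

section \<open>Algebraic independence modulo a prime ideal\<close>

text \<open>Fraction-free elimination over the domain \<open>B\<close>: one equation is used to eliminate an unknown \<open>a0\<close> with nonzero
  coefficient \<open>M e a0\<close> from the others, which leaves one equation and one unknown less.\<close>
lemma homogeneous_system_solution:
  fixes M :: "'e \<Rightarrow> 'a \<Rightarrow> 'r::comm_ring_1"
  assumes "finite E" "finite A" "card E < card A"
    and B: "0 \<in> B" "1 \<in> B" "\<And>x y. x \<in> B \<Longrightarrow> y \<in> B \<Longrightarrow> x - y \<in> B" "\<And>x y. x \<in> B \<Longrightarrow> y \<in> B \<Longrightarrow> x * y \<in> B"
      "\<And>x y. x \<in> B \<Longrightarrow> y \<in> B \<Longrightarrow> x * y = 0 \<Longrightarrow> x = 0 \<or> y = 0"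
    and M: "\<And>e a. e \<in> E \<Longrightarrow> a \<in> A \<Longrightarrow> M e a \<in> B"
  shows "\<exists>c. (\<forall>a. c a \<in> B) \<and> (\<exists>a\<in>A. c a \<noteq> 0) \<and> (\<forall>e\<in>E. (\<Sum>a\<in>A. M e a * c a) = 0)"
  using assms(1-3) M
proof (induction E arbitrary: A M rule: finite_induct)
  case empty
  then have "A \<noteq> {}" by auto
  then show ?case using B(2) by (intro exI[of _ "\<lambda>_. 1"]) auto
next
  case (insert e E)
  show ?case
  proof (cases "\<forall>a\<in>A. M e a = 0")
    case True
    have "\<exists>c. (\<forall>a. c a \<in> B) \<and> (\<exists>a\<in>A. c a \<noteq> 0) \<and> (\<forall>e\<in>E. (\<Sum>a\<in>A. M e a * c a) = 0)"
      using insert.prems insert.hyps by (intro insert.IH) auto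
    then show ?thesis using True by auto
  next
    case False
    then obtain a0 where a0: "a0 \<in> A" "M e a0 \<noteq> 0" by auto
    let ?A = "A - {a0}"
    let ?M = "\<lambda>e' a. M e a0 * M e' a - M e' a0 * M e a"
    have add: "x + y \<in> B" if "x \<in> B" "y \<in> B" for x y
      using B(3)[OF that(1) B(3)[OF B(1) that(2)]] by simp
    have sumB: "sum f X \<in> B" if "\<And>x. x \<in> X \<Longrightarrow> f x \<in> B" for f and X :: "'a set"
      using that by (induction X rule: infinite_finite_induct) (auto intro: add B(1))
    have "\<exists>c. (\<forall>a. c a \<in> B) \<and> (\<exists>a\<in>?A. c a \<noteq> 0) \<and> (\<forall>e'\<in>E. (\<Sum>a\<in>?A. ?M e' a * c a) = 0)"
    proof (rule insert.IH)
      show "finite ?A" using insert.prems by simp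
      show "card E < card ?A" using insert.prems insert.hyps a0 by simp
      show "\<And>e' a. e' \<in> E \<Longrightarrow> a \<in> ?A \<Longrightarrow> ?M e' a \<in> B"
        using insert.prems(3) a0 by (intro B(3,4)) auto
    qed
    then obtain c where c: "\<And>a. c a \<in> B" "\<exists>a\<in>?A. c a \<noteq> 0" "\<And>e'. e' \<in> E \<Longrightarrow> (\<Sum>a\<in>?A. ?M e' a * c a) = 0"
      by blast
    let ?s = "\<Sum>a\<in>?A. M e a * c a"
    define d where "d a = (if a = a0 then - ?s else M e a0 * c a)" for a
    have sB: "?s \<in> B" using insert.prems(3) c(1) by (intro sumB B(4)) auto
    have split: "(\<Sum>a\<in>A. M e' a * d a) = M e' a0 * (- ?s) + (\<Sum>a\<in>?A. M e' a * (M e a0 * c a))" for e'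
    proof -
      have "(\<Sum>a\<in>A. M e' a * d a) = M e' a0 * d a0 + (\<Sum>a\<in>?A. M e' a * d a)"
        using insert.prems(1) a0(1) by (rule sum.remove)
      also have "(\<Sum>a\<in>?A. M e' a * d a) = (\<Sum>a\<in>?A. M e' a * (M e a0 * c a))"
        by (rule sum.cong) (auto simp: d_def)
      finally show ?thesis by (simp add: d_def)
    qed
    have "(\<Sum>a\<in>A. M e' a * d a) = 0" if "e' \<in> insert e E" for e'
    proof (cases "e' = e")
      case True
      have "(\<Sum>a\<in>?A. M e a * (M e a0 * c a)) = M e a0 * ?s"
        by (simp add: sum_distrib_left mult_ac)
      then show ?thesis unfolding split True by simp
    next
      case False
      then have "(\<Sum>a\<in>?A. ?M e' a * c a) = 0" using c(3) that by auto
      moreover have "(\<Sum>a\<in>?A. ?M e' a * c a) = (\<Sum>a\<in>?A. M e' a * (M e a0 * c a)) - M e' a0 * ?s"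
        by (simp add: sum_distrib_left algebra_simps sum_subtractf)
      ultimately show ?thesis unfolding split by simp
    qed
    moreover have "\<forall>a. d a \<in> B" using c(1) B(3)[OF B(1) sB] B(4) insert.prems(3) a0(1) by (auto simp: d_def)
    moreover have "\<exists>a\<in>A. d a \<noteq> 0"
    proof -
      obtain a where a: "a \<in> ?A" "c a \<noteq> 0" using c(2) by auto
      then have "M e a0 * c a \<noteq> 0" using B(5)[of "M e a0" "c a"] a0 insert.prems(3) c(1) by auto
      then show ?thesis using a by (intro bexI[of _ a]) (auto simp: d_def)
    qed
    ultimately show ?thesis by blast
  qed
qed

text \<open>A prime ideal of the polynomial ring, spelled out with the type class operations on polynomials.\<close>
locale mpoly_prime =
  fixes V :: "'v set" and P :: "('v, 'k::field) mpoly set"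
  assumes finite_V: "finite V" and P_sub: "P \<subseteq> mpolys V" and P_0: "0 \<in> P"
    and P_add: "p \<in> P \<Longrightarrow> q \<in> P \<Longrightarrow> p + q \<in> P"
    and P_mult: "s \<in> mpolys V \<Longrightarrow> p \<in> P \<Longrightarrow> s * p \<in> P"
    and P_1: "1 \<notin> P"
    and P_prime: "p \<in> mpolys V \<Longrightarrow> q \<in> mpolys V \<Longrightarrow> p * q \<in> P \<Longrightarrow> p \<in> P \<or> q \<in> P"

lemma mpoly_primeI:
  assumes "finite V" "primeideal P (mpoly_ring K V)"
  shows "mpoly_prime V P"
proof -
  interpret P: primeideal P "mpoly_ring K V" by fact
  show ?thesis
    using P.is_ideal[unfolded ideal_mpoly_ring_iff] P.I_prime P.one_imp_carrier P.I_notcarr assms(1)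
    by unfold_locales auto
qed

context mpoly_prime
begin

text \<open>The variables in \<open>U\<close> are algebraically independent modulo \<open>P\<close>, so polynomials in them form a
  domain that embeds in the quotient by \<open>P\<close>. In the next two definitions this domain is the ring of scalars.\<close>
definition indep :: "'v set \<Rightarrow> bool" where
  "indep U \<longleftrightarrow> U \<subseteq> V \<and> mpolys U \<inter> P \<subseteq> {0}"

definition spanned :: "'v set \<Rightarrow> ('v, 'k) mpoly set \<Rightarrow> ('v, 'k) mpoly \<Rightarrow> bool" where
  "spanned U T p \<longleftrightarrow> (\<exists>b. (\<forall>t\<in>T. b t \<in> mpolys U) \<and> p - (\<Sum>t\<in>T. b t * t) \<in> P)"

definition lin_indep :: "'v set \<Rightarrow> ('v, 'k) mpoly set \<Rightarrow> bool" where
  "lin_indep U T \<longleftrightarrow> (\<forall>b. (\<forall>t\<in>T. b t \<in> mpolys U) \<longrightarrow> (\<Sum>t\<in>T. b t * t) \<in> P \<longrightarrow> (\<forall>t\<in>T. b t = 0))"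

lemma lin_indepD:
  "lin_indep U T \<Longrightarrow> (\<And>t. t \<in> T \<Longrightarrow> b t \<in> mpolys U) \<Longrightarrow> (\<Sum>t\<in>T. b t * t) \<in> P \<Longrightarrow> t \<in> T \<Longrightarrow> b t = 0"
  unfolding lin_indep_def by blast

lemma P_uminus: "p \<in> P \<Longrightarrow> - p \<in> P"
  using P_mult[OF mpolys_uminus[OF mpolys_1], of p] by simp

lemma P_diff: "p \<in> P \<Longrightarrow> q \<in> P \<Longrightarrow> p - q \<in> P"
  using P_add[OF _ P_uminus, of p q] by simp

lemma P_power: "p \<in> mpolys V \<Longrightarrow> p ^ n \<in> P \<Longrightarrow> p \<in> P"
  by (induction n) (use P_1 P_prime[OF _ mpolys_power] in auto)

lemma indep_notin:
  fixes p :: "('v, 'k) mpoly"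
  shows "indep U \<Longrightarrow> p \<in> mpolys U \<Longrightarrow> p \<noteq> 0 \<Longrightarrow> p \<notin> P"
  by (auto simp: indep_def)

lemma indep_mpolys:
  fixes p :: "('v, 'k) mpoly"
  shows "indep U \<Longrightarrow> p \<in> mpolys U \<Longrightarrow> p \<in> mpolys V"
  using mpolys_mono[of U V] by (auto simp: indep_def)

lemma indep_mult_nonzero:
  fixes p q :: "('v, 'k) mpoly"
  assumes "indep U" "p \<in> mpolys U" "q \<in> mpolys U" "p \<noteq> 0" "q \<noteq> 0"
  shows "p * q \<noteq> 0"
proof
  assume "p * q = 0"
  then have "p \<in> P \<or> q \<in> P" using P_prime[of p q] P_0 indep_mpolys[OF assms(1)] assms(2,3) by auto
  then show False using indep_notin[OF assms(1)] assms by blast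
qed

lemma indep_prod_nonzero:
  fixes f :: "'i \<Rightarrow> ('v, 'k) mpoly"
  assumes "indep U" "finite A" "\<And>i. i \<in> A \<Longrightarrow> f i \<in> mpolys U \<and> f i \<noteq> 0"
  shows "prod f A \<noteq> 0"
  using assms(2,3)
proof (induction A rule: finite_induct)
  case (insert x A)
  have "f x * prod f A \<noteq> 0"
    using insert by (intro indep_mult_nonzero[OF assms(1)] mpolys_prod) auto
  then show ?case using insert.hyps by simp
qed simp

lemma spanned_P: "p \<in> P \<Longrightarrow> spanned U T p"
  unfolding spanned_def by (intro exI[of _ "\<lambda>_. 0"]) auto

lemma spanned_add: "spanned U T p \<Longrightarrow> spanned U T q \<Longrightarrow> spanned U T (p + q)"
proof -
  assume "spanned U T p" "spanned U T q"
  then obtain b b' where b: "\<forall>t\<in>T. b t \<in> mpolys U" "p - (\<Sum>t\<in>T. b t * t) \<in> P"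
    and b': "\<forall>t\<in>T. b' t \<in> mpolys U" "q - (\<Sum>t\<in>T. b' t * t) \<in> P" unfolding spanned_def by blast
  have "(p + q) - (\<Sum>t\<in>T. (b t + b' t) * t) = (p - (\<Sum>t\<in>T. b t * t)) + (q - (\<Sum>t\<in>T. b' t * t))"
    by (simp add: algebra_simps sum.distrib)
  also have "\<dots> \<in> P" using b b' P_add by blast
  finally show ?thesis unfolding spanned_def using b b' by (intro exI[of _ "\<lambda>t. b t + b' t"]) auto
qed

lemma spanned_scale:
  assumes "indep U" "s \<in> mpolys U" "spanned U T p"
  shows "spanned U T (s * p)"
proof -
  obtain b where b: "\<forall>t\<in>T. b t \<in> mpolys U" "p - (\<Sum>t\<in>T. b t * t) \<in> P"
    using assms(3) unfolding spanned_def by blast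
  have "s * p - (\<Sum>t\<in>T. (s * b t) * t) = s * (p - (\<Sum>t\<in>T. b t * t))"
    by (simp add: algebra_simps sum_distrib_left)
  also have "\<dots> \<in> P" using b indep_mpolys[OF assms(1,2)] P_mult by blast
  finally show ?thesis unfolding spanned_def using b assms(2) by (intro exI[of _ "\<lambda>t. s * b t"]) auto
qed

lemma spanned_sum:
  "(\<And>i. i \<in> A \<Longrightarrow> spanned U T (f i)) \<Longrightarrow> spanned U T (sum f A)"
  by (induction A rule: infinite_finite_induct) (auto intro: spanned_add spanned_P P_0)

lemma spanned_self:
  assumes "finite T" "t \<in> T" shows "spanned U T t"
proof -
  have "(\<Sum>s\<in>T. (if s = t then 1 else 0) * s) = t"
    using assms by (simp add: if_distrib[of "\<lambda>x. x * _"] cong: if_cong)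
  then show ?thesis unfolding spanned_def using P_0 by (intro exI[of _ "\<lambda>s. if s = t then 1 else 0"]) auto
qed

lemma spanned_trans:
  assumes "indep U" "spanned U T p" "q \<in> mpolys V" "\<And>t. t \<in> T \<Longrightarrow> spanned U T' (q * t)"
  shows "spanned U T' (q * p)"
proof -
  obtain b where b: "\<forall>t\<in>T. b t \<in> mpolys U" "p - (\<Sum>t\<in>T. b t * t) \<in> P"
    using assms(2) unfolding spanned_def by blast
  have "q * p = q * (p - (\<Sum>t\<in>T. b t * t)) + (\<Sum>t\<in>T. b t * (q * t))"
    by (simp add: algebra_simps sum_distrib_left)
  also have "spanned U T' \<dots>"
  proof (rule spanned_add)
    show "spanned U T' (q * (p - (\<Sum>t\<in>T. b t * t)))"
      by (rule spanned_P[OF P_mult[OF assms(3) b(2)]])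
    show "spanned U T' (\<Sum>t\<in>T. b t * (q * t))"
      by (rule spanned_sum, rule spanned_scale[OF assms(1)]) (use b(1) assms(4) in auto)
  qed
  finally show ?thesis .
qed

text \<open>A nonzero polynomial in the variables \<open>insert v U\<close> that lies in \<open>P\<close>, read as a univariate polynomial
  in \<open>v\<close>, is an algebraic equation for \<open>v\<close>. Its degree is positive because \<open>U\<close> is independent.\<close>
lemma maximal_indep_algebraic:
  assumes U: "indep U" and v: "v \<in> V" "v \<notin> U" and dep: "\<not> indep (insert v U)"
  obtains c d b where "c \<in> mpolys U" "c \<noteq> 0" "d > 0" "\<And>j. b j \<in> mpolys U"
    "c * poly_var v ^ d - (\<Sum>j<d. b j * poly_var v ^ j) \<in> P"
proof -
  obtain p where p: "p \<in> mpolys (insert v U)" "p \<in> P" "p \<noteq> 0"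
    using dep U v(1) unfolding indep_def by auto
  define F where "F = as_poly v p"
  define d where "d = degree F"
  have Fc: "coeff F i \<in> mpolys U" for i
    using coeff_as_poly_mpolys[OF p(1), of i] v(2) by (simp add: F_def)
  have lc: "coeff F d \<noteq> 0" using p(3) by (simp add: d_def F_def)
  have "p = (\<Sum>j\<le>d. coeff F j * poly_var v ^ j)"
    using poly_as_poly[of v p] by (simp add: poly_altdef F_def d_def)
  also have "\<dots> = coeff F d * poly_var v ^ d + (\<Sum>j<d. coeff F j * poly_var v ^ j)"
    by (simp flip: lessThan_Suc_atMost)
  finally have pe: "p = coeff F d * poly_var v ^ d - (\<Sum>j<d. (- coeff F j) * poly_var v ^ j)"
    by (simp add: sum_negf)
  have "d > 0"
  proof (rule ccontr)
    assume "\<not> d > 0"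
    then have "p = coeff F 0" using pe by simp
    then show False using indep_notin[OF U Fc[of 0]] p by simp
  qed
  then show thesis using that[where c = "coeff F d" and d = d and b = "\<lambda>j. - coeff F j"]
      Fc lc pe p(2) mpolys_uminus[OF Fc] by metis
qed

text \<open>After inverting one polynomial \<open>f\<close> in the variables \<open>U\<close>, the quotient by \<open>P\<close> is spanned by finitely many
  elements. The variables outside \<open>U\<close> are added one at a time: if \<open>v\<close> satisfies an equation of degree \<open>d\<close> with leading
  coefficient \<open>c\<close>, then \<open>T\<close> is replaced by the products of its elements with \<open>1, v, \<dots>, v\<^sup>d\<^sup>-\<^sup>1\<close>, and \<open>f\<close> by \<open>f c\<close>.\<close>
lemma finite_span:
  assumes U: "indep U" and max: "\<forall>v\<in>V - U. \<not> indep (insert v U)"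
  shows "\<exists>T f. finite T \<and> T \<subseteq> mpolys V \<and> 1 \<in> T \<and> f \<in> mpolys U \<and> f \<noteq> 0 \<and>
    (\<forall>t\<in>T. \<forall>v\<in>V. spanned U T (f * (poly_var v * t)))"
proof -
  have "\<exists>T f. finite T \<and> T \<subseteq> mpolys V \<and> 1 \<in> T \<and> f \<in> mpolys U \<and> f \<noteq> 0 \<and>
    (\<forall>t\<in>T. \<forall>v\<in>U \<union> Y. spanned U T (f * (poly_var v * t)))" if "finite Y" "Y \<subseteq> V - U" for Y
    using that
  proof (induction Y rule: finite_induct)
    case empty
    have "spanned U {1} (poly_var v * 1)" if "v \<in> U" for v
      using that by (intro spanned_scale[OF U] spanned_self) auto
    then show ?case by (intro exI[of _ "{1}"] exI[of _ "1"]) auto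
  next
    case (insert v Y)
    then obtain T f where T: "finite T" "T \<subseteq> mpolys V" "1 \<in> T" "f \<in> mpolys U" "f \<noteq> 0"
      and sp: "\<And>t w. t \<in> T \<Longrightarrow> w \<in> U \<union> Y \<Longrightarrow> spanned U T (f * (poly_var w * t))" by blast
    have v: "v \<in> V" "v \<notin> U" "\<not> indep (insert v U)" using insert.prems max by auto
    obtain c d b where c: "c \<in> mpolys U" "c \<noteq> 0" "d > 0" "\<And>j. b j \<in> mpolys U"
      "c * poly_var v ^ d - (\<Sum>j<d. b j * poly_var v ^ j) \<in> P"
      by (rule maximal_indep_algebraic[OF U v]) (rule that)
    let ?T = "(\<lambda>(t, j). t * poly_var v ^ j) ` (T \<times> {..<d})"
    have finT: "finite ?T" using T(1) by auto
    have inT: "spanned U ?T (t * poly_var v ^ j)" if "t \<in> T" "j < d" for t j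
      by (rule spanned_self[OF finT]) (use that in force)
    have "spanned U ?T ((f * c) * (poly_var w * (t * poly_var v ^ j)))" if "t \<in> T" "j < d" "w \<in> U \<union> Y" for w t j
    proof -
      have "spanned U ?T (poly_var v ^ j * (f * (poly_var w * t)))"
        using that inT v(1) by (intro spanned_trans[OF U sp[OF that(1,3)]]) (auto simp: mult.commute)
      then have "spanned U ?T (c * (poly_var v ^ j * (f * (poly_var w * t))))" by (rule spanned_scale[OF U c(1)])
      then show ?thesis by (simp add: mult_ac)
    qed
    moreover have "spanned U ?T ((f * c) * (poly_var v * (t * poly_var v ^ j)))" if "t \<in> T" "j < d" for t j
    proof (cases "Suc j < d")
      case True
      have "spanned U ?T ((f * c) * (t * poly_var v ^ Suc j))"
        by (rule spanned_scale[OF U]) (use T(4) c(1) inT[OF that(1) True] in auto)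
      then show ?thesis by (simp add: mult_ac)
    next
      case False
      then have d: "d = Suc j" using that by simp
      have tV: "t \<in> mpolys V" using T(2) that by auto
      have "(f * c) * (poly_var v * (t * poly_var v ^ j)) =
        (f * t) * (c * poly_var v ^ d - (\<Sum>j<d. b j * poly_var v ^ j)) + (\<Sum>j<d. (f * b j) * (t * poly_var v ^ j))"
        unfolding d by (simp add: algebra_simps sum_distrib_left)
      also have "spanned U ?T \<dots>"
      proof (rule spanned_add)
        show "spanned U ?T ((f * t) * (c * poly_var v ^ d - (\<Sum>j<d. b j * poly_var v ^ j)))"
          using c(5) tV indep_mpolys[OF U T(4)] by (intro spanned_P P_mult mpolys_mult)
        show "spanned U ?T (\<Sum>j<d. (f * b j) * (t * poly_var v ^ j))"
          by (rule spanned_sum, rule spanned_scale[OF U]) (use inT[OF that(1)] c(4) T(4) in auto)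
      qed
      finally show ?thesis .
    qed
    ultimately have "\<forall>t\<in>?T. \<forall>w\<in>U \<union> insert v Y. spanned U ?T ((f * c) * (poly_var w * t))" by auto
    moreover have "?T \<subseteq> mpolys V" using T(2) v(1) by auto
    moreover have "1 \<in> ?T" using T(3) c(3) by force
    moreover have "f * c \<noteq> 0" by (rule indep_mult_nonzero[OF U T(4) c(1) T(5) c(2)])
    ultimately show ?case using finT T(4) c(1) by (intro exI[of _ ?T] exI[of _ "f * c"]) auto
  qed
  from this[of "V - U"] show ?thesis using U finite_V by (simp add: indep_def Un_absorb1)
qed

text \<open>A maximal linearly independent subset \<open>B\<close> of the spanning set, chosen to contain \<open>1\<close>, spans the rest after
  multiplication with nonzero scalars. Since multiplication by each variable costs one fixed denominator, a
  power of that denominator is enough for any polynomial.\<close>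
lemma finite_basis:
  assumes U: "indep U" and max: "\<forall>v\<in>V - U. \<not> indep (insert v U)"
  obtains B f where "finite B" "B \<subseteq> mpolys V" "1 \<in> B" "lin_indep U B" "f \<in> mpolys U" "f \<noteq> 0"
    "\<forall>p\<in>mpolys V. \<exists>M. spanned U B (f ^ M * p)"
proof -
  obtain T f where T: "finite T" "T \<subseteq> mpolys V" "1 \<in> T" "f \<in> mpolys U" "f \<noteq> 0"
    and sp: "\<And>t v. t \<in> T \<Longrightarrow> v \<in> V \<Longrightarrow> spanned U T (f * (poly_var v * t))"
    using finite_span[OF assms] by blast
  let ?F = "{B. 1 \<in> B \<and> B \<subseteq> T \<and> lin_indep U B}"
  have "lin_indep U {1}" unfolding lin_indep_def using indep_notin[OF U] by auto
  then have "?F \<noteq> {}" using T(3) by auto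
  moreover have "finite ?F" using T(1) by (rule finite_subset[rotated, OF finite_Pow_iff[THEN iffD2]]) auto
  ultimately obtain B where BF: "B \<in> ?F" and Bmax: "\<forall>B'\<in>?F. B \<subseteq> B' \<longrightarrow> B = B'"
    using finite_has_maximal[of ?F] by auto
  have B: "1 \<in> B" "B \<subseteq> T" "lin_indep U B" using BF by auto
  have finB: "finite B" using B T(1) finite_subset by auto
  have "\<exists>c. c \<in> mpolys U \<and> c \<noteq> 0 \<and> spanned U B (c * t)" if t: "t \<in> T" for t
  proof (cases "t \<in> B")
    case True
    then show ?thesis using spanned_self[OF finB True] by (intro exI[of _ 1]) auto
  next
    case False
    then have "\<not> lin_indep U (insert t B)" using Bmax B t by auto
    then obtain b where b: "\<forall>s\<in>insert t B. b s \<in> mpolys U" "(\<Sum>s\<in>insert t B. b s * s) \<in> P" "\<exists>s\<in>insert t B. b s \<noteq> 0"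
      unfolding lin_indep_def by blast
    have eq: "(\<Sum>s\<in>insert t B. b s * s) = b t * t - (\<Sum>s\<in>B. (- b s) * s)"
      using False finB by (simp add: sum_negf)
    have "b t \<noteq> 0"
    proof
      assume 0: "b t = 0"
      then have "(\<Sum>s\<in>B. b s * s) \<in> P" using b(2) False finB by simp
      then have "\<forall>s\<in>B. b s = 0" using B(3) b(1) unfolding lin_indep_def by auto
      then show False using 0 b(3) by auto
    qed
    moreover have "spanned U B (b t * t)"
      unfolding spanned_def using b(1,2) eq by (intro exI[of _ "\<lambda>s. - b s"]) auto
    ultimately show ?thesis using b(1) by auto
  qed
  then obtain c where c: "\<And>t. t \<in> T \<Longrightarrow> c t \<in> mpolys U \<and> c t \<noteq> 0 \<and> spanned U B (c t * t)" by metis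
  define g where "g = prod c T"
  have g: "g \<in> mpolys U" "g \<noteq> 0"
    unfolding g_def using c indep_prod_nonzero[OF U T(1), of c] by auto
  have gt: "spanned U B (g * t)" if "t \<in> T" for t
  proof -
    have "g * t = prod c (T - {t}) * (c t * t)"
      unfolding g_def using that T(1) by (simp add: prod.remove[of T t] mult_ac)
    also have "spanned U B \<dots>" by (rule spanned_scale[OF U]) (use c that in auto)
    finally show ?thesis .
  qed
  have fg: "f * g \<in> mpolys U" "f * g \<noteq> 0"
    using T(4,5) g indep_mult_nonzero[OF U] by auto
  have step: "spanned U B ((f * g) * (poly_var v * t))" if "t \<in> B" "v \<in> V" for t v
  proof -
    have "spanned U B (g * (f * (poly_var v * t)))"
    proof (rule spanned_trans[OF U])
      show "spanned U T (f * (poly_var v * t))" using that B(2) sp by blast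
      show "g \<in> mpolys V" by (rule indep_mpolys[OF U g(1)])
    qed (rule gt)
    then show ?thesis by (simp add: mult_ac)
  qed
  have "\<exists>M. spanned U B ((f * g) ^ M * p)" if "p \<in> mpolys V" for p
    using finite_V that
  proof (induction p rule: mpolys_induct)
    case (const c)
    have "spanned U B (const_poly c * 1)" using spanned_self[OF finB B(1)] by (intro spanned_scale[OF U]) auto
    then show ?case by (intro exI[of _ 0]) simp
  next
    case (var p v)
    then obtain M where M: "spanned U B ((f * g) ^ M * p)" by blast
    have "spanned U B (((f * g) * poly_var v) * ((f * g) ^ M * p))"
    proof (rule spanned_trans[OF U M])
      show "f * g * poly_var v \<in> mpolys V" using var(2) indep_mpolys[OF U fg(1)] by auto
      show "spanned U B (f * g * poly_var v * t)" if "t \<in> B" for t using step[OF that var(2)] by (simp add: mult_ac)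
    qed
    then show ?case by (intro exI[of _ "Suc M"]) (simp add: mult_ac)
  next
    case (add p q)
    then obtain M N where MN: "spanned U B ((f * g) ^ M * p)" "spanned U B ((f * g) ^ N * q)" by (elim exE)
    have "(f * g) ^ (M + N) * (p + q) = (f * g) ^ N * ((f * g) ^ M * p) + (f * g) ^ M * ((f * g) ^ N * q)"
      by (simp add: power_add algebra_simps)
    also have "spanned U B \<dots>"
      by (rule spanned_add; rule spanned_scale[OF U]) (use MN fg(1) in auto)
    finally show ?case by blast
  qed
  then show thesis using that[OF finB _ B(1,3) fg] B(2) T(2) by auto
qed

text \<open>In the quotient by \<open>P\<close>, every nonzero \<open>a\<close> divides a nonzero polynomial in the variables \<open>U\<close>. Indeed, if
  \<open>B\<close> is a basis as above, the elements \<open>a t\<close> for \<open>t \<in> B\<close> together with \<open>1\<close> are too many to be independent, whereas the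
  \<open>a t\<close> alone are independent because \<open>P\<close> is prime. So the coefficient of \<open>1\<close> in a relation is not zero.\<close>
lemma maximal_indep_meets:
  assumes U: "indep U" and max: "\<forall>v\<in>V - U. \<not> indep (insert v U)"
    and a: "a \<in> mpolys V" "a \<notin> P"
  obtains c s where "c \<in> mpolys U" "c \<noteq> 0" "s \<in> mpolys V" "c - s * a \<in> P"
proof -
  obtain B f where B: "finite B" "B \<subseteq> mpolys V" "1 \<in> B" "lin_indep U B" "f \<in> mpolys U" "f \<noteq> 0"
    and sp: "\<forall>p\<in>mpolys V. \<exists>M. spanned U B (f ^ M * p)"
    by (rule finite_basis[OF U max]) (rule that)
  have fP: "f \<notin> P" "f \<in> mpolys V" using indep_notin[OF U B(5,6)] indep_mpolys[OF U B(5)] by auto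
  have "\<exists>M. spanned U B (f ^ M * (a * t))" if "t \<in> B" for t using bspec[OF sp, of "a * t"] a(1) B(2) that by blast
  then obtain N where N: "\<And>t. t \<in> B \<Longrightarrow> spanned U B (f ^ N t * (a * t))" by metis
  define M where "M = sum N B"
  have "spanned U B (f ^ M * (a * t))" if "t \<in> B" for t
  proof -
    have "f ^ M * (a * t) = f ^ (M - N t) * (f ^ N t * (a * t))"
      using member_le_sum[OF that, of N] B(1) by (simp add: M_def flip: mult.assoc power_add)
    then show ?thesis using N[OF that] B(5) spanned_scale[OF U, of "f ^ (M - N t)"] by auto
  qed
  then have "\<forall>t\<in>B. \<exists>b. (\<forall>s\<in>B. b s \<in> mpolys U) \<and> f ^ M * (a * t) - (\<Sum>s\<in>B. b s * s) \<in> P"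
    unfolding spanned_def by blast
  from bchoice[OF this] obtain b where
    b': "\<forall>t\<in>B. (\<forall>s\<in>B. b t s \<in> mpolys U) \<and> f ^ M * (a * t) - (\<Sum>s\<in>B. b t s * s) \<in> P" ..
  have b: "\<And>s t. s \<in> B \<Longrightarrow> t \<in> B \<Longrightarrow> b t s \<in> mpolys U"
    "\<And>t. t \<in> B \<Longrightarrow> f ^ M * (a * t) - (\<Sum>s\<in>B. b t s * s) \<in> P" using b' by blast+
  \<comment> \<open>The unknowns are the coefficients of the elements \<open>a t\<close> (index \<open>Some t\<close>) and of \<open>1\<close> (index \<open>None\<close>).\<close>
  define A where "A = insert None (Some ` B)"
  define E where "E s x = (case x of None \<Rightarrow> if s = 1 then 1 else 0 | Some t \<Rightarrow> b t s)" for s x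
  have "\<exists>c. (\<forall>x. c x \<in> mpolys U) \<and> (\<exists>x\<in>A. c x \<noteq> 0) \<and> (\<forall>s\<in>B. (\<Sum>x\<in>A. E s x * c x) = 0)"
  proof (rule homogeneous_system_solution)
    show "card B < card A" using B(1) by (simp add: A_def card_image)
    show "x = 0 \<or> y = 0" if "x \<in> mpolys U" "y \<in> mpolys U" "x * y = 0" for x y :: "('v, 'k) mpoly"
      using indep_mult_nonzero[OF U that(1,2)] that(3) by blast
  qed (use B(1) b(1) in \<open>auto simp: A_def E_def\<close>)
  then obtain c where c: "\<And>x. c x \<in> mpolys U" "\<exists>x\<in>A. c x \<noteq> 0" "\<And>s. s \<in> B \<Longrightarrow> (\<Sum>x\<in>A. E s x * c x) = 0"
    by blast
  let ?c = "\<lambda>t. c (Some t)"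
  have eqs: "(\<Sum>t\<in>B. b t s * ?c t) = - (if s = 1 then c None else 0)" if "s \<in> B" for s
  proof -
    have "(\<Sum>x\<in>A. E s x * c x) = E s None * c None + (\<Sum>t\<in>B. b t s * ?c t)"
      using B(1) by (simp add: A_def E_def sum.reindex)
    then show ?thesis using c(3)[OF that] by (simp add: E_def add_eq_0_iff split: if_splits)
  qed
  let ?s = "\<Sum>t\<in>B. ?c t * t"
  have sV: "?s \<in> mpolys V" using B(2) indep_mpolys[OF U c(1)] by (intro mpolys_sum mpolys_mult) auto
  have "f ^ M * a * ?s + c None = (\<Sum>t\<in>B. ?c t * (f ^ M * (a * t) - (\<Sum>s\<in>B. b t s * s)))
      + ((\<Sum>s\<in>B. (\<Sum>t\<in>B. b t s * ?c t) * s) + c None)"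
  proof -
    have "(\<Sum>s\<in>B. (\<Sum>t\<in>B. b t s * ?c t) * s) = (\<Sum>s\<in>B. \<Sum>t\<in>B. ?c t * (b t s * s))"
      by (simp add: sum_distrib_left sum_distrib_right mult_ac)
    also have "\<dots> = (\<Sum>t\<in>B. \<Sum>s\<in>B. ?c t * (b t s * s))" by (rule sum.swap)
    also have "\<dots> = (\<Sum>t\<in>B. ?c t * (\<Sum>s\<in>B. b t s * s))" by (simp add: sum_distrib_left)
    finally show ?thesis by (simp add: right_diff_distrib sum_subtractf sum_distrib_left mult_ac)
  qed
  moreover have "(\<Sum>s\<in>B. (\<Sum>t\<in>B. b t s * ?c t) * s) = - c None"
  proof -
    have "(\<Sum>s\<in>B. (\<Sum>t\<in>B. b t s * ?c t) * s) = (\<Sum>s\<in>B. if s = 1 then - c None else 0)"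
      by (rule sum.cong) (auto simp: eqs)
    then show ?thesis using B(1,3) by simp
  qed
  moreover have "(\<Sum>t\<in>B. ?c t * (f ^ M * (a * t) - (\<Sum>s\<in>B. b t s * s))) \<in> P"
  proof -
    have "sum g X \<in> P" if "\<And>t. t \<in> X \<Longrightarrow> g t \<in> P" for g and X :: "('v, 'k) mpoly set"
      using that by (induction X rule: infinite_finite_induct) (auto intro: P_add P_0)
    then show ?thesis using b(2) c(1) indep_mpolys[OF U] P_mult by auto
  qed
  ultimately have rel: "f ^ M * a * ?s + c None \<in> P" by simp
  have "c None \<noteq> 0"
  proof
    assume 0: "c None = 0"
    then have "f ^ M * a * ?s \<in> P" using rel by simp
    then have "f ^ M \<in> P \<or> a \<in> P \<or> ?s \<in> P"
      using P_prime[of "f ^ M * a" ?s] P_prime[of "f ^ M" a] fP(2) a(1) sV by auto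
    then have "?s \<in> P" using P_power[OF fP(2)] fP(1) a(2) by auto
    then have "\<forall>t\<in>B. ?c t = 0" using lin_indepD[OF B(4), of ?c] c(1) by blast
    then show False using c(2) 0 by (auto simp: A_def)
  qed
  moreover have "c None - (- (f ^ M * ?s)) * a \<in> P" using rel by (simp add: algebra_simps)
  moreover have "- (f ^ M * ?s) \<in> mpolys V" using sV fP(2) by auto
  ultimately show thesis using that c(1) by blast
qed

end

text \<open>The quotient by \<open>P\<close> is a field here. Suppose that \<open>u\<close> belongs to a maximal independent set \<open>W\<close> of variables, and
  put \<open>g = 1 + u f\<close> with the denominator \<open>f\<close> of \<open>finite_basis\<close>. Expanding \<open>f\<^sup>M g\<^sup>-\<^sup>1\<close> in the basis \<open>B\<close> and
  multiplying by \<open>g\<close> gives \<open>f\<^sup>M = g b\<close> for the coefficient \<open>b\<close> of the basis element \<open>1\<close>. But \<open>f\<close> is a unit modulo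
  \<open>g\<close>, so \<open>g\<close> would be a unit in the polynomial ring, although its degree in \<open>u\<close> is positive.\<close>
lemma (in mpoly_prime) maximal_no_indep:
  assumes maxi: "\<And>p. p \<in> mpolys V \<Longrightarrow> p \<notin> P \<Longrightarrow> \<exists>q\<in>mpolys V. p * q - 1 \<in> P"
    and U: "indep U"
  shows "U = {}"
proof -
  let ?F = "{W. indep W \<and> U \<subseteq> W}"
  have "finite ?F" using finite_V by (rule finite_subset[rotated, OF finite_Pow_iff[THEN iffD2]]) (auto simp: indep_def)
  then obtain W where "W \<in> ?F" and Wmax: "\<forall>W'\<in>?F. W \<subseteq> W' \<longrightarrow> W = W'"
    using finite_has_maximal[of ?F] U by auto
  then have W: "indep W" "U \<subseteq> W" by auto
  have max: "\<forall>v\<in>V - W. \<not> indep (insert v W)" using Wmax W by blast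
  obtain B f where B: "finite B" "B \<subseteq> mpolys V" "1 \<in> B" "lin_indep W B" "f \<in> mpolys W" "f \<noteq> 0"
    and sp: "\<forall>p\<in>mpolys V. \<exists>M. spanned W B (f ^ M * p)"
    by (rule finite_basis[OF W(1) max]) (rule that)
  have "W = {}"
  proof (rule ccontr)
    assume "W \<noteq> {}"
    then obtain u where u: "u \<in> W" by auto
    define g where "g = 1 + poly_var u * f"
    have g: "g \<in> mpolys W" unfolding g_def using u B(5) by auto
    have deg: "degree (as_poly u g) > 0"
    proof -
      have "as_poly u g = 1 + pCons 0 (as_poly u f)" by (simp add: g_def as_poly_add as_poly_mult as_poly_var)
      then show ?thesis using B(6) by (simp add: one_pCons)
    qed
    then have g0: "g \<noteq> 0" by auto
    obtain q where q: "q \<in> mpolys V" "g * q - 1 \<in> P"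
      using maxi[OF indep_mpolys[OF W(1) g] indep_notin[OF W(1) g g0]] by blast
    obtain M b where b: "\<forall>t\<in>B. b t \<in> mpolys W" "f ^ M * q - (\<Sum>t\<in>B. b t * t) \<in> P"
      using bspec[OF sp q(1)] unfolding spanned_def by blast
    have "f ^ M - (\<Sum>t\<in>B. (g * b t) * t) = g * (f ^ M * q - (\<Sum>t\<in>B. b t * t)) - f ^ M * (g * q - 1)"
      by (simp add: algebra_simps sum_distrib_left)
    also have "\<dots> \<in> P"
      by (rule P_diff[OF P_mult[OF indep_mpolys[OF W(1) g] b(2)]
            P_mult[OF indep_mpolys[OF W(1) mpolys_power[OF B(5)]] q(2)]])
    also have "f ^ M - (\<Sum>t\<in>B. (g * b t) * t) = (\<Sum>t\<in>B. ((if t = 1 then f ^ M else 0) - g * b t) * t)"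
      using B(1,3) by (simp add: left_diff_distrib sum_subtractf if_distrib[of "\<lambda>x. x * _"] cong: if_cong)
    finally have "(if (1 :: ('v, 'k) mpoly) = 1 then f ^ M else 0) - g * b 1 = 0"
      by (intro lin_indepD[OF B(4) _ _ B(3)]) (use b(1) g B(5) in auto)
    then have "f ^ M = g * b 1" by simp
    then have "\<exists>h\<in>mpolys W. f ^ M = g * h" using b(1) B(3) by auto
    then have "\<exists>h\<in>mpolys W. 1 = g * h"
    proof (induction M)
      case (Suc M)
      then obtain h where h: "h \<in> mpolys W" "f ^ Suc M = g * h" by auto
      \<comment> \<open>As \<open>u f = g - 1\<close>, a factor \<open>f\<close> is removed at the cost of a multiple of \<open>g\<close>.\<close>
      have "f ^ M = g * f ^ M - poly_var u * f ^ Suc M" by (simp add: g_def algebra_simps)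
      also have "\<dots> = g * (f ^ M - poly_var u * h)" unfolding h(2) by (simp add: algebra_simps)
      finally have "f ^ M = g * (f ^ M - poly_var u * h)" .
      then show ?case using Suc.IH h(1) u B(5) by blast
    qed simp
    then obtain h where h: "h \<in> mpolys W" "1 = g * h" by blast
    have h0: "h \<noteq> 0" using h(2) by auto
    have "coeff (as_poly u g * as_poly u h) (degree (as_poly u g) + degree (as_poly u h)) \<noteq> 0"
    proof -
      have c: "coeff (as_poly u p) i \<in> mpolys W" if "p \<in> mpolys W" for p :: "('v, 'k) mpoly" and i
        using coeff_as_poly_mpolys[of p u W i] that u mpolys_mono[of "W - {u}" W] by (auto simp: insert_absorb)
      show ?thesis unfolding coeff_mult_degree_sum
        using g0 h0 c g h(1) by (intro indep_mult_nonzero[OF W(1)]) auto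
    qed
    moreover have "as_poly u g * as_poly u h = 1" using h(2) by (simp flip: as_poly_mult)
    ultimately show False using deg by simp
  qed
  then show ?thesis using W by auto
qed

definition eval_at :: "'k::field poly \<Rightarrow> ('v, 'k) mpoly \<Rightarrow> ('v, 'k) mpoly" where
  "eval_at f t = poly (map_poly const_poly f) t"

text \<open>Zariski's lemma: modulo a maximal ideal no variable is transcendental over the coefficient field.\<close>
theorem variable_algebraic_mod_maximal:
  fixes M :: "('v, 'k::field) mpoly set"
  assumes V: "finite V" and M: "maximalideal M (mpoly_ring K V)" and v: "v \<in> V"
  shows "\<exists>f. f \<noteq> 0 \<and> eval_at f (poly_var v) \<in> M"
proof -
  let ?S = "mpoly_ring K V"
  interpret S: cring ?S by (rule cring_mpoly_ring)
  interpret M: maximalideal M ?S by fact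
  interpret mpoly_prime V M by (rule mpoly_primeI[OF V S.maximalideal_prime[OF M]])
  have inv: "\<exists>q\<in>mpolys V. p * q - 1 \<in> M" if p: "p \<in> mpolys V" "p \<notin> M" for p
  proof -
    let ?J = "Idl\<^bsub>?S\<^esub> (M \<union> {p})"
    have sub: "M \<union> {p} \<subseteq> carrier ?S" using P_sub p by auto
    have J: "ideal ?J ?S" by (rule S.genideal_ideal[OF sub])
    have "M \<subseteq> ?J" "p \<in> ?J" using S.genideal_self[OF sub] by auto
    then have "?J = carrier ?S"
      using M.I_maximal[OF J] p(2) J unfolding ideal_mpoly_ring_iff by auto
    then have "1 \<in> {j \<oplus>\<^bsub>?S\<^esub> s \<otimes>\<^bsub>?S\<^esub> p |j s. j \<in> M \<and> s \<in> carrier ?S}"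
      using S.Idl_Un_singleton[OF M.is_ideal, of p] p(1) by auto
    then obtain j s where "1 = j + s * p" "j \<in> M" "s \<in> mpolys V" by auto
    then have "p * s - 1 = - j" by (simp add: algebra_simps)
    then show ?thesis using P_uminus[of j] \<open>j \<in> M\<close> \<open>s \<in> mpolys V\<close> by (intro bexI[of _ s]) simp_all
  qed
  have "\<not> indep {v}" using maximal_no_indep[OF inv, of "{v}"] by auto
  then obtain p where p: "p \<in> mpolys {v}" "p \<in> M" "p \<noteq> 0" using v by (auto simp: indep_def)
  define F where "F = as_poly v p"
  have "coeff F i \<in> mpolys {}" for i
    using coeff_as_poly_mpolys[of p v "{}" i] p(1) by (simp add: F_def)
  then have c: "coeff F i = const_poly (lookup (coeff F i) 0)" for i
    by (metis mpolys_empty const_poly_def lookup_single_eq)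
  define f where "f = map_poly (\<lambda>c. lookup c 0) F"
  have "map_poly const_poly f = F"
    using c by (intro poly_eqI) (simp add: f_def coeff_map_poly)
  then have "eval_at f (poly_var v) = p" by (simp add: eval_at_def F_def poly_as_poly)
  moreover have "f \<noteq> 0" using \<open>map_poly const_poly f = F\<close> p(3) by (auto simp: F_def)
  ultimately show ?thesis using p(2) by auto
qed

text \<open>Let \<open>U\<close> be independent modulo \<open>Q\<close>, hence also modulo the smaller prime \<open>P\<close>. If no variable could be
  added modulo \<open>P\<close>, an element \<open>a \<in> Q - P\<close> would divide a nonzero polynomial \<open>c\<close> in the variables \<open>U\<close> modulo \<open>P\<close>, and
  \<open>c\<close> would lie in \<open>Q\<close>.\<close>
lemma indep_card_drops:
  fixes P Q :: "('v, 'k::field) mpoly set"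
  assumes P: "mpoly_prime V P" and Q: "mpoly_prime V Q" and PQ: "P \<subset> Q"
    and U: "mpoly_prime.indep V Q U"
  shows "\<exists>W. mpoly_prime.indep V P W \<and> card W = Suc (card U)"
proof -
  interpret P: mpoly_prime V P by fact
  interpret Q: mpoly_prime V Q by fact
  have UP: "P.indep U" using U PQ by (auto simp: P.indep_def Q.indep_def)
  have "\<exists>v. v \<in> V \<and> v \<notin> U \<and> P.indep (insert v U)"
  proof (rule ccontr)
    assume "\<not> ?thesis"
    then have max: "\<forall>v\<in>V - U. \<not> P.indep (insert v U)" by auto
    obtain a where a: "a \<in> Q" "a \<notin> P" using PQ by auto
    then have aV: "a \<in> mpolys V" using Q.P_sub by auto
    obtain c s where c: "c \<in> mpolys U" "c \<noteq> 0" "s \<in> mpolys V" "c - s * a \<in> P"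
      by (rule P.maximal_indep_meets[OF UP max aV a(2)]) (rule that)
    then have "(c - s * a) + s * a \<in> Q" using PQ a(1) Q.P_mult Q.P_add by blast
    then show False using Q.indep_notin[OF U c(1,2)] by simp
  qed
  moreover have "finite U" using U Q.finite_V finite_subset by (auto simp: Q.indep_def)
  ultimately show ?thesis by (metis card_insert_disjoint)
qed

lemma prime_chain_indep:
  fixes C :: "nat \<Rightarrow> ('v, 'k::field) mpoly set"
  assumes V: "finite V" and "\<forall>i\<le>k. primeideal (C i) (mpoly_ring K V)" "\<forall>i<k. C i \<subset> C (Suc i)"
  shows "\<exists>U. mpoly_prime.indep V (C 0) U \<and> card U = k"
  using assms(2,3)
proof (induction k arbitrary: C)
  case 0
  interpret mpoly_prime V "C 0" using mpoly_primeI[OF V] 0 by auto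
  have "c = 0" if "const_poly c \<in> C 0" for c
  proof (rule ccontr)
    assume "c \<noteq> 0"
    then have "const_poly (inverse c) * const_poly c = (1 :: ('v, 'k) mpoly)" by (simp add: const_poly_mult)
    then show False using P_mult[OF mpolys_const_poly that, of "inverse c"] P_1 by simp
  qed
  have "p = 0" if "p \<in> mpolys {}" "p \<in> C 0" for p using that mpolys_empty[of p] const_poly_0 \<open>\<And>c. const_poly c \<in> C 0 \<Longrightarrow> c = 0\<close> by metis
  then have "indep {}" unfolding indep_def by blast
  then show ?case by (intro exI[of _ "{}"]) simp
next
  case (Suc k)
  have "\<exists>U. mpoly_prime.indep V (C (Suc 0)) U \<and> card U = k"
    using Suc.prems by (intro Suc.IH[of "\<lambda>i. C (Suc i)"]) auto
  then obtain U where U: "mpoly_prime.indep V (C (Suc 0)) U" "card U = k" by blast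
  have "mpoly_prime V (C 0)" "mpoly_prime V (C (Suc 0))" "C 0 \<subset> C (Suc 0)"
    using mpoly_primeI[OF V] Suc.prems(1)[rule_format, of 0] Suc.prems(1)[rule_format, of "Suc 0"]
      Suc.prems(2)[rule_format, of 0] by blast+
  from indep_card_drops[OF this U(1)] show ?case using U(2) by auto
qed

text \<open>The chain yields \<open>k\<close> variables that are independent modulo its smallest prime, and such variables lie outside
  that prime.\<close>
theorem prime_chain_length:
  fixes C :: "nat \<Rightarrow> ('v, 'k::field) mpoly set"
  assumes V: "finite V" and C: "\<forall>i\<le>k. primeideal (C i) (mpoly_ring K V)" "\<forall>i<k. C i \<subset> C (Suc i)"
  shows "k \<le> card {v \<in> V. poly_var v \<notin> C 0}"
proof -
  obtain U where U: "mpoly_prime.indep V (C 0) U" "card U = k" using prime_chain_indep[OF V C] by blast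
  interpret mpoly_prime V "C 0" using mpoly_primeI[OF V] C by auto
  have "poly_var v \<noteq> (0 :: ('v, 'k) mpoly)" for v
    using as_poly_var[of v] by (metis as_poly_0 pCons_eq_0_iff one_neq_zero)
  then have "poly_var v \<notin> C 0" if "v \<in> U" for v using indep_notin[OF U(1), of "poly_var v"] that by auto
  then have "U \<subseteq> {v \<in> V. poly_var v \<notin> C 0}" using U(1) by (auto simp: indep_def)
  then show ?thesis using card_mono[of "{v \<in> V. poly_var v \<notin> C 0}" U] V U(2) by simp
qed

section \<open>Monomial ideals and regular sequences\<close>

lemma keys_add_nat: "keys (a + b) = keys a \<union> keys (b :: 'v \<Rightarrow>\<^sub>0 nat)"
  by (auto simp: in_keys_iff lookup_add)

text \<open>The Stanley--Reisner ideal of the complex whose nonfaces are the supersets of members of \<open>E\<close>, given by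
  its monomials. For the edges of a graph this is the edge ideal. In this description, adding a variable and taking
  the colon ideal by a variable are operations on \<open>E\<close>.\<close>
definition nonface_ideal :: "'v set \<Rightarrow> 'v set set \<Rightarrow> ('v, 'k::field) mpoly set" where
  "nonface_ideal V E = {p \<in> mpolys V. \<forall>m\<in>keys p. \<exists>e\<in>E. e \<subseteq> keys m}"

lemma ideal_nonface_ideal:
  fixes K :: "'k::field itself" and V :: "'v set"
  shows "ideal (nonface_ideal V E) (mpoly_ring K V)"
  unfolding ideal_mpoly_ring_iff
proof (intro conjI ballI)
  fix p :: "('v, 'k) mpoly" assume p: "p \<in> nonface_ideal V E"
  show "p + q \<in> nonface_ideal V E" if "q \<in> nonface_ideal V E" for q
    using p that keys_add[of p q] by (fastforce simp: nonface_ideal_def)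
  fix s :: "('v, 'k) mpoly" assume s: "s \<in> mpolys V"
  have "\<exists>e\<in>E. e \<subseteq> keys m" if m: "m \<in> keys (s * p)" for m
  proof -
    obtain a b where ab: "b \<in> keys p" "m = a + b" using m keys_mult[of s p] by blast
    then obtain e where "e \<in> E" "e \<subseteq> keys b" using p by (auto simp: nonface_ideal_def)
    then show ?thesis using ab by (auto simp: keys_add_nat)
  qed
  then show "s * p \<in> nonface_ideal V E" using s p by (auto simp: nonface_ideal_def)
qed (auto simp: nonface_ideal_def)

lemma ideal_monomialsI:
  fixes p :: "('v, 'k::field) mpoly"
  assumes J: "ideal J (mpoly_ring K V)"
    and "\<And>m. m \<in> keys p \<Longrightarrow> single m (lookup p m) \<in> J"
  shows "p \<in> J"
proof -
  have "sum f A \<in> J" if "\<And>i. i \<in> A \<Longrightarrow> f i \<in> J" for f and A :: "('v \<Rightarrow>\<^sub>0 nat) set"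
    using that by (induction A rule: infinite_finite_induct) (use J in \<open>auto simp: ideal_mpoly_ring_iff\<close>)
  then show ?thesis using mpoly_sum_monomials[of p] assms(2) by metis
qed

lemma prod_poly_var:
  "finite e \<Longrightarrow> (\<Prod>v\<in>e. poly_var v) = (single (\<Sum>v\<in>e. single v 1) 1 :: ('v, 'k::field) mpoly)"
  by (induction e rule: finite_induct) (simp_all add: poly_var_def mult_single)

lemma monomial_factor:
  assumes e: "e \<subseteq> keys m"
  obtains m' where "keys m' \<subseteq> keys m"
    "\<And>c :: 'k::field. single m c = single m' c * (\<Prod>v\<in>e. poly_var v)"
proof -
  have fin: "finite e" using e by (rule finite_subset) simp
  define s :: "'a \<Rightarrow>\<^sub>0 nat" where "s = (\<Sum>v\<in>e. single v 1)"
  have s: "lookup s v = (if v \<in> e then 1 else 0)" for v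
    using fin by (simp add: s_def lookup_sum lookup_single when_def)
  have m: "m = (m - s) + s"
    using e by (intro poly_mapping_eqI) (auto simp: lookup_add lookup_minus s in_keys_iff subset_iff)
  show thesis
  proof
    show "keys (m - s) \<subseteq> keys m" by (auto simp: in_keys_iff lookup_minus)
    have "(\<Prod>v\<in>e. poly_var v) = (single s 1 :: ('a, 'k) mpoly)"
      unfolding s_def by (rule prod_poly_var[OF fin])
    then show "single m c = single (m - s) c * (\<Prod>v\<in>e. poly_var v)" for c :: 'k
      using m by (simp add: mult_single)
  qed
qed

lemma prod_poly_var_nonface:
  assumes "e \<in> E" "e \<subseteq> V" "finite e"
  shows "(\<Prod>v\<in>e. poly_var v) \<in> nonface_ideal V E"
proof -
  have "keys (\<Sum>v\<in>e. single v (1 :: nat)) = e"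
    using assms(3) by (auto simp: in_keys_iff lookup_sum lookup_single when_def split: if_splits)
  then show ?thesis using assms unfolding nonface_ideal_def by (auto simp: prod_poly_var[OF assms(3)] mpolys_single)
qed

lemma nonface_ideal_generated:
  assumes E: "\<And>e. e \<in> E \<Longrightarrow> e \<subseteq> V" and V: "finite V"
  shows "nonface_ideal V E = Idl\<^bsub>mpoly_ring K V\<^esub> ((\<lambda>e. \<Prod>v\<in>e. poly_var v) ` E)"
proof -
  let ?S = "mpoly_ring K V"
  interpret S: cring ?S by (rule cring_mpoly_ring)
  let ?G = "(\<lambda>e. \<Prod>v\<in>e. poly_var v) ` E"
  have fin: "finite e" if "e \<in> E" for e using E[OF that] V finite_subset by auto
  have G: "?G \<subseteq> carrier ?S" using E by auto
  have J: "ideal (Idl\<^bsub>?S\<^esub> ?G) ?S" by (rule S.genideal_ideal[OF G])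
  show ?thesis
  proof (rule antisym)
    show "Idl\<^bsub>?S\<^esub> ?G \<subseteq> nonface_ideal V E"
      using prod_poly_var_nonface[OF _ E fin] by (intro S.genideal_minimal ideal_nonface_ideal) auto
    show "nonface_ideal V E \<subseteq> Idl\<^bsub>?S\<^esub> ?G"
    proof (rule subsetI, rule ideal_monomialsI[OF J])
      fix p :: "('a, 'b) mpoly" and m
      assume p: "p \<in> nonface_ideal V E" and m: "m \<in> keys p"
      then obtain e where e: "e \<in> E" "e \<subseteq> keys m" "keys m \<subseteq> V"
        by (auto simp: nonface_ideal_def mpolys_def)
      obtain m' where m': "keys m' \<subseteq> keys m"
        "\<And>c :: 'b. single m c = single m' c * (\<Prod>v\<in>e. poly_var v)"
        by (rule monomial_factor[OF e(2)]) (rule that)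
      have "(\<Prod>v\<in>e. poly_var v) \<in> Idl\<^bsub>?S\<^esub> ?G" using S.genideal_self[OF G] e(1) by auto
      moreover have "single m' (lookup p m) \<in> mpolys V"
        using m'(1) e(3) by (intro mpolys_single) auto
      ultimately show "single m (lookup p m) \<in> Idl\<^bsub>?S\<^esub> ?G"
        unfolding m'(2) using J by (auto simp: ideal_mpoly_ring_iff)
    qed
  qed
qed

lemma nonface_ideal_mono:
  "(\<And>e. e \<in> E \<Longrightarrow> \<exists>e'\<in>E'. e' \<subseteq> e) \<Longrightarrow> nonface_ideal V E \<subseteq> nonface_ideal V E'"
  unfolding nonface_ideal_def by (auto, meson order_trans)

text \<open>Only the minimal members of \<open>E\<close> matter.\<close>
lemma nonface_ideal_eqI:
  assumes "\<And>e. e \<in> E \<Longrightarrow> \<exists>e'\<in>E'. e' \<subseteq> e" "\<And>e. e \<in> E' \<Longrightarrow> \<exists>e'\<in>E. e' \<subseteq> e"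
  shows "nonface_ideal V E = nonface_ideal V E'"
  using nonface_ideal_mono[of E E' V] nonface_ideal_mono[of E' E V] assms by blast

lemma keys_var_mult:
  fixes p :: "('v, 'k::field) mpoly"
  shows "keys (poly_var v * p) = (\<lambda>m. single v 1 + m) ` keys p"
proof
  show "keys (poly_var v * p) \<subseteq> (\<lambda>m. single v 1 + m) ` keys p"
    using keys_mult[of "poly_var v" p] by (auto simp: poly_var_def)
  have "lookup (poly_var v * p) (single v 1 + m) = lookup p m" for m
  proof -
    have "poly_var v * p = (\<Sum>n\<in>keys p. single (single v 1 + n) (lookup p n))"
      by (subst mpoly_sum_monomials[of p]) (simp add: sum_distrib_left poly_var_def mult_single)
    then show ?thesis by (auto simp: lookup_sum lookup_single when_def in_keys_iff)
  qed
  then show "(\<lambda>m. single v 1 + m) ` keys p \<subseteq> keys (poly_var v * p)"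
    by (auto simp: in_keys_iff)
qed

lemma nonface_ideal_colon:
  assumes "v \<in> V"
  shows "{p \<in> mpolys V. poly_var v * p \<in> nonface_ideal V E} = nonface_ideal V ((\<lambda>e. e - {v}) ` E)"
proof -
  have "e \<subseteq> keys (single v 1 + m) \<longleftrightarrow> e - {v} \<subseteq> keys m" for e :: "'a set" and m :: "'a \<Rightarrow>\<^sub>0 nat"
    by (auto simp: keys_add_nat)
  then show ?thesis using assms by (auto simp: nonface_ideal_def keys_var_mult)
qed

lemma nonface_ideal_insert:
  fixes V :: "'v set" and K :: "'k::field itself"
  assumes "v \<in> V"
  shows "Idl\<^bsub>mpoly_ring K V\<^esub> (nonface_ideal V E \<union> {poly_var v}) = nonface_ideal V (insert {v} E)"
proof -
  let ?S = "mpoly_ring K V"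
  interpret S: cring ?S by (rule cring_mpoly_ring)
  let ?J = "Idl\<^bsub>?S\<^esub> (nonface_ideal V E \<union> {poly_var v})"
  have sub: "nonface_ideal V E \<union> {poly_var v} \<subseteq> carrier ?S"
    using assms by (auto simp: nonface_ideal_def)
  have J: "ideal ?J ?S" by (rule S.genideal_ideal[OF sub])
  have self: "nonface_ideal V E \<subseteq> ?J" "poly_var v \<in> ?J" using S.genideal_self[OF sub] by auto
  show ?thesis
  proof (rule antisym)
    have "(poly_var v :: ('v, 'k) mpoly) \<in> nonface_ideal V (insert {v} E)"
      using prod_poly_var_nonface[of "{v}" "insert {v} E" V] assms by simp
    then show "?J \<subseteq> nonface_ideal V (insert {v} E)"
      using nonface_ideal_mono[of E "insert {v} E" V] by (intro S.genideal_minimal ideal_nonface_ideal) auto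
    show "nonface_ideal V (insert {v} E) \<subseteq> ?J"
    proof (rule subsetI, rule ideal_monomialsI[OF J])
      fix p :: "('v, 'k) mpoly" and m
      assume p: "p \<in> nonface_ideal V (insert {v} E)" and m: "m \<in> keys p"
      then have mV: "keys m \<subseteq> V" by (auto simp: nonface_ideal_def mpolys_def)
      obtain e where "e = {v} \<or> e \<in> E" "e \<subseteq> keys m"
        using p m by (auto simp: nonface_ideal_def)
      then show "single m (lookup p m) \<in> ?J"
      proof (elim disjE)
        assume "e = {v}" "e \<subseteq> keys m"
        then have "{v} \<subseteq> keys m" by simp
        then obtain m' where m': "keys m' \<subseteq> keys m"
          "\<And>c :: 'k. single m c = single m' c * (\<Prod>v\<in>{v}. poly_var v)"
          by (rule monomial_factor) (rule that)
        have "single m' (lookup p m) \<in> mpolys V"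
          using m'(1) mV by (intro mpolys_single) auto
        then show ?thesis using J self(2) by (simp add: m'(2) ideal_mpoly_ring_iff)
      next
        assume "e \<in> E" "e \<subseteq> keys m"
        then have "single m (lookup p m) \<in> nonface_ideal V E"
          using mV unfolding nonface_ideal_def by (auto intro: mpolys_single)
        then show ?thesis using self(1) by blast
      qed
    qed
  qed
qed

lemma eval_at_0 [simp]: "eval_at 0 t = 0"
  by (simp add: eval_at_def)

lemma eval_at_pCons: "eval_at (pCons a f) t = const_poly a + t * eval_at f t"
  by (simp add: eval_at_def map_poly_pCons)

lemma eval_at_mpolys: "t \<in> mpolys V \<Longrightarrow> eval_at f t \<in> mpolys V"
  by (induction f) (auto simp: eval_at_pCons)

lemma eval_at_cong_mod:
  assumes J: "ideal J (mpoly_ring K V)" and xy: "x \<in> mpolys V" "y \<in> mpolys V" "x - y \<in> J"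
  shows "eval_at f x - eval_at f y \<in> J"
proof (induction f)
  case 0
  then show ?case using J by (simp add: ideal_mpoly_ring_iff)
next
  case (pCons a f)
  have "eval_at (pCons a f) x - eval_at (pCons a f) y =
      x * (eval_at f x - eval_at f y) + eval_at f y * (x - y)"
    by (simp add: eval_at_pCons algebra_simps)
  then show ?case using J pCons xy eval_at_mpolys[OF xy(2), of f] by (simp add: ideal_mpoly_ring_iff)
qed

lemma as_poly_eval_at: "as_poly z (eval_at f (poly_var z)) = map_poly const_poly f"
  by (induction f) (simp_all add: eval_at_pCons as_poly_add as_poly_mult as_poly_var map_poly_pCons)

lemma const_poly_eq_0_iff [simp]: "const_poly c = 0 \<longleftrightarrow> c = 0"
  unfolding const_poly_def by (metis lookup_single_eq lookup_zero single_zero)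

text \<open>The polynomials whose coefficients with respect to \<open>z\<close> all lie in the ideal form an ideal themselves, and it
  contains the generators because they are free of \<open>z\<close>.\<close>
lemma coeff_as_poly_in_ideal:
  fixes G :: "('v, 'k::field) mpoly set"
  assumes G: "G \<subseteq> mpolys (V - {z})" and z: "z \<in> V" and q: "q \<in> Idl\<^bsub>mpoly_ring K V\<^esub> G"
  shows "coeff (as_poly z q) j \<in> Idl\<^bsub>mpoly_ring K V\<^esub> G"
proof -
  let ?S = "mpoly_ring K V"
  interpret S: cring ?S by (rule cring_mpoly_ring)
  let ?J = "Idl\<^bsub>?S\<^esub> G"
  have G': "G \<subseteq> carrier ?S" using G mpolys_mono[of "V - {z}" V] by auto
  have J: "ideal ?J ?S" by (rule S.genideal_ideal[OF G'])
  then have J': "0 \<in> ?J" "\<And>p q. p \<in> ?J \<Longrightarrow> q \<in> ?J \<Longrightarrow> p + q \<in> ?J" "\<And>s p. p \<in> ?J \<Longrightarrow> s \<in> mpolys V \<Longrightarrow> s * p \<in> ?J"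
    unfolding ideal_mpoly_ring_iff by blast+
  have sumJ: "sum f A \<in> ?J" if "\<And>i. i \<in> A \<Longrightarrow> f i \<in> ?J" for f and A :: "nat set"
    using that by (induction A rule: infinite_finite_induct) (auto intro: J')
  have co: "coeff (as_poly z s) i \<in> mpolys V" if "s \<in> mpolys V" for s :: "('v, 'k) mpoly" and i
    using coeff_as_poly_mpolys[of s z V i] that z mpolys_mono[of "V - {z}" V] by (auto simp: insert_absorb)
  let ?X = "{q \<in> mpolys V. \<forall>j. coeff (as_poly z q) j \<in> ?J}"
  have "ideal ?X ?S"
    unfolding ideal_mpoly_ring_iff
  proof (intro conjI ballI)
    fix p s :: "('v, 'k) mpoly" assume "p \<in> ?X" "s \<in> mpolys V"
    then show "s * p \<in> ?X" using co by (auto simp: as_poly_mult coeff_mult intro!: sumJ J'(3))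
  qed (auto simp: as_poly_add intro: J')
  moreover have "G \<subseteq> ?X"
  proof
    fix g assume g: "g \<in> G"
    then have "as_poly z g = [:g:]" using G by (intro as_poly_free[of _ "V - {z}"]) auto
    then show "g \<in> ?X" using g G' S.genideal_self[OF G'] J'(1) by (auto simp: coeff_pCons split: nat.splits)
  qed
  ultimately have "?J \<subseteq> ?X" by (rule S.genideal_minimal)
  then show ?thesis using q by auto
qed

text \<open>If \<open>f(z) p\<close> lies in the ideal, so does its leading coefficient with respect to \<open>z\<close>, and therefore the one of
  \<open>p\<close>, because the leading coefficient of \<open>f\<close> is a unit. Removing the leading term of \<open>p\<close> lowers the degree.\<close>
lemma eval_at_var_nonzerodivisor:
  fixes G :: "('v, 'k::field) mpoly set"
  assumes G: "G \<subseteq> mpolys (V - {z})" and z: "z \<in> V" and f: "f \<noteq> 0"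
    and p: "p \<in> mpolys V" "eval_at f (poly_var z) * p \<in> Idl\<^bsub>mpoly_ring K V\<^esub> G"
  shows "p \<in> Idl\<^bsub>mpoly_ring K V\<^esub> G"
proof -
  let ?S = "mpoly_ring K V"
  interpret S: cring ?S by (rule cring_mpoly_ring)
  let ?J = "Idl\<^bsub>?S\<^esub> G"
  let ?f = "eval_at f (poly_var z) :: ('v, 'k) mpoly"
  have G': "G \<subseteq> carrier ?S" using G mpolys_mono[of "V - {z}" V] by auto
  have J: "ideal ?J ?S" by (rule S.genideal_ideal[OF G'])
  then have J': "?J \<subseteq> mpolys V" "0 \<in> ?J" "\<And>p q. p \<in> ?J \<Longrightarrow> q \<in> ?J \<Longrightarrow> p + q \<in> ?J" "\<And>s p. p \<in> ?J \<Longrightarrow> s \<in> mpolys V \<Longrightarrow> s * p \<in> ?J"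
    unfolding ideal_mpoly_ring_iff by blast+
  have "p \<in> ?J" if "as_poly z p = 0 \<or> degree (as_poly z p) < n" "p \<in> mpolys V" "?f * p \<in> ?J" for n p
    using that
  proof (induction n arbitrary: p)
    case 0
    then show ?case using J' by simp
  next
    case (Suc n)
    define P where "P = as_poly z p"
    define l where "l = lead_coeff P"
    define r where "r = l * poly_var z ^ degree P"
    have lf: "lead_coeff (map_poly const_poly f) = (const_poly (lead_coeff f) :: ('v, 'k) mpoly)"
      by (simp add: coeff_map_poly degree_map_poly)
    have "lead_coeff (map_poly const_poly f) * l \<in> ?J"
      using coeff_as_poly_in_ideal[OF G z Suc.prems(3), of "degree (map_poly const_poly f :: ('v, 'k) mpoly poly) + degree P"]
      unfolding as_poly_mult as_poly_eval_at P_def[symmetric] coeff_mult_degree_sum l_def .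
    then have "const_poly (inverse (lead_coeff f)) * (const_poly (lead_coeff f) * l) \<in> ?J" unfolding lf using J'(4) by blast
    then have l: "l \<in> ?J" using f by (simp add: const_poly_mult flip: mult.assoc)
    then have r: "r \<in> ?J" unfolding r_def using J'(4)[OF l mpolys_power[OF mpolys_var[OF z]]] by (simp add: mult.commute)
    have lz: "l \<in> mpolys (V - {z})"
      using coeff_as_poly_mpolys[of p z V] Suc.prems(2) z by (simp add: l_def P_def insert_absorb)
    have ar: "as_poly z r = Polynomial.monom l (degree P)"
      using as_poly_free[OF lz, of z] by (simp add: r_def as_poly_mult as_poly_power as_poly_var monom_altdef)
    have "p - r \<in> ?J"
    proof (rule Suc.IH)
      show "p - r \<in> mpolys V" using Suc.prems(2) r J'(1) by auto
      have "?f * p - ?f * r \<in> ?J" using Suc.prems(3) J'(4)[OF r eval_at_mpolys[OF mpolys_var[OF z]]]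
        by (rule ideal_mpoly_ring_diff[OF J])
      then show "?f * (p - r) \<in> ?J" by (simp add: right_diff_distrib)
      have d: "as_poly z (p - r) = P - Polynomial.monom l (degree P)" by (simp add: as_poly_diff ar P_def)
      have "degree (as_poly z (p - r)) \<le> degree P" unfolding d by (intro degree_diff_le) (auto simp: degree_monom_le)
      moreover have "coeff (as_poly z (p - r)) (degree P) = 0" unfolding d by (simp add: l_def)
      ultimately have "as_poly z (p - r) = 0 \<or> degree (as_poly z (p - r)) < degree P"
        by (metis leading_coeff_0_iff order_le_less)
      then show "as_poly z (p - r) = 0 \<or> degree (as_poly z (p - r)) < n"
        using Suc.prems(1) by (auto simp: P_def)
    qed
    then have "(p - r) + r \<in> ?J" using r J'(3) by blast
    then show ?case by simp
  qed
  then show ?thesis using p by blast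
qed

section \<open>Graphs of ordered pairs\<close>

text \<open>Each \<open>a \<in> N\<close> has a partner \<open>c a\<close> outside \<open>N\<close>. For the zero-divisor graph, \<open>c\<close> is complementation and
  \<open>orth\<close> is disjointness.\<close>
locale paired_order =
  fixes N :: "'v set" and c :: "'v \<Rightarrow> 'v" and le orth :: "'v \<Rightarrow> 'v \<Rightarrow> bool"
  assumes finite_N: "finite N" and inj_c: "inj_on c N" and c_notin: "a \<in> N \<Longrightarrow> c a \<notin> N"
    and le_refl: "a \<in> N \<Longrightarrow> le a a"
    and le_trans: "a \<in> N \<Longrightarrow> b \<in> N \<Longrightarrow> d \<in> N \<Longrightarrow> le a b \<Longrightarrow> le b d \<Longrightarrow> le a d"
    and le_antisym: "a \<in> N \<Longrightarrow> b \<in> N \<Longrightarrow> le a b \<Longrightarrow> le b a \<Longrightarrow> a = b"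
    and orth_sym: "a \<in> N \<Longrightarrow> b \<in> N \<Longrightarrow> orth a b \<Longrightarrow> orth b a"
    and orth_irrefl: "a \<in> N \<Longrightarrow> \<not> orth a a"
    and orth_down: "a \<in> N \<Longrightarrow> b \<in> N \<Longrightarrow> d \<in> N \<Longrightarrow> orth a b \<Longrightarrow> le d a \<Longrightarrow> orth d b"
begin

definition edges :: "'v set \<Rightarrow> 'v set set" where
  "edges U = {{a, c b} | a b. a \<in> U \<and> b \<in> U \<and> le a b} \<union> {{a, b} | a b. a \<in> U \<and> b \<in> U \<and> orth a b}"

text \<open>The stage of the induction in which the pairs in \<open>X\<close> and \<open>Y\<close> are decided: the variable \<open>a\<close> is a generator for
  \<open>a \<in> X\<close>, the variable \<open>c a\<close> for \<open>a \<in> Y\<close>, and only the edges between undecided pairs remain.\<close>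
definition nonfaces :: "'v set \<Rightarrow> 'v set \<Rightarrow> 'v set set" where
  "nonfaces X Y = (\<lambda>a. {a}) ` X \<union> (\<lambda>a. {c a}) ` Y \<union> edges (N - X - Y)"

abbreviation "V \<equiv> N \<union> c ` N"

lemma edges_cases:
  assumes "e \<in> edges U"
  obtains (le) a b where "e = {a, c b}" "a \<in> U" "b \<in> U" "le a b"
  | (orth) a b where "e = {a, b}" "a \<in> U" "b \<in> U" "orth a b"
  using assms unfolding edges_def by blast

lemma edges_le: "a \<in> U \<Longrightarrow> b \<in> U \<Longrightarrow> le a b \<Longrightarrow> {a, c b} \<in> edges U"
  and edges_orth: "a \<in> U \<Longrightarrow> b \<in> U \<Longrightarrow> orth a b \<Longrightarrow> {a, b} \<in> edges U"
  unfolding edges_def by blast+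

text \<open>By minimality of \<open>i\<close>, the only edges at \<open>c i\<close> join it to \<open>i\<close>, so once \<open>i\<close> is a generator, \<open>c i\<close> is free.\<close>
lemma nonfaces_insert_minimal:
  assumes X: "X \<subseteq> N" and Y: "Y \<subseteq> N" and i: "i \<in> N - X - Y"
    and min: "\<And>j. j \<in> N - X - Y \<Longrightarrow> le j i \<Longrightarrow> j = i"
  shows "nonface_ideal V (insert {i} (nonfaces X Y)) = nonface_ideal V (nonfaces (insert i X) Y)"
proof (rule nonface_ideal_eqI)
  let ?U = "N - X - Y" and ?U' = "N - insert i X - Y"
  fix e assume e: "e \<in> insert {i} (nonfaces X Y)"
  show "\<exists>e'\<in>nonfaces (insert i X) Y. e' \<subseteq> e"
  proof (cases "i \<in> e")
    case True
    then show ?thesis by (intro bexI[of _ "{i}"]) (auto simp: nonfaces_def)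
  next
    case False
    then consider "e \<in> (\<lambda>a. {a}) ` X \<union> (\<lambda>a. {c a}) ` Y" | "e \<in> edges ?U" using e by (auto simp: nonfaces_def)
    then show ?thesis
    proof cases
      case 1
      then show ?thesis by (intro bexI[of _ e]) (auto simp: nonfaces_def)
    next
      case 2
      then have "e \<in> edges ?U'"
      proof (cases rule: edges_cases)
        case (le a b)
        then have "a \<noteq> i" "b \<noteq> i" using False min by auto
        then show ?thesis using le by (auto intro: edges_le)
      next
        case (orth a b)
        then have "a \<noteq> i" "b \<noteq> i" using False by auto
        then show ?thesis using orth by (auto intro: edges_orth)
      qed
      then show ?thesis by (intro bexI[of _ e]) (auto simp: nonfaces_def)
    qed
  qed
next
  fix e assume e: "e \<in> nonfaces (insert i X) Y"
  have "edges (N - insert i X - Y) \<subseteq> edges (N - X - Y)" unfolding edges_def by blast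
  then have "e \<in> insert {i} (nonfaces X Y)" using e by (auto simp: nonfaces_def)
  then show "\<exists>e'\<in>insert {i} (nonfaces X Y). e' \<subseteq> e" by blast
qed

text \<open>The colon ideal by the variable \<open>i\<close> acquires the neighbours of \<open>i\<close> as generators. These are \<open>j\<close> for \<open>orth i j\<close>
  and \<open>c j\<close> for \<open>le i j\<close>. Their partners, and \<open>i\<close> itself, become free: an edge at such a
  vertex leads to another new generator, by transitivity of \<open>le\<close> and since \<open>orth\<close> is inherited downwards.\<close>
lemma nonfaces_colon:
  assumes X: "X \<subseteq> N" and Y: "Y \<subseteq> N" and i: "i \<in> N - X - Y"
  shows "nonface_ideal V ((\<lambda>e. e - {i}) ` nonfaces X Y) =
    nonface_ideal V (nonfaces (X \<union> {j \<in> N - X - Y. orth i j}) (Y \<union> {j \<in> N - X - Y. le i j}))"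
    (is "_ = nonface_ideal V (nonfaces ?X ?Y)")
proof (rule nonface_ideal_eqI)
  let ?U = "N - X - Y" and ?U' = "N - ?X - ?Y"
  have iN: "i \<in> N" using i by auto
  fix e' assume "e' \<in> (\<lambda>e. e - {i}) ` nonfaces X Y"
  then obtain e where e: "e \<in> nonfaces X Y" "e' = e - {i}" by auto
  \<comment> \<open>A set that contains one of the generating variables needs no further argument.\<close>
  have single: "\<exists>x\<in>nonfaces ?X ?Y. x \<subseteq> e'" if "(a \<in> ?X \<and> a \<in> e') \<or> (a \<in> ?Y \<and> c a \<in> e')" for a
  proof -
    have "a \<in> ?X \<longrightarrow> {a} \<in> nonfaces ?X ?Y" "a \<in> ?Y \<longrightarrow> {c a} \<in> nonfaces ?X ?Y" by (simp_all add: nonfaces_def)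
    then show ?thesis using that by (meson empty_subsetI insert_subset)
  qed
  from e(1) consider a where "a \<in> X" "e = {a}" | a where "a \<in> Y" "e = {c a}" | "e \<in> edges ?U"
    by (auto simp: nonfaces_def)
  then show "\<exists>x\<in>nonfaces ?X ?Y. x \<subseteq> e'"
  proof cases
    case (1 a)
    then show ?thesis using i e(2) by (intro single[of a]) auto
  next
    case (2 a)
    then show ?thesis using i e(2) c_notin[of a] Y by (intro single[of a]) auto
  next
    case 3
    then show ?thesis
    proof (cases rule: edges_cases)
      case (le a b)
      have ab: "a \<in> N" "b \<in> N" "c b \<noteq> i" using le c_notin[of b] iN by auto
      show ?thesis
      proof (cases "le i b")
        case True
        then show ?thesis using le ab e(2) by (intro single[of b]) auto
      next
        case F1: False
        then have "\<not> le i a" using le_trans[OF iN ab(1,2)] le(4) by blast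
        moreover have "a \<noteq> i" using F1 le(4) by auto
        moreover have "a \<in> ?U' \<Longrightarrow> b \<in> ?U' \<Longrightarrow> {a, c b} \<in> nonfaces ?X ?Y"
          using le(4) unfolding nonfaces_def by (blast intro: edges_le)
        moreover have "orth i a" if "orth i b"
          using orth_sym[OF ab(1) iN orth_down[OF ab(2) iN ab(1) orth_sym[OF iN ab(2) that] le(4)]] .
        ultimately show ?thesis using le ab e(2) F1 single[of a] by (cases "orth i a") auto
      qed
    next
      case (orth a b)
      have ab: "a \<in> N" "b \<in> N" using orth by auto
      have ba: "orth b a" using orth_sym[OF ab orth(4)] .
      show ?thesis
      proof (cases "orth i a \<or> orth i b")
        case True
        then show ?thesis using orth ab e(2) orth_irrefl[OF iN] single[of a] single[of b] by auto
      next
        case F1: False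
        then have "a \<noteq> i" "b \<noteq> i" using orth(4) ba by auto
        moreover have "\<not> le i a" "\<not> le i b" using F1 orth_down[OF ab(1,2) iN orth(4)] orth_down[OF ab(2,1) iN ba] by auto
        moreover have "a \<in> ?U' \<Longrightarrow> b \<in> ?U' \<Longrightarrow> {a, b} \<in> nonfaces ?X ?Y"
          using orth(4) unfolding nonfaces_def by (blast intro: edges_orth)
        ultimately show ?thesis using orth ab e(2) F1 by (intro bexI[of _ e]) auto
      qed
    qed
  qed
next
  let ?U = "N - X - Y"
  fix e assume e: "e \<in> nonfaces ?X ?Y"
  have iN: "i \<in> N" using i by auto
  have sub: "edges (N - ?X - ?Y) \<subseteq> edges ?U" unfolding edges_def by blast
  have "\<exists>x\<in>nonfaces X Y. x - {i} \<subseteq> e"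
  proof (cases "e \<in> nonfaces X Y")
    case False
    then consider a where "a \<in> ?U" "orth i a" "e = {a}" | a where "a \<in> ?U" "le i a" "e = {c a}"
      using e sub by (auto simp: nonfaces_def)
    then show ?thesis
    proof cases
      case (1 a)
      then have "{i, a} \<in> nonfaces X Y" using edges_orth[OF i 1(1,2)] by (simp add: nonfaces_def)
      then show ?thesis using 1 by (intro bexI[of _ "{i, a}"]) auto
    next
      case (2 a)
      then have "{i, c a} \<in> nonfaces X Y" using edges_le[OF i 2(1,2)] by (simp add: nonfaces_def)
      then show ?thesis using 2 by (intro bexI[of _ "{i, c a}"]) auto
    qed
  qed blast
  then show "\<exists>x\<in>(\<lambda>e. e - {i}) ` nonfaces X Y. x \<subseteq> e" by blast
qed

lemma nonfaces_subset: "X \<subseteq> N \<Longrightarrow> Y \<subseteq> N \<Longrightarrow> e \<in> nonfaces X Y \<Longrightarrow> e \<subseteq> V"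
  unfolding nonfaces_def edges_def by blast

definition parameters :: "('v \<Rightarrow> 'k::field poly) \<Rightarrow> 'v list \<Rightarrow> ('v, 'k) mpoly list" where
  "parameters F ns = map (\<lambda>a. eval_at (F a) (poly_var a + poly_var (c a))) ns"

text \<open>When all pairs are decided, the ideal is generated by the variables \<open>wf a\<close>, one for each pair, and the
  elements of the sequence may be replaced by \<open>h a\<close>, which involves only the remaining variable \<open>zf a\<close> of the pair.\<close>
lemma weakly_regular_facet:
  fixes K :: "'k::field itself"
  assumes XY: "X \<union> Y = N" "X \<inter> Y = {}" and F: "\<And>a. a \<in> N \<Longrightarrow> F a \<noteq> 0"
    and ns: "distinct ns" "set ns \<subseteq> N"
  shows "weakly_regular (mpoly_ring K V) (nonface_ideal V (nonfaces X Y)) (parameters F ns)"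
proof -
  let ?S = "mpoly_ring K V"
  interpret S: cring ?S by (rule cring_mpoly_ring)
  let ?I = "nonface_ideal V (nonfaces X Y) :: ('v, 'k) mpoly set"
  define zf where "zf a = (if a \<in> X then c a else a)" for a
  define wf where "wf a = (if a \<in> X then a else c a)" for a
  define g :: "'v \<Rightarrow> ('v, 'k) mpoly" where "g a = eval_at (F a) (poly_var a + poly_var (c a))" for a
  define h :: "'v \<Rightarrow> ('v, 'k) mpoly" where "h a = eval_at (F a) (poly_var (zf a))" for a
  have finV: "finite V" using finite_N by simp
  have I: "ideal ?I ?S" by (rule ideal_nonface_ideal)
  have inV: "zf a \<in> V" "wf a \<in> V" if "a \<in> N" for a using that by (auto simp: zf_def wf_def)
  have nf: "nonfaces X Y = (\<lambda>a. {wf a}) ` N"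
  proof -
    have empty: "N - X - Y = {}" "edges {} = {}" using XY by (auto simp: edges_def)
    have X: "(\<lambda>a. {a}) ` X = (\<lambda>a. {wf a}) ` X" by (rule image_cong) (auto simp: wf_def)
    have Y: "(\<lambda>a. {c a}) ` Y = (\<lambda>a. {wf a}) ` Y"
      using XY(2) by (intro image_cong) (auto simp: wf_def)
    have "nonfaces X Y = (\<lambda>a. {wf a}) ` X \<union> (\<lambda>a. {wf a}) ` Y"
      unfolding nonfaces_def empty X Y by (rule Un_empty_right)
    then show ?thesis using XY(1) by auto
  qed
  have Igen: "?I = Idl\<^bsub>?S\<^esub> ((\<lambda>a. poly_var (wf a)) ` N)"
    using nonface_ideal_generated[of "nonfaces X Y" V K] nonfaces_subset[of X Y] XY finV
    by (auto simp: nf image_image)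
  have wI: "poly_var (wf a) \<in> ?I" if "a \<in> N" for a
    using prod_poly_var_nonface[of "{wf a}" "nonfaces X Y" V] inV[OF that] that nf by auto
  have gV: "g a \<in> mpolys V" "h a \<in> mpolys V" if "a \<in> N" for a
    unfolding g_def h_def using that inV by (auto intro!: eval_at_mpolys)
  have gh: "g a - h a \<in> ?I" if a: "a \<in> N" for a
    unfolding g_def h_def
  proof (rule eval_at_cong_mod[OF I])
    have "poly_var a + poly_var (c a) - poly_var (zf a) = (poly_var (wf a) :: ('v, 'k) mpoly)"
      by (simp add: zf_def wf_def)
    then show "poly_var a + poly_var (c a) - poly_var (zf a) \<in> ?I" using wI[OF a] by simp
  qed (use a inV in auto)
  have parameters: "parameters F ns = map g ns" by (simp add: parameters_def g_def)
  have ns': "set (parameters F ns) \<subseteq> carrier ?S" using ns(2) gV(1) by (auto simp: parameters)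
  show ?thesis unfolding S.weakly_regular_nth[OF I ns']
  proof (intro allI impI ballI)
    fix k p assume k: "k < length (parameters F ns)" and p: "p \<in> carrier ?S"
      and gp: "parameters F ns ! k \<otimes>\<^bsub>?S\<^esub> p \<in> Idl\<^bsub>?S\<^esub> (?I \<union> set (take k (parameters F ns)))"
    let ?a = "ns ! k" and ?T = "set (take k ns)"
    let ?G = "(\<lambda>a. poly_var (wf a)) ` N \<union> h ` ?T"
    have k': "k < length ns" using k by (simp add: parameters)
    then have a: "?a \<in> N" using ns(2) by auto
    have T: "?T \<subseteq> N" "?a \<notin> ?T"
      using ns set_take_subset[of k ns] k' by (auto simp: in_set_conv_nth nth_eq_iff_index_eq)
    have take: "set (take k (parameters F ns)) = g ` ?T" by (simp add: parameters take_map)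
    have subI: "?I \<subseteq> mpolys V" by (auto simp: nonface_ideal_def)
    have G: "?G \<subseteq> carrier ?S" using T gV(2) inV by auto
    have J: "ideal (Idl\<^bsub>?S\<^esub> ?G) ?S" by (rule S.genideal_ideal[OF G])
    have IG: "?I \<subseteq> Idl\<^bsub>?S\<^esub> ?G" unfolding Igen
      using S.genideal_self[OF G] by (intro S.genideal_minimal J) auto
    have Jadd: "q \<in> Idl\<^bsub>?S\<^esub> ?G" if "r - q \<in> ?I" "r \<in> Idl\<^bsub>?S\<^esub> ?G" for q r
      using ideal_mpoly_ring_diff[OF J that(2), of "r - q"] IG that(1) by auto
    have eq: "Idl\<^bsub>?S\<^esub> (?I \<union> g ` ?T) = Idl\<^bsub>?S\<^esub> ?G"
    proof (rule antisym)
      have "g a \<in> Idl\<^bsub>?S\<^esub> ?G" if "a \<in> ?T" for a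
      proof (rule Jadd)
        show "h a \<in> Idl\<^bsub>?S\<^esub> ?G" using S.genideal_self[OF G] that by auto
        have "- (g a - h a) \<in> ?I" using ideal_mpoly_ring_diff[OF I, of 0 "g a - h a"] gh that T I
          by (auto simp: ideal_mpoly_ring_iff)
        then show "h a - g a \<in> ?I" by simp
      qed
      then show "Idl\<^bsub>?S\<^esub> (?I \<union> g ` ?T) \<subseteq> Idl\<^bsub>?S\<^esub> ?G" using IG by (intro S.genideal_minimal J) auto
      have G2: "?I \<union> g ` ?T \<subseteq> carrier ?S" using subI T gV(1) by auto
      have J2: "ideal (Idl\<^bsub>?S\<^esub> (?I \<union> g ` ?T)) ?S" by (rule S.genideal_ideal[OF G2])
      have self: "?I \<subseteq> Idl\<^bsub>?S\<^esub> (?I \<union> g ` ?T)" "g ` ?T \<subseteq> Idl\<^bsub>?S\<^esub> (?I \<union> g ` ?T)" using S.genideal_self[OF G2] by auto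
      have "h a \<in> Idl\<^bsub>?S\<^esub> (?I \<union> g ` ?T)" if "a \<in> ?T" for a
      proof -
        have "g a \<in> Idl\<^bsub>?S\<^esub> (?I \<union> g ` ?T)" "g a - h a \<in> Idl\<^bsub>?S\<^esub> (?I \<union> g ` ?T)"
          using self gh that T by blast+
        from ideal_mpoly_ring_diff[OF J2 this] show ?thesis by simp
      qed
      then show "Idl\<^bsub>?S\<^esub> ?G \<subseteq> Idl\<^bsub>?S\<^esub> (?I \<union> g ` ?T)"
        using self(1) wI by (intro S.genideal_minimal J2) auto
    qed
    have "h ?a * p \<in> Idl\<^bsub>?S\<^esub> ?G"
    proof (rule Jadd)
      show "g ?a * p \<in> Idl\<^bsub>?S\<^esub> ?G" using gp k' unfolding take eq by (simp add: parameters)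
      have "p * (g ?a - h ?a) \<in> ?I" using gh[OF a] p I by (simp add: ideal_mpoly_ring_iff)
      then show "g ?a * p - h ?a * p \<in> ?I" by (simp add: algebra_simps)
    qed
    moreover have "?G \<subseteq> mpolys (V - {zf ?a})"
    proof -
      have "wf b \<noteq> zf ?a" if "b \<in> N" for b
        using c_notin[OF that] c_notin[OF a] inj_onD[OF inj_c _ that a] that a
        by (auto simp: wf_def zf_def split: if_splits)
      moreover have "zf b \<noteq> zf ?a" if "b \<in> ?T" for b
      proof -
        have b: "b \<in> N" "b \<noteq> ?a" using that T by auto
        then show ?thesis using c_notin[OF b(1)] c_notin[OF a] inj_onD[OF inj_c _ b(1) a] a
          by (auto simp: zf_def split: if_splits)
      qed
      ultimately show ?thesis using inV T by (auto simp: h_def intro!: eval_at_mpolys)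
    qed
    ultimately have "p \<in> Idl\<^bsub>?S\<^esub> ?G"
      using eval_at_var_nonzerodivisor[of ?G V "zf ?a" "F ?a" p K] inV[OF a] F[OF a] p by (simp add: h_def)
    then show "p \<in> Idl\<^bsub>?S\<^esub> (?I \<union> set (take k (parameters F ns)))" unfolding take eq .
  qed
qed

text \<open>Induction on the number of undecided pairs. Adding the variable \<open>i\<close> decides at least the pair of \<open>i\<close>, and so
  does the colon ideal, in which \<open>c i\<close> is a generator.\<close>
theorem weakly_regular_parameters:
  fixes K :: "'k::field itself"
  assumes X: "X \<subseteq> N" and Y: "Y \<subseteq> N" and XY: "X \<inter> Y = {}" and F: "\<And>a. a \<in> N \<Longrightarrow> F a \<noteq> 0"
    and ns: "distinct ns" "set ns \<subseteq> N"
  shows "weakly_regular (mpoly_ring K V) (nonface_ideal V (nonfaces X Y)) (parameters F ns)"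
  using X Y XY
proof (induction "card (N - X - Y)" arbitrary: X Y rule: less_induct)
  case less
  show ?case
  proof (cases "N - X - Y = {}")
    case True
    then show ?thesis using less.prems by (intro weakly_regular_facet F ns) auto
  next
    case False
    let ?S = "mpoly_ring K V" and ?U = "N - X - Y"
    interpret S: cring ?S by (rule cring_mpoly_ring)
    have fin: "finite ?U" using finite_N by auto
    have "\<exists>i\<in>?U. \<forall>j\<in>?U. j \<noteq> i \<longrightarrow> \<not> (le j i \<and> j \<noteq> i)"
    proof (rule Finite_Set.bex_min_element[OF fin _ _ False])
      show "asymp_on ?U (\<lambda>a b. le a b \<and> a \<noteq> b)" using le_antisym by (intro asymp_onI) auto
      show "transp_on ?U (\<lambda>a b. le a b \<and> a \<noteq> b)"
        by (rule transp_onI) (use le_trans le_antisym in blast)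
    qed
    then obtain i where i: "i \<in> ?U" and min: "\<And>j. j \<in> ?U \<Longrightarrow> le j i \<Longrightarrow> j = i" by blast
    let ?X = "X \<union> {j \<in> ?U. orth i j}" and ?Y = "Y \<union> {j \<in> ?U. le i j}"
    have smaller: "card W < card ?U" if "W \<subseteq> ?U - {i}" for W
      using i fin that by (metis card_Diff1_less card_mono finite_Diff le_less_trans)
    have iV: "i \<in> V" using i by auto
    have "weakly_regular ?S (nonface_ideal V (nonfaces ?X ?Y)) (parameters F ns)"
    proof (rule less.hyps)
      show "card (N - ?X - ?Y) < card ?U" using i le_refl by (intro smaller) auto
      show "?X \<inter> ?Y = {}" using less.prems i orth_down orth_sym orth_irrefl by blast
    qed (use less.prems in auto)
    moreover have "{b \<in> carrier ?S. poly_var i \<otimes>\<^bsub>?S\<^esub> b \<in> nonface_ideal V (nonfaces X Y)} =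
        nonface_ideal V (nonfaces ?X ?Y)"
      unfolding mpoly_ring_simps nonface_ideal_colon[OF iV] by (rule nonfaces_colon[OF less.prems(1,2) i])
    ultimately have 1: "weakly_regular ?S {b \<in> carrier ?S. poly_var i \<otimes>\<^bsub>?S\<^esub> b \<in> nonface_ideal V (nonfaces X Y)} (parameters F ns)" by (simp only:)
    have "weakly_regular ?S (nonface_ideal V (nonfaces (insert i X) Y)) (parameters F ns)"
    proof (rule less.hyps)
      show "card (N - insert i X - Y) < card ?U" by (intro smaller) auto
    qed (use less.prems i in auto)
    moreover have "Idl\<^bsub>?S\<^esub> (nonface_ideal V (nonfaces X Y) \<union> {poly_var i}) = nonface_ideal V (nonfaces (insert i X) Y)"
      unfolding nonface_ideal_insert[OF iV] by (rule nonfaces_insert_minimal[OF less.prems(1,2) i min])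
    ultimately have 2: "weakly_regular ?S (Idl\<^bsub>?S\<^esub> (nonface_ideal V (nonfaces X Y) \<union> {poly_var i})) (parameters F ns)" by (simp only:)
    show ?thesis
    proof (rule S.weakly_regular_colon[OF ideal_nonface_ideal _ _ 1 2])
      show "poly_var i \<in> carrier ?S" using iV by auto
      show "set (parameters F ns) \<subseteq> carrier ?S" using ns(2) by (auto simp: parameters_def intro!: eval_at_mpolys)
    qed
  qed
qed

lemma edge_ideal_eq: "edge_ideal K V (edges N) = nonface_ideal V (nonfaces {} {})"
proof -
  have gens: "{poly_var i * poly_var j |i j. i \<in> V \<and> j \<in> V \<and> {i, j} \<in> edges N} = (\<lambda>e. \<Prod>v\<in>e. poly_var v) ` edges N"
    (is "?A = ?B")
  proof
    have ne: "i \<noteq> j" if "{i, j} \<in> edges N" for i j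
    proof
      assume ij: "i = j"
      from that show False
      proof (cases rule: edges_cases)
        case (le a b)
        then show False using ij c_notin by (auto simp: doubleton_eq_iff)
      next
        case (orth a b)
        then show False using ij orth_irrefl by (auto simp: doubleton_eq_iff)
      qed
    qed
    show "?A \<subseteq> ?B"
    proof clarify
      fix i j assume "{i, j} \<in> edges N"
      then show "poly_var i * poly_var j \<in> ?B" using ne[of i j] by (intro image_eqI[of _ _ "{i, j}"]) auto
    qed
    show "?B \<subseteq> ?A"
    proof clarify
      fix e assume e: "e \<in> edges N"
      then obtain i j where ij: "e = {i, j}" "i \<in> V" "j \<in> V" by (cases rule: edges_cases) auto
      have ij_edge: "{i, j} \<in> edges N" using e ij(1) by blast
      have "(\<Prod>v\<in>e. poly_var v) = poly_var i * poly_var j" unfolding ij(1) using ne[OF ij_edge] by simp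
      then show "\<exists>i j. (\<Prod>v\<in>e. poly_var v) = poly_var i * poly_var j \<and> i \<in> V \<and> j \<in> V \<and> {i, j} \<in> edges N"
        using ij(2,3) ij_edge by blast
    qed
  qed
  have "nonfaces {} {} = edges N" by (simp add: nonfaces_def)
  then show ?thesis unfolding edge_ideal_def gens
    using nonface_ideal_generated[of "edges N" V K] nonfaces_subset[of "{}" "{}"] finite_N by simp
qed

theorem cohen_macaulay_paired_order:
  fixes K :: "'k::field itself"
  shows "cohen_macaulay_graph K V (edges N)"
  unfolding cohen_macaulay_graph_def stanley_reisner_ring_def
proof (rule cring.cohen_macaulay_quotientI[OF cring_mpoly_ring, where n = "card N"])
  let ?S = "mpoly_ring K V"
  let ?I = "edge_ideal K V (edges N)"
  interpret S: cring ?S by (rule cring_mpoly_ring)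
  have finV: "finite V" using finite_N by simp
  show I: "ideal ?I ?S" unfolding edge_ideal_eq by (rule ideal_nonface_ideal)
  show "noetherian_ring ?S" by (rule noetherian_mpoly_ring[OF finV])
  have pair: "poly_var a * poly_var (c a) \<in> ?I" if a: "a \<in> N" for a
  proof -
    have "{a, c a} \<in> nonfaces {} {}" using edges_le[OF a a le_refl[OF a]] by (simp add: nonfaces_def)
    moreover have "a \<noteq> c a" using c_notin[OF a] a by auto
    ultimately show ?thesis using prod_poly_var_nonface[of "{a, c a}" "nonfaces {} {}" V] a
      unfolding edge_ideal_eq by simp
  qed
  have one_of: "poly_var a \<in> Q \<or> poly_var (c a) \<in> Q" if "primeideal Q ?S" "?I \<subseteq> Q" "a \<in> N" for Q a
    using primeideal.I_prime[OF that(1), of "poly_var a" "poly_var (c a)"] pair[OF that(3)] that(2,3) by auto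
  show "k \<le> card N" if C: "\<forall>i\<le>k. primeideal (C i) ?S" "?I \<subseteq> C 0" "\<forall>i<k. C i \<subset> C (Suc i)" for C k
  proof -
    let ?D = "{v \<in> V. poly_var v \<notin> C 0}"
    let ?f = "\<lambda>v. if v \<in> N then v else the_inv_into N c v"
    have inv: "the_inv_into N c (c a) = a" if "a \<in> N" for a using the_inv_into_f_f[OF inj_c that] .
    have no: "poly_var a \<in> C 0 \<or> poly_var (c a) \<in> C 0" if "a \<in> N" for a using one_of[OF _ C(2) that] C(1) by auto
    \<comment> \<open>The map \<open>?f\<close> sends both variables of a pair to its element of \<open>N\<close>, and at most one of them lies outside \<open>C 0\<close>.\<close>
    have "inj_on ?f ?D"
    proof (rule inj_onI)
      fix v w assume "v \<in> ?D" "w \<in> ?D" "?f v = ?f w"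
      then show "v = w" using no[of v] no[of w] inv c_notin by (auto split: if_splits)
    qed
    moreover have "?f ` ?D \<subseteq> N" using inv c_notin by auto
    ultimately have "card ?D \<le> card N" using finite_N by (rule card_inj_on_le)
    then show ?thesis using prime_chain_length[OF finV C(1,3)] by linarith
  qed
  show "\<exists>gs. length gs = card N \<and> set gs \<subseteq> M \<and> weakly_regular ?S ?I gs"
    if M: "maximalideal M ?S" "?I \<subseteq> M" for M
  proof -
    interpret M: maximalideal M ?S by fact
    have "\<exists>f. f \<noteq> 0 \<and> eval_at f (poly_var a + poly_var (c a)) \<in> M" if a: "a \<in> N" for a
    proof -
      have shift: "eval_at f (v + w) \<in> M" if "eval_at f v \<in> M" "w \<in> M" "v \<in> mpolys V" "w \<in> mpolys V" for f v w
      proof -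
        have "eval_at f (v + w) - eval_at f v \<in> M"
          using that by (intro eval_at_cong_mod[OF M.is_ideal]) auto
        then have "(eval_at f (v + w) - eval_at f v) + eval_at f v \<in> M"
          using that(1) M.is_ideal unfolding ideal_mpoly_ring_iff by blast
        then show ?thesis by simp
      qed
      have V: "a \<in> V" "c a \<in> V" using a by auto
      from one_of[OF S.maximalideal_prime[OF M(1)] M(2) a] show ?thesis
      proof
        assume 1: "poly_var a \<in> M"
        obtain f where "f \<noteq> 0" "eval_at f (poly_var (c a)) \<in> M" using variable_algebraic_mod_maximal[OF finV M(1) V(2)] by blast
        then show ?thesis using shift[OF _ 1, of f "poly_var (c a)"] V by (auto simp: add.commute)
      next
        assume 1: "poly_var (c a) \<in> M"
        obtain f where "f \<noteq> 0" "eval_at f (poly_var a) \<in> M" using variable_algebraic_mod_maximal[OF finV M(1) V(1)] by blast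
        then show ?thesis using shift[OF _ 1, of f "poly_var a"] V by auto
      qed
    qed
    then obtain F where F: "\<And>a. a \<in> N \<Longrightarrow> F a \<noteq> 0 \<and> eval_at (F a) (poly_var a + poly_var (c a)) \<in> M" by metis
    obtain ns where ns: "set ns = N" "distinct ns" using finite_distinct_list[OF finite_N] by blast
    have "weakly_regular ?S ?I (parameters F ns)"
      unfolding edge_ideal_eq by (rule weakly_regular_parameters) (use F ns in auto)
    moreover have "length (parameters F ns) = card N" using ns distinct_card[of ns] by (simp add: parameters_def)
    moreover have "set (parameters F ns) \<subseteq> M" using F ns by (auto simp: parameters_def)
    ultimately show ?thesis by blast
  qed
qed

end

section \<open>Boolean posets\<close>

context boolean_poset
begin

lemma bottom_carrier: "\<bottom> \<in> carrier P" and bottom_least: "x \<in> carrier P \<Longrightarrow> \<bottom> \<sqsubseteq> x"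
proof -
  have "least P \<bottom> (carrier P)" unfolding bottom_def by (rule someI_ex[OF ex_bottom])
  then show "\<bottom> \<in> carrier P" "x \<in> carrier P \<Longrightarrow> \<bottom> \<sqsubseteq> x" by (auto simp: least_def)
qed

lemma top_greatest: "x \<in> carrier P \<Longrightarrow> x \<sqsubseteq> \<top>"
proof -
  have "greatest P \<top> (carrier P)" unfolding top_def by (rule someI_ex[OF ex_top])
  then show "x \<in> carrier P \<Longrightarrow> x \<sqsubseteq> \<top>" by (auto simp: greatest_def)
qed

definition disjoint :: "'a \<Rightarrow> 'a \<Rightarrow> bool" where
  "disjoint a b \<longleftrightarrow> Lower P {a, b} = {\<bottom>}"

lemma disjoint_iff:
  "a \<in> carrier P \<Longrightarrow> b \<in> carrier P \<Longrightarrow>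
    disjoint a b \<longleftrightarrow> (\<forall>l\<in>carrier P. l \<sqsubseteq> a \<longrightarrow> l \<sqsubseteq> b \<longrightarrow> l = \<bottom>)"
  using bottom_carrier bottom_least by (auto simp: disjoint_def Lower_def)

lemma disjoint_sym: "disjoint a b \<Longrightarrow> disjoint b a"
  by (simp add: disjoint_def insert_commute)

definition complement :: "'a \<Rightarrow> 'a" where
  "complement a = (SOME b. b \<in> carrier P \<and> is_complement P a b)"

lemma complement:
  assumes "a \<in> carrier P"
  shows "complement a \<in> carrier P" "is_complement P a (complement a)" "is_complement P (complement a) a" "disjoint a (complement a)"
proof -
  have "complement a \<in> carrier P \<and> is_complement P a (complement a)"
    unfolding complement_def by (rule someI_ex) (use complemented[OF assms] in blast)
  then show "complement a \<in> carrier P" "is_complement P a (complement a)" "is_complement P (complement a) a" "disjoint a (complement a)"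
    by (auto simp: is_complement_def disjoint_def insert_commute)
qed

text \<open>Distributivity: \<open>a\<close> lies below the join of \<open>b\<close> and \<open>b'\<close>, so it lies below every upper bound of the common lower
  bounds of \<open>a, b\<close> and of \<open>a, b'\<close>. The latter are trivial, hence \<open>b\<close> is such an upper bound.\<close>
lemma disjoint_complement_imp_le:
  assumes a: "a \<in> carrier P" and b: "b \<in> carrier P" and b': "b' \<in> carrier P"
    and c: "is_complement P b b'" and d: "disjoint a b'"
  shows "a \<sqsubseteq> b"
proof -
  have "a \<in> Lower P ({a} \<union> Upper P {b, b'})"
    using a top_greatest[OF a] c by (auto simp: is_complement_def Lower_def)
  then have "a \<in> Lower P (Upper P (Lower P {a, b} \<union> Lower P {a, b'}))" using distributive[OF a b b'] by simp
  moreover have "b \<in> Upper P (Lower P {a, b} \<union> Lower P {a, b'})"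
    using b d bottom_least[OF b] unfolding disjoint_def Upper_def by (auto simp: Lower_def)
  ultimately show ?thesis using Lower_memD Upper_closed by fast
qed

lemma disjoint_complement_iff_le:
  assumes "a \<in> carrier P" "b \<in> carrier P"
  shows "disjoint a (complement b) \<longleftrightarrow> a \<sqsubseteq> b"
proof
  show "disjoint a (complement b) \<Longrightarrow> a \<sqsubseteq> b"
    using disjoint_complement_imp_le[OF assms complement(1,2)] assms by blast
  assume ab: "a \<sqsubseteq> b"
  have "disjoint b (complement b)" "complement b \<in> carrier P" using complement[OF assms(2)] by auto
  then show "disjoint a (complement b)" using assms ab le_trans[of _ a b] by (auto simp: disjoint_iff)
qed

lemma verts_iff:
  "a \<in> zero_divisor_graph_verts P \<longleftrightarrow> a \<in> carrier P \<and> a \<noteq> \<bottom> \<and> (\<exists>b\<in>carrier P. b \<noteq> \<bottom> \<and> disjoint a b)"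
  by (auto simp: zero_divisor_graph_verts_def zero_divisors_def disjoint_def)

lemma graph_edges_eq:
  "zero_divisor_graph_edges P = {{a, b} | a b. a \<in> zero_divisor_graph_verts P \<and>
     b \<in> zero_divisor_graph_verts P \<and> a \<noteq> b \<and> disjoint a b}"
  by (simp add: zero_divisor_graph_edges_def disjoint_def)

lemma atom_disjoint:
  assumes p: "poset_atom P p" and a: "a \<in> carrier P" "\<not> p \<sqsubseteq> a"
  shows "disjoint p a"
proof -
  have pc: "p \<in> carrier P" using p by (simp add: poset_atom_def)
  have "l = \<bottom>" if l: "l \<in> carrier P" "l \<sqsubseteq> p" "l \<sqsubseteq> a" for l
  proof (rule ccontr)
    assume "l \<noteq> \<bottom>"
    then have "\<bottom> \<sqsubset> l" using bottom_least[OF l(1)] by (simp add: lless_def eq_is_equal)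
    moreover have "l \<sqsubset> p" using l a by (auto simp: lless_def eq_is_equal)
    ultimately show False using p l by (auto simp: poset_atom_def)
  qed
  then show ?thesis using pc a by (simp add: disjoint_iff)
qed

end

text \<open>Every atom \<open>p\<close> presents the graph as the graph of the paired order on the vertices not above \<open>p\<close>.\<close>
theorem cohen_macaulay_zero_divisor_graph:
  fixes K :: "'k::field itself" and P :: "('a, 'm) gorder_scheme"
  assumes "boolean_poset P" and fin: "finite (carrier P)" and p: "poset_atom P p"
  shows "cohen_macaulay_graph K (zero_divisor_graph_verts P) (zero_divisor_graph_edges P)"
proof -
  interpret boolean_poset P by fact
  let ?V = "zero_divisor_graph_verts P"
  define N where "N = {a \<in> ?V. \<not> p \<sqsubseteq>\<^bsub>P\<^esub> a}"
  have pc: "p \<in> carrier P" and p0: "p \<noteq> \<bottom>\<^bsub>P\<^esub>" using p by (auto simp: poset_atom_def lless_def eq_is_equal)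
  have VC: "a \<in> carrier P" "a \<noteq> \<bottom>\<^bsub>P\<^esub>" if "a \<in> ?V" for a using that by (auto simp: verts_iff)
  have NV: "a \<in> ?V" "a \<in> carrier P" "\<not> p \<sqsubseteq>\<^bsub>P\<^esub> a" if "a \<in> N" for a using that VC by (auto simp: N_def)
  have cN: "complement a \<in> ?V" "p \<sqsubseteq>\<^bsub>P\<^esub> complement a" if a: "a \<in> N" for a
  proof -
    note ca = complement[OF NV(2)[OF a]]
    show le: "p \<sqsubseteq>\<^bsub>P\<^esub> complement a"
      using disjoint_complement_imp_le[OF pc ca(1) NV(2)[OF a] ca(3)] atom_disjoint[OF p NV(2,3)] a by blast
    then have "complement a \<noteq> \<bottom>\<^bsub>P\<^esub>" using p0 le_antisym[OF le] bottom_least[OF pc] pc ca(1) by auto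
    then show "complement a \<in> ?V" using ca(1,4) disjoint_sym NV[OF a] VC[of a] by (auto simp: verts_iff)
  qed
  have onto: "\<exists>x\<in>N. y = complement x" if y: "y \<in> ?V" "y \<notin> N" for y
  proof -
    have yc: "y \<in> carrier P" and py: "p \<sqsubseteq>\<^bsub>P\<^esub> y" using y VC by (auto simp: N_def)
    let ?x = "complement y"
    note x = complement[OF yc]
    have px: "\<not> p \<sqsubseteq>\<^bsub>P\<^esub> ?x" using x(1,4) yc py pc p0 by (auto simp: disjoint_iff)
    have x0: "?x \<noteq> \<bottom>\<^bsub>P\<^esub>"
    proof
      assume x0: "?x = \<bottom>\<^bsub>P\<^esub>"
      obtain b where b: "b \<in> carrier P" "b \<noteq> \<bottom>\<^bsub>P\<^esub>" "disjoint y b" using y(1) by (auto simp: verts_iff)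
      have "disjoint b ?x" using b(1) bottom_carrier bottom_least le_antisym x0 by (auto simp: disjoint_iff)
      then have "b \<sqsubseteq>\<^bsub>P\<^esub> y" using disjoint_complement_iff_le b(1) yc by simp
      then show False using b yc by (auto simp: disjoint_iff)
    qed
    have xV: "?x \<in> ?V" using x yc x0 VC(2)[OF y(1)] disjoint_sym by (auto simp: verts_iff)
    have xN: "?x \<in> N" using xV px by (simp add: N_def)
    note cx = complement[OF x(1)]
    have "y \<sqsubseteq>\<^bsub>P\<^esub> complement ?x" by (rule disjoint_complement_imp_le[OF yc cx(1) x(1) cx(3) x(4)])
    moreover have "complement ?x \<sqsubseteq>\<^bsub>P\<^esub> y" by (rule disjoint_complement_imp_le[OF cx(1) yc x(1) x(2) disjoint_sym[OF cx(4)]])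
    ultimately have "y = complement ?x" using le_antisym yc cx(1) by auto
    then show ?thesis using xN by blast
  qed
  interpret PO: paired_order N complement "\<lambda>a b. a \<sqsubseteq>\<^bsub>P\<^esub> b" disjoint
  proof
    show "finite N" using fin by (rule finite_subset[rotated]) (auto dest: NV)
    show "inj_on complement N"
    proof (rule inj_onI)
      fix a b assume ab: "a \<in> N" "b \<in> N" "complement a = complement b"
      then have "a \<sqsubseteq>\<^bsub>P\<^esub> b" "b \<sqsubseteq>\<^bsub>P\<^esub> a" using disjoint_complement_iff_le NV complement(4) by metis+
      then show "a = b" using le_antisym NV ab by auto
    qed
    show "complement a \<notin> N" if "a \<in> N" for a using cN[OF that] NV(3) by blast
    show "\<not> disjoint a a" if "a \<in> N" for a using NV[OF that] VC[of a] by (auto simp: disjoint_iff)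
    show "disjoint d b" if "a \<in> N" "b \<in> N" "d \<in> N" "disjoint a b" "d \<sqsubseteq>\<^bsub>P\<^esub> a" for a b d
      using that NV le_trans[of _ d a] by (auto simp: disjoint_iff)
  qed (use NV le_trans le_antisym disjoint_sym in auto)
  have V: "?V = N \<union> complement ` N"
    using NV(1) cN(1) onto by blast
  have "zero_divisor_graph_edges P = PO.edges N"
  proof
    show "zero_divisor_graph_edges P \<subseteq> PO.edges N"
      unfolding graph_edges_eq
    proof clarify
      fix a b assume ab: "a \<in> ?V" "b \<in> ?V" "disjoint a b"
      have le: "{x, y} \<in> PO.edges N" if "x \<in> N" "y \<in> ?V" "y \<notin> N" "disjoint x y" for x y
      proof -
        obtain z where z: "z \<in> N" "y = complement z" using onto[OF \<open>y \<in> ?V\<close> \<open>y \<notin> N\<close>] by blast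
        then have "x \<sqsubseteq>\<^bsub>P\<^esub> z" using disjoint_complement_iff_le NV that by auto
        then show ?thesis using PO.edges_le[OF that(1) z(1)] z(2) by simp
      qed
      show "{a, b} \<in> PO.edges N"
      proof (cases "a \<in> N"; cases "b \<in> N")
        assume "a \<in> N" "b \<in> N"
        then show ?thesis using PO.edges_orth ab(3) by blast
      next
        assume "a \<in> N" "b \<notin> N"
        then show ?thesis using le ab by blast
      next
        assume "a \<notin> N" "b \<in> N"
        then show ?thesis using le[of b a] ab disjoint_sym by (simp add: insert_commute)
      next
        assume "a \<notin> N" "b \<notin> N"
        then have "p \<sqsubseteq>\<^bsub>P\<^esub> a" "p \<sqsubseteq>\<^bsub>P\<^esub> b" using ab by (auto simp: N_def)
        then show ?thesis using ab VC pc p0 by (auto simp: disjoint_iff)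
      qed
    qed
    show "PO.edges N \<subseteq> zero_divisor_graph_edges P"
    proof
      fix e assume "e \<in> PO.edges N"
      then show "e \<in> zero_divisor_graph_edges P"
      proof (cases rule: PO.edges_cases)
        case (le a b)
        have "disjoint a (complement b)" using le disjoint_complement_iff_le[of a b] NV(2) by blast
        moreover have "a \<noteq> complement b" using cN(2)[OF le(3)] NV(3)[OF le(2)] by auto
        ultimately show ?thesis unfolding graph_edges_eq using le NV(1) cN(1) by blast
      next
        case (orth a b)
        then have "a \<noteq> b" using PO.orth_irrefl by blast
        then show ?thesis unfolding graph_edges_eq using orth NV(1) by blast
      qed
    qed
  qed
  then show ?thesis using PO.cohen_macaulay_paired_order[of K] V by simp
qed

theorem theorem1p2:
  fixes K :: "'k::field itself"
    and P :: "('a, 'm) gorder_scheme"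
  assumes "boolean_poset P"
    and "finite (carrier P)"
    and "card {a. poset_atom P a} \<ge> 2"
  shows "cohen_macaulay_graph K (zero_divisor_graph_verts P) (zero_divisor_graph_edges P)"
proof -
  have "{a. poset_atom P a} \<noteq> {}" using assms(3) by (metis card.empty not_numeral_le_zero)
  then obtain p where "poset_atom P p" by blast
  then show ?thesis using assms(1,2) by (intro cohen_macaulay_zero_divisor_graph)
qed

end
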